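(* Let $\lambda/\mu$ be a skew partition with $\lambda,\mu\in\Lambda$, and put $m=|\lambda/\mu|$. Let $\mathbf a=\{a_1,\dots,a_m\}$ be an $m$-element multiset of elements of $\mathcal K$ such that $0\notin\mathbf a$ if $\mu\neq\varnothing$, and let $T\in\mathrm{DIT}(\lambda/\mu;\mathbf a)$. Let $\omega_1,\dots,\omega_m\in\mathbb C$ be such that $\det J\neq0$, where $$J_{ij}=\frac{\partial}{\partial\omega_j}\sum_{\nu\in M_{i-1}(T)}q_\nu\Omega_\nu,\qquad i,j=1,\dots,m .$$ Then there is a point $x\in\mathcal X(\mathbf a^+)$ with Plücker coordinates $[p_\nu(x)]_{\nu\in\Lambda}$ (suitably scaled) satisfying $$\mathrm{LT}(p_\nu(x))=\Omega_\nu\,u^{\mathrm{val}(T|_{\lambda/\nu})}\qquad\text{for all }\nu\in\Lambda$$ if and only if $$\sum_{\nu\in M_i(T)}q_\nu\Omega_\nu=q_\lambda\,e_i(\mathbf a)\qquad\text{for }0\le i<m .$$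
   Context: Fix integers $0<d<n$, $N=d(n-d)$. $\mathcal K=\bigcup_{r\ge1}\mathbb C((u^{1/r}))$ is the field of Puiseux series. For $g=c_\ell u^\ell+\sum_{r>\ell}c_ru^r$ with $c_\ell\ne0$: $\mathrm{val}(g)=\ell$, $\mathrm{LT}(g)=c_\ell u^\ell$; also $\mathrm{val}(0)=+\infty$, $\mathrm{LT}(0)=0$. Conventions: $u^{+\infty}=0$ and a coefficient of $u^{+\infty}$ is $0$. The norm is $\|g\|=\varepsilon^{\mathrm{val}(g)}$ for a fixed $0<\varepsilon<1$. $\mathcal X=\mathrm{Gr}_d(\mathcal K_{n-1}[z])$ is the Grassmannian of $d$-dimensional subspaces of the space of polynomials over $\mathcal K$ of degree $\le n-1$. For $x$ spanned by $f_1,\dots,f_d$, $\mathrm{Wr}(x;z)=\det(f_j^{(i-1)}(z))_{1\le i,j\le d}$, a nonzero polynomial of degree $\le N$ defined up to scalar. For an $N$-element multiset $\mathbf b$ in $\mathbb P^1(\mathcal K)$, $\mathcal X(\mathbf b)$ is the fibre of the Wronski map over $\prod_{b\in\mathbf b,\,b\ne\infty}(z+b)$. $\Lambda$ is the set of partitions $\lambda=(\lambda_1\ge\dots\ge\lambda_d)$ with $n-d\ge\lambda_1$, $\lambda_d\ge0$, ordered by inclusion of diagrams; $\nu\vdash k$ means $|\nu|=k$. With $J(\lambda)=\{j+\lambda_{d+1-j}:1\le j\le d\}$, the Plücker coordinate $p_\lambda(x)$ (up to a common scalar) is the maximal minor with column set $J(\lambda)$ of the $d\times n$ matrix whose $(i,j)$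 entry is the coefficient of $z^{j-1}$ in $f_i$. Also $q_\lambda=\prod_{1\le i<j\le d}(k_j-k_i)$, where $k_j=j+\lambda_{d+1-j}$. $\mathrm{DIT}(\lambda/\mu;\mathbf a)$ is the set of diagonally increasing tableaux: fillings of the boxes of $\lambda/\mu$ with the elements of the multiset $\mathbf a$ (each used as many times as its multiplicity) such that norms weakly increase along rows and down columns, and norms strictly increase diagonally right-and-downward. For $\mu\le\nu\le\lambda$, $T|_{\lambda/\nu}$ is the part of $T$ in the boxes of $\lambda/\nu$, and $\mathrm{val}(T|_{\lambda/\nu})$ is the sum of the valuations of its entries ($0$ if the shape is empty). $\mathbf a^+$ is the $N$-element multiset obtained from $\mathbf a$ by adding $|\mu|$ copies of $0$ and $N-|\lambda|$ copies of $\infty$. For $0\le i\le m$: $E_i(\mathbf a)=\sum_{k_1<\dots<k_{m-i}}a_{k_1}\cdots a_{k_{m-i}}$ (the elementary symmetric function of degree $m-i$), $\ell_i=\min\mathrm{val}(a_{k_1}\cdots a_{k_{m-i}})$ over all terms of this sum, and $e_i(\mathbf a)\in\mathbb C$ is the coefficient of $u^{\ell_i}$ in $E_i(\mathbf a)$. $M_i(T)$ is the set of $\nu\in\Lambda$ with $\mu\le\nu\le\lambda$, $|\nu|=|\mu|+i$, such that $\mathrm{val}(T|_{\lambda/\nu})\le\mathrm{val}(T|_{\lambda/\nu'})$ for all $\nu'$ with $\mu\le\nu'\le\lambda$, $|\nu'|=|\mu|+i$. Place the variables $\omega_1,\dots,\omega_m$ in the boxes of $\lambda/\mu$ so that $\omega_i$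 is in the box of $T$ containing $a_i$. For $\mu\le\nu\le\lambda$, $\Omega_\nu$ is the product of the $\omega_i$ in boxes outside $\nu$; for all other $\nu\in\Lambda$, $\Omega_\nu=0$ (and then the right-hand side $\Omega_\nu u^{\mathrm{val}(T|_{\lambda/\nu})}$ is $0$).
   Formalization: The equations are required only for those i with ℓ_i finite; this is every i unless 0 is in a. With all i required the claim fails: d=1, n=2, μ=∅, λ=(1), a={0}, ω_1=1, where x=span(z) exists but the i=0 equation reads 1=0. *)

theory Defs
  imports
    "HOL-Analysis.Derivative"
    "HOL-Library.Extended"
    "HOL-Library.Multiset"
    "HOL-Library.FuncSet"
    "HOL-Computational_Algebra.Formal_Laurent_Series"
    "HOL-Computational_Algebra.Polynomial"
    "Jordan_Normal_Form.Determinant"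
begin

section \<open>The field of complex Puiseux series\<close>

text \<open>
  A Puiseux series \<open>\<Sum>q. c q u^q\<close> is given by its coefficient function \<open>c\<close> on the rationals, whose
  support is bounded below and has a common denominator \<open>r\<close>.
\<close>

definition is_puiseux :: "(rat \<Rightarrow> complex) \<Rightarrow> bool" where
  "is_puiseux c \<longleftrightarrow>
     (\<exists>r::nat. r > 0 \<and> (\<exists>l. \<forall>q. c q \<noteq> 0 \<longrightarrow> q * of_nat r \<in> \<int> \<and> l \<le> q))"

definition conv :: "(rat \<Rightarrow> complex) \<Rightarrow> (rat \<Rightarrow> complex) \<Rightarrow> rat \<Rightarrow> complex" where
  "conv f g q = (\<Sum>p | f p \<noteq> 0 \<and> g (q - p) \<noteq> 0. f p * g (q - p))"

text \<open>The series obtained from a Laurent series by substituting \<open>u^(1/r)\<close> for the variable.\<close>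

definition ramify :: "nat \<Rightarrow> complex fls \<Rightarrow> rat \<Rightarrow> complex" where
  "ramify r F q = (if q * of_nat r \<in> \<int> then fls_nth F \<lfloor>q * of_nat r\<rfloor> else 0)"

lemma is_puiseux_ramify:
  assumes "r > 0"
  shows "is_puiseux (ramify r F)"
  unfolding is_puiseux_def
proof (intro exI[of _ r] exI[of _ "of_int (fls_subdegree F) / of_nat r"] conjI allI impI assms)
  fix q assume "ramify r F q \<noteq> 0"
  then have 1: "q * of_nat r \<in> \<int>" and 2: "fls_nth F \<lfloor>q * of_nat r\<rfloor> \<noteq> 0"
    by (auto simp: ramify_def split: if_splits)
  from 1 show "q * of_nat r \<in> \<int>" .
  have "fls_subdegree F \<le> \<lfloor>q * of_nat r\<rfloor>"
    using 2 by (rule fls_subdegree_leI)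
  then have "of_int (fls_subdegree F) \<le> q * of_nat r"
    by (simp add: le_floor_iff)
  then show "of_int (fls_subdegree F) / of_nat r \<le> q"
    using assms by (simp add: field_simps)
qed

lemma ramify_exists:
  assumes "r > 0" and "\<And>q. f q \<noteq> 0 \<Longrightarrow> q * of_nat r \<in> \<int> \<and> l \<le> q"
  shows "\<exists>F. f = ramify r F"
proof -
  define h where "h k = f (of_int k / of_nat r)" for k :: int
  have "\<forall>k < \<lfloor>l * of_nat r\<rfloor>. h k = 0"
  proof (intro allI impI, rule ccontr)
    fix k assume k: "k < \<lfloor>l * of_nat r\<rfloor>" and "h k \<noteq> 0"
    then have "l \<le> of_int k / of_nat r" using assms(2) by (auto simp: h_def)
    then have "l * of_nat r \<le> of_int k" using assms(1) by (simp add: field_simps)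
    then have "\<lfloor>l * of_nat r\<rfloor> \<le> k" by (simp add: floor_le_iff)
    with k show False by simp
  qed
  then have nth: "fls_nth (Abs_fls h) k = h k" for k
    by (rule nth_Abs_fls_lower_bound)
  have "f q = ramify r (Abs_fls h) q" for q
  proof (cases "q * of_nat r \<in> \<int>")
    case True
    then obtain k where "q * of_nat r = of_int k" by (auto elim: Ints_cases)
    moreover from this have "q = of_int k / of_nat r" using assms(1) by (simp add: field_simps)
    ultimately show ?thesis by (simp add: ramify_def nth h_def)
  next
    case False
    then show ?thesis using assms(2)[of q] by (auto simp: ramify_def)
  qed
  then show ?thesis by blast
qed

lemma ramify_times:
  assumes "r > 0"
  shows "conv (ramify r F) (ramify r G) = ramify r (F * G)"
proof
  fix q
  let ?S = "{p. ramify r F p \<noteq> 0 \<and> ramify r G (q - p) \<noteq> 0}"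
  show "conv (ramify r F) (ramify r G) q = ramify r (F * G) q"
  proof (cases "q * of_nat r \<in> \<int>")
    case False
    have "?S = {}"
    proof (rule ccontr)
      assume "?S \<noteq> {}"
      then obtain p where "p * of_nat r \<in> \<int>" "(q - p) * of_nat r \<in> \<int>"
        by (auto simp: ramify_def split: if_splits)
      then have "p * of_nat r + (q - p) * of_nat r \<in> \<int>" by (rule Ints_add)
      with False show False by (simp add: algebra_simps)
    qed
    then have "conv (ramify r F) (ramify r G) q = 0" by (simp only: conv_def sum.empty)
    then show ?thesis using False by (simp add: ramify_def)
  next
    case True
    then obtain k where k: "q * of_nat r = of_int k" by (auto elim: Ints_cases)
    let ?\<iota> = "\<lambda>i::int. (of_int i :: rat) / of_nat r"
    let ?I = "{fls_subdegree F..k - fls_subdegree G}"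
    have inj: "inj_on ?\<iota> ?I" using assms by (auto simp: inj_on_def field_simps)
    have F: "ramify r F (?\<iota> i) = fls_nth F i" for i using assms by (simp add: ramify_def)
    have qi: "(q - ?\<iota> i) * of_nat r = of_int (k - i)" for i
      using k assms by (simp add: left_diff_distrib)
    have G: "ramify r G (q - ?\<iota> i) = fls_nth G (k - i)" for i
      unfolding ramify_def qi by simp
    have sub: "?S \<subseteq> ?\<iota> ` ?I"
    proof
      fix p assume p: "p \<in> ?S"
      then have "p * of_nat r \<in> \<int>" by (auto simp: ramify_def split: if_splits)
      then obtain i where "p * of_nat r = of_int i" by (auto elim: Ints_cases)
      then have i: "p = ?\<iota> i" using assms by (simp add: field_simps)
      have "fls_nth F i \<noteq> 0" "fls_nth G (k - i) \<noteq> 0" using p F G by (auto simp: i)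
      then have "fls_subdegree F \<le> i" "fls_subdegree G \<le> k - i" by (auto intro: fls_subdegree_leI)
      then show "p \<in> ?\<iota> ` ?I" using i by auto
    qed
    have "conv (ramify r F) (ramify r G) q = (\<Sum>p\<in>?\<iota> ` ?I. ramify r F p * ramify r G (q - p))"
      unfolding conv_def by (rule sum.mono_neutral_left) (use sub in auto)
    also have "\<dots> = (\<Sum>i\<in>?I. fls_nth F i * fls_nth G (k - i))"
      by (subst sum.reindex[OF inj]) (simp add: F G)
    also have "\<dots> = fls_nth (F * G) k" by (simp add: fls_times_nth(2))
    also have "\<dots> = ramify r (F * G) q" using k by (simp add: ramify_def)
    finally show ?thesis .
  qed
qed

lemma ramify_add: "ramify r (F + G) q = ramify r F q + ramify r G q"
  by (simp add: ramify_def)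

lemma ramify_uminus: "ramify r (- F) q = - ramify r F q"
  by (simp add: ramify_def)

lemma ramify_1:
  assumes "r > 0"
  shows "ramify r 1 = (\<lambda>q. if q = 0 then 1 else 0)"
proof
  fix q
  show "ramify r 1 q = (if q = 0 then 1 else 0)"
    using assms by (cases "q = 0") (auto simp: ramify_def elim!: Ints_cases)
qed

lemma is_puiseux_common:
  assumes "is_puiseux f" "is_puiseux g" "is_puiseux h"
  obtains r F G H where "r > 0" "f = ramify r F" "g = ramify r G" "h = ramify r H"
proof -
  obtain r1 l1 where 1: "r1 > 0" "\<And>q. f q \<noteq> 0 \<Longrightarrow> q * of_nat r1 \<in> \<int> \<and> l1 \<le> q"
    using assms(1) unfolding is_puiseux_def by metis
  obtain r2 l2 where 2: "r2 > 0" "\<And>q. g q \<noteq> 0 \<Longrightarrow> q * of_nat r2 \<in> \<int> \<and> l2 \<le> q"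
    using assms(2) unfolding is_puiseux_def by metis
  obtain r3 l3 where 3: "r3 > 0" "\<And>q. h q \<noteq> 0 \<Longrightarrow> q * of_nat r3 \<in> \<int> \<and> l3 \<le> q"
    using assms(3) unfolding is_puiseux_def by metis
  let ?r = "r1 * r2 * r3"
  have r: "?r > 0" using 1 2 3 by simp
  have mult: "q * of_nat (s * t) \<in> \<int>" if "q * of_nat s \<in> \<int>" for q :: rat and s t
    using Ints_mult[OF that Ints_of_nat[of t]] by (simp add: mult.assoc)
  have "\<exists>F. f = ramify ?r F"
    by (rule ramify_exists[OF r, of _ l1]) (use 1(2) mult[of _ r1 "r2 * r3"] in \<open>auto simp: mult_ac\<close>)
  moreover have "\<exists>F. g = ramify ?r F"
    by (rule ramify_exists[OF r, of _ l2]) (use 2(2) mult[of _ r2 "r1 * r3"] in \<open>auto simp: mult_ac\<close>)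
  moreover have "\<exists>F. h = ramify ?r F"
    by (rule ramify_exists[OF r, of _ l3]) (use 3(2) mult[of _ r3 "r1 * r2"] in \<open>auto simp: mult_ac\<close>)
  ultimately show ?thesis using that r by metis
qed

typedef puiseux = "{c. is_puiseux c}"
  morphisms pcoeff Abs_puiseux
  using is_puiseux_ramify[of 1 0] by auto

setup_lifting type_definition_puiseux

lift_definition puiseux_of_fls :: "nat \<Rightarrow> complex fls \<Rightarrow> puiseux" is
  "\<lambda>r F. ramify (Suc r) F"
  by (rule is_puiseux_ramify) simp

lemma puiseux_common:
  obtains r F G H where
    "x = puiseux_of_fls r F" "y = puiseux_of_fls r G" "z = puiseux_of_fls r H"
proof -
  obtain r F G H where *: "r > 0" "pcoeff x = ramify r F" "pcoeff y = ramify r G" "pcoeff z = ramify r H"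
    using is_puiseux_common[of "pcoeff x" "pcoeff y" "pcoeff z"] pcoeff by blast
  then obtain s where "r = Suc s" by (cases r) auto
  with * show ?thesis using that[of s F G H]
    by (simp add: pcoeff_inject[symmetric] puiseux_of_fls.rep_eq)
qed

instantiation puiseux :: comm_ring_1
begin

lift_definition zero_puiseux :: puiseux is "\<lambda>q. 0"
  by (auto simp: is_puiseux_def)

lift_definition one_puiseux :: puiseux is "\<lambda>q. if q = 0 then 1 else 0"
  by (auto simp: is_puiseux_def)

lift_definition uminus_puiseux :: "puiseux \<Rightarrow> puiseux" is "\<lambda>f q. - f q"
  by (simp add: is_puiseux_def)

lift_definition plus_puiseux :: "puiseux \<Rightarrow> puiseux \<Rightarrow> puiseux" is "\<lambda>f g q. f q + g q"
proof -
  fix f g :: "rat \<Rightarrow> complex" assume "is_puiseux f" "is_puiseux g"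
  from is_puiseux_common[OF this this(1)] obtain r F G
    where "r > 0" "f = ramify r F" "g = ramify r G" by metis
  then show "is_puiseux (\<lambda>q. f q + g q)"
    using is_puiseux_ramify[of r "F + G"] by (simp add: ramify_add[abs_def])
qed

lift_definition times_puiseux :: "puiseux \<Rightarrow> puiseux \<Rightarrow> puiseux" is conv
proof -
  fix f g :: "rat \<Rightarrow> complex" assume "is_puiseux f" "is_puiseux g"
  from is_puiseux_common[OF this this(1)] obtain r F G
    where "r > 0" "f = ramify r F" "g = ramify r G" by metis
  then show "is_puiseux (conv f g)"
    by (simp add: ramify_times is_puiseux_ramify)
qed

definition minus_puiseux :: "puiseux \<Rightarrow> puiseux \<Rightarrow> puiseux" where
  "f - g = f + - (g :: puiseux)"

lemma puiseux_of_fls_hom: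
  "puiseux_of_fls r F + puiseux_of_fls r G = puiseux_of_fls r (F + G)"
  "puiseux_of_fls r F * puiseux_of_fls r G = puiseux_of_fls r (F * G)"
  "- puiseux_of_fls r F = puiseux_of_fls r (- F)"
  "0 = puiseux_of_fls r 0"
  "1 = puiseux_of_fls r 1"
  by (simp_all add: pcoeff_inject[symmetric] fun_eq_iff puiseux_of_fls.rep_eq plus_puiseux.rep_eq
      times_puiseux.rep_eq uminus_puiseux.rep_eq zero_puiseux.rep_eq one_puiseux.rep_eq
      ramify_add ramify_times ramify_uminus ramify_1 del: of_nat_Suc)
     (simp add: ramify_def)

instance
proof
  fix a b c :: puiseux
  obtain r F G H where *: "a = puiseux_of_fls r F" "b = puiseux_of_fls r G" "c = puiseux_of_fls r H"
    by (rule puiseux_common)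
  show "a + b + c = a + (b + c)" "a + b = b + a" "a * b * c = a * (b * c)" "a * b = b * a"
    "(a + b) * c = a * c + b * c"
    unfolding * by (simp_all add: puiseux_of_fls_hom algebra_simps)
  show "0 + a = a" unfolding * puiseux_of_fls_hom(4)[of r] by (simp add: puiseux_of_fls_hom(1))
  show "1 * a = a" unfolding * puiseux_of_fls_hom(5)[of r] by (simp add: puiseux_of_fls_hom(2))
  show "- a + a = 0" unfolding * puiseux_of_fls_hom(4)[of r] by (simp add: puiseux_of_fls_hom(1,3))
  show "a - b = a + - b" by (rule minus_puiseux_def)
  show "(0::puiseux) \<noteq> 1" by transfer (auto dest: fun_cong[of _ _ 0])
qed

end

instantiation puiseux :: field
begin

definition inverse_puiseux :: "puiseux \<Rightarrow> puiseux" where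
  "inverse (f :: puiseux) = (if f = 0 then 0 else SOME g. f * g = 1)"

definition divide_puiseux :: "puiseux \<Rightarrow> puiseux \<Rightarrow> puiseux" where
  "(f :: puiseux) div g = f * inverse g"

instance
proof
  fix f g :: puiseux
  show "inverse f * f = 1" if "f \<noteq> 0"
  proof -
    obtain r F where f: "f = puiseux_of_fls r F" using puiseux_common by metis
    with that have "F \<noteq> 0" using puiseux_of_fls_hom(4) by metis
    then have "f * puiseux_of_fls r (inverse F) = 1"
      by (simp add: f puiseux_of_fls_hom(2) puiseux_of_fls_hom(5)[of r])
    then have "f * (SOME g. f * g = 1) = 1" by (rule someI)
    then show ?thesis using that by (simp add: inverse_puiseux_def mult.commute)
  qed
  show "f div g = f * inverse g" by (rule divide_puiseux_def)
  show "inverse (0::puiseux) = 0" by (simp add: inverse_puiseux_def)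
qed

end

text \<open>The monomial \<open>c u^v\<close>; the convention is \<open>u^\<infinity> = 0\<close>.\<close>

lift_definition fin_monom :: "complex \<Rightarrow> rat \<Rightarrow> puiseux" is "\<lambda>c v q. if q = v then c else 0"
proof -
  fix c :: complex and v :: rat
  obtain a b where ab: "v = of_int a / of_int b" "b > 0"
    by (cases v) (auto simp: Fract_of_int_quotient)
  then have "v * of_nat (nat b) = of_int a" by simp
  then have "v * of_nat (nat b) \<in> \<int>" by simp
  then show "is_puiseux (\<lambda>q. if q = v then c else 0)"
    unfolding is_puiseux_def using \<open>b > 0\<close>
    by (intro exI[of _ "nat b"] exI[of _ v] conjI) auto
qed

definition pmonom :: "complex \<Rightarrow> rat extended \<Rightarrow> puiseux" where
  "pmonom c v = (case v of Fin q \<Rightarrow> fin_monom c q | _ \<Rightarrow> 0)"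

definition coeff_at :: "puiseux \<Rightarrow> rat extended \<Rightarrow> complex" where
  "coeff_at g v = (case v of Fin q \<Rightarrow> pcoeff g q | _ \<Rightarrow> 0)"

definition val :: "puiseux \<Rightarrow> rat extended" where
  "val g = (if g = 0 then Pinf else Fin (LEAST q. pcoeff g q \<noteq> 0))"

lemma val_least:
  assumes "g \<noteq> 0"
  shows "\<exists>v. val g = Fin v \<and> pcoeff g v \<noteq> 0 \<and> (\<forall>q. pcoeff g q \<noteq> 0 \<longrightarrow> v \<le> q)"
proof -
  obtain r F where g: "g = puiseux_of_fls r F" using puiseux_common by metis
  with assms have F: "F \<noteq> 0" using puiseux_of_fls_hom(4) by metis
  define v where "v = (of_int (fls_subdegree F) / of_nat (Suc r) :: rat)"
  have v: "pcoeff g v \<noteq> 0"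
    using F by (simp add: g puiseux_of_fls.rep_eq ramify_def v_def del: of_nat_Suc)
  have least: "v \<le> q" if "pcoeff g q \<noteq> 0" for q
  proof -
    have "fls_nth F \<lfloor>q * of_nat (Suc r)\<rfloor> \<noteq> 0"
      using that by (auto simp: g puiseux_of_fls.rep_eq ramify_def split: if_splits)
    then have "fls_subdegree F \<le> \<lfloor>q * of_nat (Suc r)\<rfloor>" by (rule fls_subdegree_leI)
    then show ?thesis by (simp add: v_def le_floor_iff field_simps del: of_nat_Suc)
  qed
  have "(LEAST q. pcoeff g q \<noteq> 0) = v" by (rule Least_equality) (use v least in auto)
  then show ?thesis using assms v least by (auto simp: val_def)
qed

definition LT :: "puiseux \<Rightarrow> puiseux" where
  "LT g = pmonom (coeff_at g (val g)) (val g)"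

definition pnorm :: "real \<Rightarrow> puiseux \<Rightarrow> real" where
  "pnorm \<epsilon> g = (case val g of Fin v \<Rightarrow> \<epsilon> powr of_rat v | _ \<Rightarrow> 0)"


section \<open>The Grassmannian and the Wronski map\<close>

global_interpretation poly_vs:
  vector_space "Polynomial.smult :: 'a::field \<Rightarrow> 'a poly \<Rightarrow> 'a poly"
  by unfold_locales (simp_all add: smult_add_right smult_add_left)

definition Gr :: "nat \<Rightarrow> nat \<Rightarrow> puiseux poly set set" where
  "Gr d n = {x. poly_vs.subspace x \<and> x \<subseteq> {p. degree p \<le> n - 1} \<and> poly_vs.dim x = d}"

text \<open>
  A family \<open>f 0, \<dots>, f (d - 1)\<close> spanning a \<open>d\<close>-dimensional \<open>x\<close> is automatically a basis.
\<close>

definition spans :: "nat \<Rightarrow> (nat \<Rightarrow> puiseux poly) \<Rightarrow> puiseux poly set \<Rightarrow> bool" where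
  "spans d f x \<longleftrightarrow> poly_vs.span (f ` {..<d}) = x"

definition wronskian :: "nat \<Rightarrow> (nat \<Rightarrow> puiseux poly) \<Rightarrow> puiseux poly" where
  "wronskian d f = Determinant.det (Matrix.mat d d (\<lambda>(i, j). (pderiv ^^ i) (f j)))"

datatype 'a proj_line = Point 'a | Infinity

definition root_factor :: "puiseux proj_line \<Rightarrow> puiseux poly" where
  "root_factor b = (case b of Point c \<Rightarrow> [:c, 1:] | Infinity \<Rightarrow> 1)"

text \<open>The Wronskian of \<open>x\<close> is only defined up to a nonzero scalar \<open>c\<close>.\<close>

definition wronski_fibre ::
    "nat \<Rightarrow> nat \<Rightarrow> puiseux proj_line multiset \<Rightarrow> puiseux poly set set" where
  "wronski_fibre d n b =
     {x \<in> Gr d n. \<exists>f c. c \<noteq> 0 \<and> spans d f x \<and>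
        wronskian d f = Polynomial.smult c (\<Prod>\<^sub># (image_mset root_factor b))}"


section \<open>Partitions and Pluecker coordinates\<close>

text \<open>
  Partitions are lists of length \<open>d\<close>. Everything is indexed from \<open>0\<close>, so \<open>nu ! i\<close> is the \<open>(i+1)\<close>-st
  part, and the boxes of a diagram are pairs (row, column) starting at \<open>(0, 0)\<close>.
\<close>

definition partitions :: "nat \<Rightarrow> nat \<Rightarrow> nat list set" where
  "partitions d n = {nu. length nu = d \<and> sorted_wrt (\<ge>) nu \<and> (\<forall>k\<in>set nu. k \<le> n - d)}"

definition diagram :: "nat list \<Rightarrow> (nat \<times> nat) set" where
  "diagram nu = {(i, j). i < length nu \<and> j < nu ! i}"

definition part_le :: "nat list \<Rightarrow> nat list \<Rightarrow> bool"  (infix \<open>\<preceq>\<close> 50) where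
  "mu \<preceq> nu \<longleftrightarrow> diagram mu \<subseteq> diagram nu"

definition skew :: "nat list \<Rightarrow> nat list \<Rightarrow> (nat \<times> nat) set" where
  "skew lam mu = diagram lam - diagram mu"

text \<open>
  \<open>kcol d nu j\<close> is the number \<open>k\<^sub>j\<^sub>+\<^sub>1\<close>, the \<open>(j+1)\<close>-st element of \<open>J(nu)\<close> in increasing order.
\<close>

definition kcol :: "nat \<Rightarrow> nat list \<Rightarrow> nat \<Rightarrow> nat" where
  "kcol d nu j = (j + 1) + nu ! (d - (j + 1))"

definition minor :: "nat \<Rightarrow> (nat \<Rightarrow> puiseux poly) \<Rightarrow> nat list \<Rightarrow> puiseux" where
  "minor d f nu =
     Determinant.det (Matrix.mat d d (\<lambda>(i, j). Polynomial.coeff (f i) (kcol d nu j - 1)))"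

definition plucker_coords ::
    "nat \<Rightarrow> nat \<Rightarrow> puiseux poly set \<Rightarrow> (nat list \<Rightarrow> puiseux) \<Rightarrow> bool" where
  "plucker_coords d n x p \<longleftrightarrow>
     (\<exists>f c. c \<noteq> 0 \<and> spans d f x \<and> (\<forall>nu\<in>partitions d n. p nu = c * minor d f nu))"

definition q_coef :: "nat \<Rightarrow> nat list \<Rightarrow> complex" where
  "q_coef d nu = (\<Prod>j<d. \<Prod>i<j. of_nat (kcol d nu j) - of_nat (kcol d nu i))"


section \<open>Diagonally increasing tableaux\<close>

definition DIT ::
    "real \<Rightarrow> nat list \<Rightarrow> nat list \<Rightarrow> puiseux multiset \<Rightarrow> (nat \<times> nat \<Rightarrow> puiseux) set" where
  "DIT \<epsilon> lam mu A = {T \<in> extensional (skew lam mu).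
     image_mset T (mset_set (skew lam mu)) = A \<and>
     (\<forall>i j j'. (i, j) \<in> skew lam mu \<and> (i, j') \<in> skew lam mu \<and> j < j' \<longrightarrow>
        pnorm \<epsilon> (T (i, j)) \<le> pnorm \<epsilon> (T (i, j'))) \<and>
     (\<forall>i i' j. (i, j) \<in> skew lam mu \<and> (i', j) \<in> skew lam mu \<and> i < i' \<longrightarrow>
        pnorm \<epsilon> (T (i, j)) \<le> pnorm \<epsilon> (T (i', j))) \<and>
     (\<forall>i j k. (i, j) \<in> skew lam mu \<and> (i + k, j + k) \<in> skew lam mu \<and> 0 < k \<longrightarrow>
        pnorm \<epsilon> (T (i, j)) < pnorm \<epsilon> (T (i + k, j + k)))}"

definition val_tab :: "(nat \<times> nat \<Rightarrow> puiseux) \<Rightarrow> nat list \<Rightarrow> nat list \<Rightarrow> rat extended" where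
  "val_tab T lam nu = (\<Sum>b\<in>skew lam nu. val (T b))"

definition M_set ::
    "nat \<Rightarrow> nat \<Rightarrow> nat list \<Rightarrow> nat list \<Rightarrow> (nat \<times> nat \<Rightarrow> puiseux) \<Rightarrow> nat \<Rightarrow> nat list set" where
  "M_set d n lam mu T i =
     {nu \<in> partitions d n. mu \<preceq> nu \<and> nu \<preceq> lam \<and> sum_list nu = sum_list mu + i \<and>
        (\<forall>nu'\<in>partitions d n. mu \<preceq> nu' \<and> nu' \<preceq> lam \<and> sum_list nu' = sum_list mu + i \<longrightarrow>
           val_tab T lam nu \<le> val_tab T lam nu')}"

text \<open>
  A multiset \<open>{a\<^sub>1, \<dots>, a\<^sub>m}\<close> is listed as \<open>a 0, \<dots>, a (m - 1)\<close>, and \<open>pos k\<close> is the box containing the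
  \<open>k\<close>-th element (the box in which the \<open>k\<close>-th variable is placed).
\<close>

definition Omega ::
    "nat list \<Rightarrow> nat list \<Rightarrow> nat \<Rightarrow> (nat \<Rightarrow> nat \<times> nat) \<Rightarrow> (nat \<Rightarrow> complex) \<Rightarrow> nat list \<Rightarrow> complex" where
  "Omega lam mu m pos \<omega> nu =
     (if mu \<preceq> nu \<and> nu \<preceq> lam then \<Prod>k | k < m \<and> pos k \<notin> diagram nu. \<omega> k else 0)"

definition elem_sym :: "nat \<Rightarrow> (nat \<Rightarrow> puiseux) \<Rightarrow> nat \<Rightarrow> puiseux" where
  "elem_sym m a i = (\<Sum>S | S \<subseteq> {..<m} \<and> card S = m - i. \<Prod>k\<in>S. a k)"

definition ell :: "nat \<Rightarrow> (nat \<Rightarrow> puiseux) \<Rightarrow> nat \<Rightarrow> rat extended" where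
  "ell m a i = Min ((\<lambda>S. val (\<Prod>k\<in>S. a k)) ` {S. S \<subseteq> {..<m} \<and> card S = m - i})"

text \<open>
  \<open>ell m a i = \<infinity>\<close> happens exactly when every term of the \<open>i\<close>-th elementary symmetric function
  vanishes, i.e. when more than \<open>i\<close> of the \<open>a k\<close> are \<open>0\<close>. Then all \<open>val_tab T lam nu\<close> with
  \<open>mu \<preceq> nu \<preceq> lam\<close> and \<open>|nu| = |mu| + i\<close> are \<open>\<infinity>\<close> too, the prescribed leading terms of the
  corresponding Pluecker coordinates are \<open>0\<close> for every choice of the variables, and there is no
  leading coefficient of order \<open>i\<close> to compare. The system of leading-coefficient equations
  therefore consists of those \<open>i\<close> with \<open>ell m a i \<noteq> \<infinity>\<close>; if no \<open>a k\<close> is \<open>0\<close>, these are all \<open>i\<close>.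
\<close>

definition e_coef :: "nat \<Rightarrow> (nat \<Rightarrow> puiseux) \<Rightarrow> nat \<Rightarrow> complex" where
  "e_coef m a i = coeff_at (elem_sym m a i) (ell m a i)"

definition a_plus ::
    "nat \<Rightarrow> nat \<Rightarrow> nat list \<Rightarrow> nat list \<Rightarrow> puiseux multiset \<Rightarrow> puiseux proj_line multiset" where
  "a_plus d n lam mu A =
     image_mset Point A + replicate_mset (sum_list mu) (Point 0) +
     replicate_mset (d * (n - d) - sum_list lam) Infinity"

definition lead_sum ::
    "nat \<Rightarrow> nat \<Rightarrow> nat list \<Rightarrow> nat list \<Rightarrow> nat \<Rightarrow> (nat \<times> nat \<Rightarrow> puiseux) \<Rightarrow> (nat \<Rightarrow> nat \<times> nat) \<Rightarrow>
     nat \<Rightarrow> (nat \<Rightarrow> complex) \<Rightarrow> complex" where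
  "lead_sum d n lam mu m T pos i \<omega> =
     (\<Sum>nu\<in>M_set d n lam mu T i. q_coef d nu * Omega lam mu m pos \<omega> nu)"

text \<open>The partial derivative in the \<open>j\<close>-th variable is the derivative in that variable alone.\<close>

definition jacobian ::
    "nat \<Rightarrow> nat \<Rightarrow> nat list \<Rightarrow> nat list \<Rightarrow> nat \<Rightarrow> (nat \<times> nat \<Rightarrow> puiseux) \<Rightarrow> (nat \<Rightarrow> nat \<times> nat) \<Rightarrow>
     (nat \<Rightarrow> complex) \<Rightarrow> complex Matrix.mat" where
  "jacobian d n lam mu m T pos \<omega> =
     Matrix.mat m m (\<lambda>(i, j). deriv (\<lambda>t. lead_sum d n lam mu m T pos i (\<omega>(j := t))) (\<omega> j))"

end

(*
  The open Richardson variety of points with p_nu = 0 outside mu <= nu <= lam is parametrized by one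
  variable x_b for each box b of lam/mu: the r-th spanning polynomial (row_polys counted from 0) is the
  sum over mu_r <= k <= lam_r of z^(k + d - 1 - r) times the product of the x_b over the boxes b of
  row r in columns k, ..., lam_r - 1. In the Leibniz expansion of the minor p_nu, the identity
  permutation contributes exactly the product of the x_b over lam/nu. Any other nonzero term arises
  from it by moving boxes to the north-west along their diagonals, so by the diagonal condition on T
  it has larger valuation as soon as val(x_b) = val(T(b)).

  Since Wr(x; z) is the sum of q_nu p_nu(x) z^|nu|, lying in the fibre means m polynomial equations
  in the variables x_b. Their reductions are the equations for the leading coefficients, because the
  least valuation of T on lam/nu with |nu| = |mu| + i equals l_i: the boxes with the i largest
  valuations can be chosen so as to form a partition together with mu. As det J does not vanish, a
  solution of the reduced system lifts by Hensel's lemma for power series in a root of u.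
*)

theory Submission
  imports Defs
begin

section \<open>Valuations of Puiseux series\<close>

text \<open>Two obstacles shape the argument. First, entries of \<open>a\<close> may be zero, so
  \<open>ell m a i\<close> may be infinite. Then both sides of the i-th equation vanish identically
  on the parametrized points, and only the Jacobian still has a row for it; a substitute equation
  keeps the system square. Second, a leading term with coefficient 0 and finite exponent says that
  the series is zero, not that it starts later. A lifted solution therefore has the right leading
  terms only if \<open>\<omega> k\<close> is nonzero whenever \<open>a k\<close> is; this is
  extracted from one of the reduced equations.

  Each variable is written as \<open>u^(val (a k))\<close> times \<open>\<omega> k + Y k\<close>
  with \<open>Y k\<close> in the maximal ideal, and the i-th equation is divided by
  \<open>u^(ell m a i)\<close>. All coefficients become integral, and a nonzero constant term is
  left only for the identity permutation and minimal partitions.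

  The direction from a point to the equations needs no parametrization: the top Wronskian
  coefficient fixes the unknown scalars, and then the coefficients of \<open>u^(ell m a i)\<close>
  are compared.\<close>

lemma pcoeff_0 [simp]: "pcoeff 0 q = 0"
  by (simp add: zero_puiseux.rep_eq)

lemma pcoeff_1: "pcoeff 1 q = (if q = 0 then 1 else 0)"
  by (simp add: one_puiseux.rep_eq)

lemma pcoeff_add [simp]: "pcoeff (f + g) q = pcoeff f q + pcoeff g q"
  by (simp add: plus_puiseux.rep_eq)

lemma pcoeff_sum [simp]: "pcoeff (\<Sum>i\<in>A. f i) q = (\<Sum>i\<in>A. pcoeff (f i) q)"
  by (induction A rule: infinite_finite_induct) auto

lemma puiseux_eqI: "(\<And>q. pcoeff f q = pcoeff g q) \<Longrightarrow> f = g"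
  by (simp add: pcoeff_inject[symmetric] fun_eq_iff)

text \<open>A lower bound on the order is stable under sums: unlike an equation for
  \<open>val\<close>, it survives cancellation and includes the zero series.\<close>

definition ord_ge :: "puiseux \<Rightarrow> rat \<Rightarrow> bool" where
  "ord_ge g w \<longleftrightarrow> (\<forall>q<w. pcoeff g q = 0)"

lemma ord_ge_0 [simp]: "ord_ge 0 w"
  by (simp add: ord_ge_def)

lemma ord_ge_sum: "(\<And>i. i \<in> A \<Longrightarrow> ord_ge (f i) w) \<Longrightarrow> ord_ge (\<Sum>i\<in>A. f i) w"
  by (auto simp: ord_ge_def)

lemma ord_ge_mono: "ord_ge g w \<Longrightarrow> v \<le> w \<Longrightarrow> ord_ge g v"
  by (auto simp: ord_ge_def)

text \<open>At exponent \<open>v + w\<close> the convolution has \<open>v\<close> as its only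
  possible index: smaller ones are excluded by \<open>f\<close>, larger ones by \<open>g\<close>.
  Lowest coefficients therefore multiply even when one of them is zero.\<close>

lemma
  assumes f: "ord_ge f v" and g: "ord_ge g w"
  shows ord_ge_mult: "ord_ge (f * g) (v + w)"
    and pcoeff_mult_low: "pcoeff (f * g) (v + w) = pcoeff f v * pcoeff g w"
proof -
  have S: "v \<le> p \<and> w \<le> q - p" if "pcoeff f p \<noteq> 0" "pcoeff g (q - p) \<noteq> 0" for p q
    using that f g unfolding ord_ge_def by (meson not_le)
  show "ord_ge (f * g) (v + w)"
    unfolding ord_ge_def times_puiseux.rep_eq conv_def
    by (intro allI impI sum.neutral) (use S in force)
  let ?S = "{p. pcoeff f p \<noteq> 0 \<and> pcoeff g (v + w - p) \<noteq> 0}"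
  have "?S \<subseteq> {v}" using S[of _ "v + w"] by force
  then have "(\<Sum>p\<in>?S. pcoeff f p * pcoeff g (v + w - p))
      = (\<Sum>p\<in>{v}. pcoeff f p * pcoeff g (v + w - p))"
    by (intro sum.mono_neutral_left) auto
  then show "pcoeff (f * g) (v + w) = pcoeff f v * pcoeff g w"
    by (simp add: times_puiseux.rep_eq conv_def)
qed

lemma val_0 [simp]: "val 0 = Pinf"
  by (simp add: val_def)

lemma val_eq_Pinf [simp]: "val g = Pinf \<longleftrightarrow> g = 0"
  by (auto simp: val_def)

lemma val_eq_FinD:
  assumes "val g = Fin v"
  shows "g \<noteq> 0" "ord_ge g v" "pcoeff g v \<noteq> 0"
proof -
  show g: "g \<noteq> 0" using assms by auto
  show "ord_ge g v" "pcoeff g v \<noteq> 0"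
    using val_least[OF g] assms by (force simp: ord_ge_def)+
qed

lemma val_eqI:
  assumes "ord_ge g v" "pcoeff g v \<noteq> 0"
  shows "val g = Fin v"
proof -
  have "g \<noteq> 0" using assms(2) by auto
  then obtain w where w: "val g = Fin w" "pcoeff g w \<noteq> 0" "\<And>q. pcoeff g q \<noteq> 0 \<Longrightarrow> w \<le> q"
    using val_least by blast
  have "w \<le> v" using w(3) assms(2) by blast
  moreover have "\<not> w < v" using w(2) assms(1) by (auto simp: ord_ge_def)
  ultimately show ?thesis using w(1) by simp
qed

lemma val_neq_Minf [simp]: "val g \<noteq> Minf"
  by (auto simp: val_def)

lemma val_cases:
  obtains "g = 0" | v where "val g = Fin v"
  by (cases "val g") auto

lemma val_mult: "val (f * g) = val f + val g"
proof (cases f rule: val_cases)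
  case 1
  then show ?thesis by (cases g rule: val_cases) auto
next
  case f: (2 v)
  show ?thesis
  proof (cases g rule: val_cases)
    case 1
    then show ?thesis using f by auto
  next
    case g: (2 w)
    have "val (f * g) = Fin (v + w)"
      by (intro val_eqI ord_ge_mult)
        (simp_all add: pcoeff_mult_low val_eq_FinD[OF f] val_eq_FinD[OF g])
    then show ?thesis using f g by simp
  qed
qed

lemma val_1: "val 1 = 0"
  by (simp add: zero_extended_def val_eqI pcoeff_1 ord_ge_def)

lemma val_prod: "val (\<Prod>i\<in>A. f i) = (\<Sum>i\<in>A. val (f i))"
  by (induction A rule: infinite_finite_induct) (auto simp: val_1 val_mult)

lemma ord_ge_if_val_ge: "Fin w \<le> val g \<Longrightarrow> ord_ge g w"
  by (cases g rule: val_cases) (auto intro: ord_ge_mono[OF val_eq_FinD(2)])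

lemma pcoeff_fin_monom: "pcoeff (fin_monom c v) q = (if q = v then c else 0)"
  by (simp add: fin_monom.rep_eq)

lemma fin_monom_0 [simp]: "fin_monom 0 v = 0"
  by (rule puiseux_eqI) (simp add: pcoeff_fin_monom)

lemma fin_monom_mult: "fin_monom a v * fin_monom b w = fin_monom (a * b) (v + w)"
proof (rule puiseux_eqI)
  fix q
  have "{p. pcoeff (fin_monom a v) p \<noteq> 0 \<and> pcoeff (fin_monom b w) (q - p) \<noteq> 0} =
      (if a \<noteq> 0 \<and> b \<noteq> 0 \<and> q = v + w then {v} else {})"
    by (auto simp: pcoeff_fin_monom split: if_splits)
  then show "pcoeff (fin_monom a v * fin_monom b w) q = pcoeff (fin_monom (a * b) (v + w)) q"
    by (auto simp: times_puiseux.rep_eq conv_def pcoeff_fin_monom)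
qed

lemma pcoeff_fin_monom_mult: "pcoeff (fin_monom c v * g) q = c * pcoeff g (q - v)"
proof -
  have "{p. pcoeff (fin_monom c v) p \<noteq> 0 \<and> pcoeff g (q - p) \<noteq> 0} =
      (if c \<noteq> 0 \<and> pcoeff g (q - v) \<noteq> 0 then {v} else {})"
    by (auto simp: pcoeff_fin_monom split: if_splits)
  then show ?thesis by (auto simp: times_puiseux.rep_eq conv_def pcoeff_fin_monom)
qed

lemma fin_monom_1_0: "fin_monom 1 0 = 1"
  by (rule puiseux_eqI) (simp add: pcoeff_fin_monom pcoeff_1)

lemma fin_monom_prod: "(\<Prod>i\<in>A. fin_monom 1 (f i)) = fin_monom 1 (\<Sum>i\<in>A. f i)"
  by (induction A rule: infinite_finite_induct) (auto simp: fin_monom_1_0 fin_monom_mult)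

lemma fin_monom_add: "fin_monom (a + b) v = fin_monom a v + fin_monom b v"
  by (rule puiseux_eqI) (simp add: pcoeff_fin_monom)

lemma fin_monom_eq_0 [simp]: "fin_monom c v = 0 \<longleftrightarrow> c = 0"
  by (metis fin_monom_0 pcoeff_0 pcoeff_fin_monom)

lemma of_nat_puiseux: "of_nat k = fin_monom (of_nat k) 0"
proof (induction k)
  case (Suc k)
  then show ?case by (simp add: fin_monom_add fin_monom_1_0)
qed simp

lemma fin_monom_minus: "- fin_monom a v = fin_monom (- a) v"
  by (metis add.right_inverse fin_monom_0 fin_monom_add neg_eq_iff_add_eq_0)

lemma of_int_puiseux: "of_int k = fin_monom (of_int k) 0"
proof (cases k rule: int_diff_cases)
  case (diff a b)
  have "of_int k = of_nat a + - (of_nat b :: puiseux)" by (simp add: diff)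
  also have "\<dots> = fin_monom (of_nat a + - of_nat b) 0"
    by (simp only: of_nat_puiseux fin_monom_minus fin_monom_add)
  finally show ?thesis by (simp add: diff)
qed

lemma LT_nz: "val g = Fin v \<Longrightarrow> LT g = fin_monom (pcoeff g v) v"
  by (simp add: LT_def pmonom_def coeff_at_def)

lemma LT_0 [simp]: "LT 0 = 0"
  by (simp add: LT_def pmonom_def)

lemma LT_eq_0 [simp]: "LT g = 0 \<longleftrightarrow> g = 0"
  by (cases g rule: val_cases) (auto simp: LT_nz val_eq_FinD)

lemma pmonom_0 [simp]: "pmonom 0 v = 0" "pmonom c Pinf = 0"
  by (auto simp: pmonom_def split: extended.splits)

text \<open>Turns prescribed leading terms into statements about coefficients, which are additive.
  For \<open>c = 0\<close> the hypothesis forces \<open>g = 0\<close>, and both conclusions still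
  hold.\<close>

lemma LT_eq_monomD:
  assumes "LT g = pmonom c (Fin w)"
  shows "ord_ge g w" "pcoeff g w = c"
proof -
  have "ord_ge g w \<and> pcoeff g w = c"
  proof (cases g rule: val_cases)
    case 1
    then have "fin_monom c w = 0" using assms by (simp add: pmonom_def)
    then show ?thesis using 1 by simp
  next
    case (2 v)
    then have eq: "fin_monom (pcoeff g v) v = fin_monom c w"
      using assms by (simp add: pmonom_def LT_nz)
    from arg_cong[OF this, of "\<lambda>h. pcoeff h v"] have "v = w"
      using val_eq_FinD(3)[OF 2] by (auto simp: pcoeff_fin_monom split: if_splits)
    with eq show ?thesis using val_eq_FinD[OF 2]
      by (metis pcoeff_fin_monom)
  qed
  then show "ord_ge g w" "pcoeff g w = c" by auto
qed

text \<open>For \<open>c = 0\<close> the conclusion would force \<open>g = 0\<close>, whereas the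
  first two assumptions would only say that \<open>g\<close> starts above \<open>w\<close>.\<close>

lemma LT_eq_monomI:
  assumes "ord_ge g w" "pcoeff g w = c" "c \<noteq> 0"
  shows "LT g = pmonom c (Fin w)"
  using LT_nz[OF val_eqI[OF assms(1)]] assms by (simp add: pmonom_def)

section \<open>Integral Puiseux series as power series in a root of u\<close>

definition puiseux_of_fps :: "nat \<Rightarrow> complex fps \<Rightarrow> puiseux" where
  "puiseux_of_fps r F = puiseux_of_fls r (fps_to_fls F)"

lemma puiseux_of_fps_hom:
  "puiseux_of_fps r (F + G) = puiseux_of_fps r F + puiseux_of_fps r G"
  "puiseux_of_fps r (F * G) = puiseux_of_fps r F * puiseux_of_fps r G"
  "puiseux_of_fps r 0 = 0" "puiseux_of_fps r 1 = 1"
  by (simp_all add: puiseux_of_fps_def puiseux_of_fls_hom(1,2) puiseux_of_fls_hom(4,5)[of r]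
    fls_times_fps_to_fls)

lemma puiseux_of_fps_sum: "puiseux_of_fps r (\<Sum>i\<in>A. f i) = (\<Sum>i\<in>A. puiseux_of_fps r (f i))"
  by (induction A rule: infinite_finite_induct) (auto simp: puiseux_of_fps_hom)

lemma puiseux_of_fps_prod: "puiseux_of_fps r (\<Prod>i\<in>A. f i) = (\<Prod>i\<in>A. puiseux_of_fps r (f i))"
  by (induction A rule: infinite_finite_induct) (auto simp: puiseux_of_fps_hom)

lemma pcoeff_puiseux_of_fps:
  "pcoeff (puiseux_of_fps r F) q =
    (if q * of_nat (Suc r) \<in> \<int> \<and> 0 \<le> q then fps_nth F (nat \<lfloor>q * of_nat (Suc r)\<rfloor>) else 0)"
proof -
  have "q * of_nat (Suc r) < 0 \<longleftrightarrow> q < 0"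
    by (simp add: mult_less_0_iff del: of_nat_Suc)
  then show ?thesis
    by (auto simp: puiseux_of_fps_def puiseux_of_fls.rep_eq ramify_def not_le del: of_nat_Suc)
qed

definition integral_puiseux :: "nat \<Rightarrow> puiseux \<Rightarrow> bool" where
  "integral_puiseux r g \<longleftrightarrow> (\<forall>q. pcoeff g q \<noteq> 0 \<longrightarrow> q * of_nat (Suc r) \<in> \<int> \<and> 0 \<le> q)"

definition fps_of_puiseux :: "nat \<Rightarrow> puiseux \<Rightarrow> complex fps" where
  "fps_of_puiseux r g = Abs_fps (\<lambda>k. pcoeff g (of_nat k / of_nat (Suc r)))"

lemma puiseux_of_fps_inverse:
  assumes "integral_puiseux r g"
  shows "puiseux_of_fps r (fps_of_puiseux r g) = g"
proof (rule puiseux_eqI)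
  fix q
  show "pcoeff (puiseux_of_fps r (fps_of_puiseux r g)) q = pcoeff g q"
  proof (cases "q * of_nat (Suc r) \<in> \<int> \<and> 0 \<le> q")
    case True
    then obtain k where k: "q * of_nat (Suc r) = of_int k" by (auto elim: Ints_cases)
    have "0 \<le> q * of_nat (Suc r)" using True by (simp del: of_nat_Suc)
    then have "0 \<le> k" unfolding k by simp
    then have "q = of_nat (nat k) / of_nat (Suc r)" using k by (simp add: field_simps)
    then show ?thesis using True k
      by (simp add: pcoeff_puiseux_of_fps fps_of_puiseux_def del: of_nat_Suc)
  next
    case False
    then show ?thesis using assms by (auto simp: pcoeff_puiseux_of_fps integral_puiseux_def simp del: of_nat_Suc)
  qed
qed

lemma fps_of_puiseux_nth_0: "fps_nth (fps_of_puiseux r g) 0 = pcoeff g 0"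
  by (simp add: fps_of_puiseux_def)

definition ramified :: "nat \<Rightarrow> puiseux \<Rightarrow> bool" where
  "ramified r g \<longleftrightarrow> (\<forall>q. pcoeff g q \<noteq> 0 \<longrightarrow> q * of_nat (Suc r) \<in> \<int>)"

text \<open>The lower bound on the exponents is part of being a Puiseux series. As an image of
  Laurent series, the series with a fixed denominator are closed under products by the homomorphism
  laws.\<close>

lemma ramified_iff_range: "ramified r g \<longleftrightarrow> g \<in> range (puiseux_of_fls r)"
proof
  assume g: "ramified r g"
  obtain l where l: "\<And>q. pcoeff g q \<noteq> 0 \<Longrightarrow> l \<le> q"
    using pcoeff[of g] by (auto simp: is_puiseux_def)
  have "\<exists>F. pcoeff g = ramify (Suc r) F"
    using ramify_exists[of "Suc r" "pcoeff g" l] g l by (auto simp: ramified_def simp del: of_nat_Suc)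
  then obtain F where "pcoeff g = ramify (Suc r) F" ..
  then have "g = puiseux_of_fls r F"
    by (simp add: puiseux_eqI puiseux_of_fls.rep_eq)
  then show "g \<in> range (puiseux_of_fls r)" by blast
qed (auto simp: ramified_def puiseux_of_fls.rep_eq ramify_def simp del: of_nat_Suc split: if_splits)

lemma ramified_mult: "ramified r f \<Longrightarrow> ramified r g \<Longrightarrow> ramified r (f * g)"
  unfolding ramified_iff_range using puiseux_of_fls_hom(2) by auto

lemma ramified_sum: "(\<And>i. i \<in> A \<Longrightarrow> ramified r (f i)) \<Longrightarrow> ramified r (\<Sum>i\<in>A. f i)"
  unfolding ramified_def by (metis pcoeff_sum sum.neutral)

lemma ramified_1: "ramified r 1"
  by (simp add: ramified_def pcoeff_1)

lemma ramified_prod: "(\<And>i. i \<in> A \<Longrightarrow> ramified r (f i)) \<Longrightarrow> ramified r (\<Prod>i\<in>A. f i)"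
  by (induction A rule: infinite_finite_induct) (auto simp: ramified_1 ramified_mult)

lemma integral_puiseux_iff: "integral_puiseux r g \<longleftrightarrow> ramified r g \<and> ord_ge g 0"
  by (auto simp: integral_puiseux_def ramified_def ord_ge_def not_less[symmetric])

lemma ramified_fin_monom: "v * of_nat (Suc r) \<in> \<int> \<Longrightarrow> ramified r (fin_monom c v)"
  by (simp add: ramified_def pcoeff_fin_monom)

text \<open>Finitely many entries share one denominator, so the whole system can be solved in a
  single power series ring.\<close>

lemma common_ramification: "\<exists>r. \<forall>k<m. ramified r (a k)" for a :: "nat \<Rightarrow> puiseux"
proof (induction m)
  case (Suc m)
  then obtain r where r: "\<forall>k<m. ramified r (a k)" by blast
  obtain s where s: "s > 0" "\<And>q. pcoeff (a m) q \<noteq> 0 \<Longrightarrow> q * of_nat s \<in> \<int>"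
  proof -
    have "is_puiseux (pcoeff (a m))" using pcoeff by blast
    then show ?thesis using that unfolding is_puiseux_def by blast
  qed
  \<comment> \<open>\<open>ramified R\<close> refers to the denominator \<open>Suc R\<close>; the
    subtraction of 1 makes this denominator the product \<open>Suc r * s\<close>.\<close>
  define R where "R = Suc r * s - 1"
  have R: "of_nat (Suc R) = (of_nat (Suc r) * of_nat s :: rat)"
    using s(1) by (simp add: R_def del: of_nat_Suc of_nat_mult flip: of_nat_mult)
  have "ramified R (a k)" if "k < Suc m" for k
  proof (cases "k = m")
    case True
    have "q * (of_nat (Suc r) * of_nat s) \<in> \<int>" if "pcoeff (a m) q \<noteq> 0" for q
      using Ints_mult[OF s(2)[OF that] Ints_of_nat[of "Suc r"]] by (simp add: mult_ac del: of_nat_Suc)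
    then show ?thesis by (simp only: ramified_def R True) blast
  next
    case False
    then have "ramified r (a k)" using r that by simp
    then have "q * (of_nat (Suc r) * of_nat s) \<in> \<int>" if "pcoeff (a k) q \<noteq> 0" for q
      using Ints_mult[of "q * of_nat (Suc r)" "of_nat s"] that
      by (simp add: mult_ac ramified_def del: of_nat_Suc)
    then show ?thesis by (simp only: ramified_def R) blast
  qed
  then show ?case by blast
qed simp

section \<open>The Wronskian in Pluecker coordinates\<close>

text \<open>Vandermonde's determinant with monic polynomials in place of powers, because derivatives
  of monomials produce falling factorials. As a function of the last node the determinant is a
  polynomial of degree at most \<open>d\<close> vanishing at the other nodes, so its top
  coefficient, the smaller determinant, fixes it.\<close>

lemma det_monic_polys:
  fixes P :: "nat \<Rightarrow> 'a :: idom poly" and x :: "nat \<Rightarrow> 'a"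
  assumes "\<And>i. i < d \<Longrightarrow> degree (P i) = i" "\<And>i. i < d \<Longrightarrow> Polynomial.coeff (P i) i = 1"
  shows "Determinant.det (Matrix.mat d d (\<lambda>(i, j). poly (P i) (x j))) = (\<Prod>j<d. \<Prod>i<j. x j - x i)"
  using assms
proof (induction d)
  case 0
  then show ?case by simp
next
  case (Suc d)
  \<comment> \<open>The last node becomes a free argument \<open>y\<close>; the cofactors of the
    last column do not involve it.\<close>
  define A where "A y = Matrix.mat (Suc d) (Suc d) (\<lambda>(i, j). poly (P i) (if j = d then y else x j))" for y
  define V where "V = (\<Prod>j<d. \<Prod>i<j. x j - x i)"
  have A: "A y \<in> carrier_mat (Suc d) (Suc d)" for y
    by (simp add: A_def)
  have Ax: "Matrix.mat (Suc d) (Suc d) (\<lambda>(i, j). poly (P i) (x j)) = A (x d)"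
    by (auto simp: A_def)
  have cof: "cofactor (A y) i d = cofactor (A 0) i d" if "i < Suc d" for y i
  proof -
    have "mat_delete (A y) i d = mat_delete (A 0) i d"
      using that by (intro eq_matI) (auto simp: A_def mat_delete_def)
    then show ?thesis by (simp add: cofactor_def)
  qed
  define Q where "Q = (\<Sum>i<Suc d. Polynomial.smult (cofactor (A 0) i d) (P i))"
  have Q: "Determinant.det (A y) = poly Q y" for y
  proof -
    have "Determinant.det (A y) = (\<Sum>i<Suc d. A y $$ (i, d) * cofactor (A y) i d)"
      using A by (rule laplace_expansion_column) simp
    also have "\<dots> = (\<Sum>i<Suc d. poly (P i) y * cofactor (A 0) i d)"
    proof (intro sum.cong refl)
      fix i assume i: "i \<in> {..<Suc d}"
      then have "A y $$ (i, d) = poly (P i) y" by (simp add: A_def)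
      then show "A y $$ (i, d) * cofactor (A y) i d = poly (P i) y * cofactor (A 0) i d"
        using cof[of i y] i by simp
    qed
    finally show ?thesis by (simp add: Q_def poly_sum mult.commute)
  qed
  have "mat_delete (A 0) d d = Matrix.mat d d (\<lambda>(i, j). poly (P i) (x j))"
    by (intro eq_matI) (auto simp: A_def mat_delete_def)
  moreover have "Determinant.det (Matrix.mat d d (\<lambda>(i, j). poly (P i) (x j))) = V"
    unfolding V_def by (rule Suc.IH) (use Suc.prems in auto)
  ultimately have cofd: "cofactor (A 0) d d = V"
    by (simp add: cofactor_def)
  have "Polynomial.coeff (P i) d = 0" if "i < d" for i
    using that Suc.prems(1)[of i] by (intro coeff_eq_0) auto
  then have Qd: "Polynomial.coeff Q d = V"
    using Suc.prems(2)[of d] by (simp add: Q_def coeff_sum cofd)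
  have degQ: "degree Q \<le> d"
    unfolding Q_def
  proof (intro degree_sum_le)
    fix i assume "i \<in> {..<Suc d}"
    then show "degree (Polynomial.smult (cofactor (A 0) i d) (P i)) \<le> d"
      using Suc.prems(1)[of i] by (intro order.trans[OF degree_smult_le]) auto
  qed simp
  show ?case
  proof (cases "inj_on x {..<Suc d}")
    case True
    define R where "R = Polynomial.smult V (\<Prod>k<d. [:- x k, 1:])"
    have deg: "degree (\<Prod>k<d. [:- x k, 1:]) = d"
      by (subst degree_prod_eq_sum_degree) auto
    have "Q = R"
    proof (rule poly_eqI_degree_lead_coeff[where A = "x ` {..<d}"])
      have "lead_coeff (\<Prod>k<d. [:- x k, 1:]) = 1"
        by (simp add: lead_coeff_prod)
      then show "Polynomial.coeff Q d = Polynomial.coeff R d"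
        by (simp add: Qd R_def deg)
      show "card (x ` {..<d}) \<ge> d"
        using True by (subst card_image) (auto simp: inj_on_def)
      show "degree Q \<le> d" by (rule degQ)
      show "degree R \<le> d"
        unfolding R_def using deg by (intro order.trans[OF degree_smult_le]) simp
      fix z assume "z \<in> x ` {..<d}"
      then obtain k where k: "k < d" "z = x k" by auto
      have "Matrix.col (A z) d = Matrix.col (A z) k"
        using k by (intro eq_vecI) (auto simp: A_def)
      then have "Determinant.det (A z) = 0"
        using k by (intro det_identical_columns[OF A, of d k]) auto
      moreover have "poly R z = 0"
        using k by (auto simp: R_def poly_prod)
      ultimately show "poly Q z = poly R z" by (simp add: Q)
    qed
    then show ?thesis
      by (simp add: Ax Q R_def poly_prod V_def)
  next
    \<comment> \<open>With a repeated node there are too few roots to determine \<open>Q\<close>,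
      but two equal columns and a zero factor make both sides vanish.\<close>
    case False
    then obtain k l where kl: "k < l" "l < Suc d" "x k = x l"
      unfolding inj_on_def by (metis lessThan_iff linorder_neqE_nat)
    have "Matrix.col (A (x d)) k = Matrix.col (A (x d)) l"
      using kl by (intro eq_vecI) (auto simp: A_def)
    then have "Determinant.det (A (x d)) = 0"
      using kl by (intro det_identical_columns[OF A, of k l]) auto
    moreover have z: "(\<Prod>i<l. x l - x i) = 0"
      using kl by (intro prod_zero bexI[of _ k]) auto
    have "(\<Prod>j<Suc d. \<Prod>i<j. x j - x i) = 0"
      by (rule prod_zero[OF _ bexI[of _ l]]) (use kl z in auto)
    ultimately show ?thesis by (simp only: Ax)
  qed
qed

text \<open>The falling factorial X (X - 1) ... (X - i + 1).\<close>

definition falling_poly :: "nat \<Rightarrow> 'a :: idom poly" where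
  "falling_poly i = (\<Prod>l<i. [:- of_nat l, 1:])"

lemma degree_falling_poly: "degree (falling_poly i :: 'a :: idom poly) = i"
  unfolding falling_poly_def by (subst degree_prod_eq_sum_degree) auto

lemma monic_falling_poly: "Polynomial.coeff (falling_poly i :: 'a :: idom poly) i = 1"
proof -
  have "lead_coeff (falling_poly i :: 'a poly) = 1"
    by (simp add: falling_poly_def lead_coeff_prod)
  then show ?thesis by (simp add: degree_falling_poly)
qed

text \<open>The truncated exponent \<open>k - i\<close> is harmless: for \<open>i > k\<close> the
  falling factorial vanishes at \<open>k\<close>.\<close>

lemma higher_pderiv_monom_falling:
  "(pderiv ^^ i) (Polynomial.monom (c :: 'a :: idom) k)
    = Polynomial.monom (poly (falling_poly i) (of_nat k) * c) (k - i)"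
proof (induction i)
  case 0
  then show ?case by (simp add: falling_poly_def)
next
  case (Suc i)
  have "of_nat (k - i) * poly (falling_poly i) (of_nat k) =
      (poly (falling_poly (Suc i)) (of_nat k) :: 'a)"
  proof (cases "i \<le> k")
    case True
    then show ?thesis by (simp add: falling_poly_def of_nat_diff algebra_simps)
  next
    case False
    then have "poly (falling_poly i) (of_nat k) = (0::'a)"
      unfolding falling_poly_def poly_prod by (intro prod_zero bexI[of _ k]) auto
    with False show ?thesis by (simp add: falling_poly_def)
  qed
  from this[symmetric] show ?case by (simp add: Suc pderiv_monom mult_ac)
qed

text \<open>Polymorphic because the same integer product is needed over the complex numbers, as
  \<open>q_coef\<close>, and over the Puiseux series, in the Wronskian.\<close>

definition vandermonde :: "nat \<Rightarrow> (nat \<Rightarrow> nat) \<Rightarrow> 'a :: idom" where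
  "vandermonde d \<phi> = (\<Prod>j<d. \<Prod>i<j. of_nat (\<phi> j) - of_nat (\<phi> i))"

lemma vandermonde_eq_det:
  "vandermonde d \<phi> = Determinant.det (Matrix.mat d d (\<lambda>(i, j). poly (falling_poly i) (of_nat (\<phi> j) :: 'a :: idom)))"
  unfolding vandermonde_def
  by (rule det_monic_polys[symmetric]) (auto simp: degree_falling_poly monic_falling_poly)

lemma vandermonde_permute:
  assumes p: "p permutes {0..<d}"
  shows "vandermonde d (\<lambda>j. \<phi> (p j)) = of_int (sign p) * (vandermonde d \<phi> :: 'a :: idom)"
proof -
  define A where "A = Matrix.mat d d (\<lambda>(j, i). poly (falling_poly i) (of_nat (\<phi> j) :: 'a))"
  have A: "A \<in> carrier_mat d d" by (simp add: A_def)
  have pl: "p i < d" if "i < d" for i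
    using permutes_in_image[OF p, of i] that by simp
  have "vandermonde d (\<lambda>j. \<phi> (p j)) = Determinant.det (transpose_mat (Matrix.mat d d (\<lambda>(i, j). A $$ (p i, j))))"
    unfolding vandermonde_eq_det
    by (intro arg_cong[where f = Determinant.det] eq_matI) (auto simp: A_def pl)
  also have "\<dots> = of_int (sign p) * Determinant.det A"
    using det_permute_rows[OF A p] by (subst det_transpose[where n = d]) auto
  also have "Determinant.det A = Determinant.det (transpose_mat A)"
    by (rule det_transpose[OF A, symmetric])
  also have "\<dots> = vandermonde d \<phi>"
    unfolding vandermonde_eq_det
    by (intro arg_cong[where f = Determinant.det] eq_matI) (auto simp: A_def)
  finally show ?thesis .
qed

lemma vandermonde_not_inj:
  assumes "\<not> inj_on \<phi> {..<d}"
  shows "vandermonde d \<phi> = (0 :: 'a :: idom)"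
proof -
  obtain k l where kl: "k < l" "l < d" "\<phi> k = \<phi> l"
    using assms unfolding inj_on_def by (metis lessThan_iff linorder_neqE_nat)
  then have z: "(\<Prod>i<l. of_nat (\<phi> l) - of_nat (\<phi> i)) = (0::'a)"
    by (intro prod_zero bexI[of _ k]) auto
  show ?thesis
    unfolding vandermonde_def by (rule prod_zero[OF _ bexI[of _ l]]) (use kl z in auto)
qed

lemma prod_monom: "(\<Prod>j\<in>A. Polynomial.monom (c j) (e j)) = Polynomial.monom (\<Prod>j\<in>A. c j) (\<Sum>j\<in>A. e j)"
  by (induction A rule: infinite_finite_induct) (auto simp: mult_monom monom_0)

lemma of_int_mult_monom: "of_int c * Polynomial.monom (a :: 'a :: comm_ring_1) e = Polynomial.monom (of_int c * a) e"
  by (simp add: of_int_poly smult_monom)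

lemma poly_as_sum_of_monoms_lt:
  assumes "degree p < n"
  shows "(\<Sum>k<n. Polynomial.monom (Polynomial.coeff p k) k) = p"
  using poly_as_sum_of_monoms'[of p "n - 1"] assms by (simp flip: lessThan_Suc_atMost)

text \<open>Multilinearity in the columns: \<open>\<phi>\<close> selects one monomial from each
  \<open>f j\<close>. Every permutation in the Leibniz formula lowers the total degree by the same
  amount 0 + ... + (d - 1), so the determinant of falling factorials factors out.\<close>

lemma wronskian_expand_maps:
  fixes f :: "nat \<Rightarrow> puiseux poly"
  assumes "\<And>j. j < d \<Longrightarrow> degree (f j) < n"
  shows "wronskian d f = (\<Sum>\<phi>\<in>{..<d} \<rightarrow>\<^sub>E {..<n}.
    Polynomial.monom ((\<Prod>j<d. Polynomial.coeff (f j) (\<phi> j)) * vandermonde d \<phi>) ((\<Sum>j<d. \<phi> j) - \<Sum>{..<d}))"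
proof -
  let ?P = "{p. p permutes {0..<d}}"
  let ?c = "\<lambda>p j k. poly (falling_poly (p j)) (of_nat k) * Polynomial.coeff (f j) k"
  have f: "(pderiv ^^ i) (f j) = (\<Sum>k<n. Polynomial.monom (poly (falling_poly i) (of_nat k) * Polynomial.coeff (f j) k) (k - i))"
    if "j < d" for i j
  proof -
    have "(pderiv ^^ i) (f j) = (pderiv ^^ i) (\<Sum>k<n. Polynomial.monom (Polynomial.coeff (f j) k) k)"
      using assms[OF that] by (simp add: poly_as_sum_of_monoms_lt)
    then show ?thesis by (simp add: higher_pderiv_sum higher_pderiv_monom_falling)
  qed
  have exp: "of_int (sign p) * (\<Prod>j<d. Polynomial.monom (?c p j (\<phi> j)) (\<phi> j - p j)) =
     Polynomial.monom (of_int (sign p) * (\<Prod>j<d. ?c p j (\<phi> j))) ((\<Sum>j<d. \<phi> j) - \<Sum>{..<d})"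
    if p: "p permutes {0..<d}" for p \<phi>
  proof (cases "(\<Prod>j<d. ?c p j (\<phi> j)) = 0")
    case True
    then show ?thesis by (simp only: prod_monom of_int_mult_monom) simp
  next
    case False
    \<comment> \<open>In a nonzero summand no monomial is differentiated to zero, so the truncated
      subtractions are exact.\<close>
    have le: "p j \<le> \<phi> j" if "j < d" for j
    proof (rule ccontr)
      assume "\<not> p j \<le> \<phi> j"
      then have "poly (falling_poly (p j)) (of_nat (\<phi> j)) = (0::puiseux)"
        unfolding falling_poly_def poly_prod by (intro prod_zero bexI[of _ "\<phi> j"]) auto
      with False that show False by auto
    qed
    have "(\<Sum>j<d. \<phi> j - p j) = (\<Sum>j<d. \<phi> j) - (\<Sum>j<d. p j)"
      by (rule sum_subtractf_nat) (use le in auto)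
    also have "(\<Sum>j<d. p j) = \<Sum>{..<d}"
      using sum.permute[OF p, of "\<lambda>j. j"] by (simp add: atLeast0LessThan)
    finally show ?thesis
      by (simp only: prod_monom of_int_mult_monom)
  qed
  have "wronskian d f = (\<Sum>p\<in>?P. of_int (sign p) * (\<Prod>j<d. (pderiv ^^ p j) (f j)))"
    unfolding wronskian_def by (subst det_col[where n = d]) (auto intro!: sum.cong prod.cong simp: permutes_def)
  also have "\<dots> = (\<Sum>p\<in>?P. of_int (sign p) * (\<Prod>j<d. \<Sum>k<n. Polynomial.monom (?c p j k) (k - p j)))"
    using f by (intro sum.cong refl arg_cong2[where f = "(*)"] prod.cong) auto
  also have "\<dots> = (\<Sum>p\<in>?P. \<Sum>\<phi>\<in>{..<d} \<rightarrow>\<^sub>E {..<n}.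
      of_int (sign p) * (\<Prod>j<d. Polynomial.monom (?c p j (\<phi> j)) (\<phi> j - p j)))"
    by (subst prod_sum_PiE) (auto simp: sum_distrib_left)
  also have "\<dots> = (\<Sum>\<phi>\<in>{..<d} \<rightarrow>\<^sub>E {..<n}. \<Sum>p\<in>?P.
      of_int (sign p) * (\<Prod>j<d. Polynomial.monom (?c p j (\<phi> j)) (\<phi> j - p j)))"
    by (rule sum.swap)
  also have "\<dots> = (\<Sum>\<phi>\<in>{..<d} \<rightarrow>\<^sub>E {..<n}. \<Sum>p\<in>?P.
      Polynomial.monom (of_int (sign p) * (\<Prod>j<d. ?c p j (\<phi> j))) ((\<Sum>j<d. \<phi> j) - \<Sum>{..<d}))"
    by (intro sum.cong refl exp) auto
  also have "\<dots> = (\<Sum>\<phi>\<in>{..<d} \<rightarrow>\<^sub>E {..<n}.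
    Polynomial.monom ((\<Prod>j<d. Polynomial.coeff (f j) (\<phi> j)) * vandermonde d \<phi>) ((\<Sum>j<d. \<phi> j) - \<Sum>{..<d}))"
  proof (intro sum.cong refl)
    fix \<phi>
    have "vandermonde d \<phi> = (\<Sum>p\<in>?P. of_int (sign p) * (\<Prod>j<d. poly (falling_poly (p j)) (of_nat (\<phi> j)) :: puiseux))"
      unfolding vandermonde_eq_det by (subst det_col[where n = d]) (auto intro!: sum.cong prod.cong simp: permutes_def)
    then have "(\<Prod>j<d. Polynomial.coeff (f j) (\<phi> j)) * vandermonde d \<phi> =
       (\<Sum>p\<in>?P. of_int (sign p) * (\<Prod>j<d. ?c p j (\<phi> j)))"
      by (simp add: sum_distrib_left prod.distrib mult_ac)
    then show "(\<Sum>p\<in>?P. Polynomial.monom (of_int (sign p) * (\<Prod>j<d. ?c p j (\<phi> j))) ((\<Sum>j<d. \<phi> j) - \<Sum>{..<d}))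
      = Polynomial.monom ((\<Prod>j<d. Polynomial.coeff (f j) (\<phi> j)) * vandermonde d \<phi>) ((\<Sum>j<d. \<phi> j) - \<Sum>{..<d})"
      by (simp add: monom_sum)
  qed
  finally show ?thesis .
qed

section \<open>Partitions as strictly increasing column sequences\<close>

definition col_index :: "nat \<Rightarrow> nat list \<Rightarrow> nat \<Rightarrow> nat" where
  "col_index d nu j = j + nu ! (d - Suc j)"

lemma kcol_eq_Suc: "kcol d nu j = Suc (col_index d nu j)"
  by (simp add: kcol_def col_index_def)

lemma partitionsD:
  assumes "nu \<in> partitions d n"
  shows "length nu = d" "\<And>i j. i \<le> j \<Longrightarrow> j < d \<Longrightarrow> nu ! j \<le> nu ! i" "\<And>i. i < d \<Longrightarrow> nu ! i \<le> n - d"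
proof -
  show len: "length nu = d" using assms by (simp add: partitions_def)
  show "nu ! j \<le> nu ! i" if "i \<le> j" "j < d" for i j
    using assms that len by (cases "i = j") (auto simp: partitions_def sorted_wrt_iff_nth_less)
  show "nu ! i \<le> n - d" if "i < d" for i
    using assms that len by (auto simp: partitions_def)
qed

lemma partitionsI:
  assumes "length nu = d" "\<And>i. Suc i < d \<Longrightarrow> nu ! Suc i \<le> nu ! i" "\<And>i. i < d \<Longrightarrow> nu ! i \<le> n - d"
  shows "nu \<in> partitions d n"
proof -
  have mono: "nu ! j \<le> nu ! i" if "i \<le> j" "j < d" for i j
    using that
  proof (induction j rule: dec_induct)
    case (step k)
    then show ?case using assms(2)[of k] by simp
  qed simp
  have "sorted_wrt (\<ge>) nu"
    using mono assms(1) by (auto simp: sorted_wrt_iff_nth_less)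
  then show ?thesis using assms(1,3) by (auto simp: partitions_def in_set_conv_nth)
qed

lemma finite_partitions: "finite (partitions d n)"
proof -
  have "partitions d n \<subseteq> {xs. set xs \<subseteq> {..n - d} \<and> length xs = d}"
    by (auto simp: partitions_def)
  then show ?thesis using finite_lists_length_eq[of "{..n - d}" d] finite_subset by blast
qed

lemma col_index_strict_mono:
  assumes "nu \<in> partitions d n" "i < j" "j < d"
  shows "col_index d nu i < col_index d nu j"
proof -
  have "nu ! (d - Suc i) \<le> nu ! (d - Suc j)"
    by (rule partitionsD(2)[OF assms(1)]) (use assms(2,3) in auto)
  then show ?thesis using assms(2) by (simp add: col_index_def)
qed

lemma col_index_less:
  assumes "nu \<in> partitions d n" "i < d" "d < n"
  shows "col_index d nu i < n"
  using partitionsD(3)[OF assms(1), of "d - Suc i"] assms(2,3)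
  by (simp add: col_index_def)

lemma sum_col_index:
  assumes "length nu = d"
  shows "(\<Sum>j<d. col_index d nu j) = sum_list nu + \<Sum>{..<d}"
proof -
  have "(\<Sum>j<d. nu ! (d - Suc j)) = (\<Sum>j<d. nu ! j)"
    by (rule sum.nat_diff_reindex)
  also have "\<dots> = sum_list nu"
    using assms by (simp add: sum_list_sum_nth atLeast0LessThan)
  finally show ?thesis by (simp add: col_index_def sum.distrib)
qed

lemma col_index_inj:
  assumes "length nu = d" "length nu' = d" "\<And>j. j < d \<Longrightarrow> col_index d nu j = col_index d nu' j"
  shows "nu = nu'"
proof (rule nth_equalityI)
  fix i assume "i < length nu"
  then show "nu ! i = nu' ! i"
    using assms(3)[of "d - Suc i"] assms(1) by (simp add: col_index_def Suc_diff_Suc)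
qed (use assms in simp)

lemma strict_mono_image_eq:
  fixes e e' :: "nat \<Rightarrow> nat"
  assumes "\<And>i j. i < j \<Longrightarrow> j < d \<Longrightarrow> e i < e j" "\<And>i j. i < j \<Longrightarrow> j < d \<Longrightarrow> e' i < e' j"
    and "e ` {..<d} = e' ` {..<d}" "i < d"
  shows "e i = e' i"
proof -
  have "map e [0..<d] = map e' [0..<d]"
    by (rule strict_sorted_equal)
      (use assms in \<open>auto simp: sorted_wrt_iff_nth_less atLeast0LessThan\<close>)
  then show ?thesis using assms(4) by auto
qed

text \<open>A strictly increasing sequence gains at least 1 per step, so \<open>e i - i\<close> is
  weakly increasing, and it is at most \<open>n - d\<close> because
  \<open>e (d - 1) < n\<close>.\<close>

lemma partition_of_strict_mono:
  fixes e :: "nat \<Rightarrow> nat"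
  assumes e: "\<And>i j. i < j \<Longrightarrow> j < d \<Longrightarrow> e i < e j" and lt: "\<And>i. i < d \<Longrightarrow> e i < n" and "d < n"
  obtains nu where "nu \<in> partitions d n" "\<And>i. i < d \<Longrightarrow> col_index d nu i = e i"
proof -
  have step: "e i + (j - i) \<le> e j" if "i \<le> j" "j < d" for i j
    using that
  proof (induction j rule: dec_induct)
    case (step k)
    then show ?case using e[of k "Suc k"] by simp
  qed simp
  define nu where "nu = map (\<lambda>s. e (d - Suc s) - (d - Suc s)) [0..<d]"
  have ge: "i \<le> e i" if "i < d" for i
    using step[of 0 i] that by simp
  have "nu \<in> partitions d n"
  proof (rule partitionsI)
    show "nu ! Suc i \<le> nu ! i" if "Suc i < d" for i
    proof -
      have "e (d - Suc (Suc i)) < e (d - Suc i)" by (rule e) (use that in auto)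
      then have "e (d - Suc (Suc i)) - (d - Suc (Suc i)) \<le> e (d - Suc i) - (d - Suc i)"
        using that by arith
      then show ?thesis using that by (simp add: nu_def)
    qed
    show "nu ! i \<le> n - d" if "i < d" for i
    proof -
      have "e (d - Suc i) + (d - 1 - (d - Suc i)) \<le> e (d - 1)" by (rule step) (use that in auto)
      moreover have "e (d - 1) < n" using lt[of "d - 1"] that by simp
      ultimately have "e (d - Suc i) - (d - Suc i) \<le> n - d" using that by arith
      then show ?thesis using that by (simp add: nu_def)
    qed
  qed (simp add: nu_def)
  moreover have "col_index d nu i = e i" if "i < d" for i
    using ge[OF that] that by (simp add: col_index_def nu_def Suc_diff_Suc)
  ultimately show ?thesis by (rule that)
qed

text \<open>An injective choice of exponents is the increasing enumeration of its image, which comes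
  from a partition, composed with a permutation.\<close>

lemma bij_betw_partitions_permutations:
  assumes "d < n"
  shows "bij_betw (\<lambda>(nu, p). restrict (\<lambda>j. col_index d nu (p j)) {..<d})
    (partitions d n \<times> {p. p permutes {0..<d}}) {\<phi> \<in> {..<d} \<rightarrow>\<^sub>E {..<n}. inj_on \<phi> {..<d}}"
    (is "bij_betw ?g ?A ?B")
proof (rule bij_betwI')
  have pl: "p i < d" if "p permutes {0..<d}" "i < d" for p i
    using permutes_in_image[OF that(1), of i] that(2) by simp
  have inj: "inj_on (col_index d nu) {..<d}" if "nu \<in> partitions d n" for nu
    using col_index_strict_mono[OF that] by (intro linorder_inj_onI) (auto simp: neq_iff)
  show "?g x = ?g y \<longleftrightarrow> x = y" if "x \<in> ?A" "y \<in> ?A" for x y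
  proof
    assume eq: "?g x = ?g y"
    obtain nu p nu' p' where xy: "x = (nu, p)" "y = (nu', p')" by (cases x, cases y)
    have nu: "nu \<in> partitions d n" "nu' \<in> partitions d n" and p: "p permutes {0..<d}" "p' permutes {0..<d}"
      using that xy by auto
    have eq': "col_index d nu (p j) = col_index d nu' (p' j)" if "j < d" for j
      using fun_cong[OF eq, of j] that by (simp add: xy)
    have im: "p ` {..<d} = {..<d}" "p' ` {..<d} = {..<d}"
      using permutes_image[OF p(1)] permutes_image[OF p(2)] by (simp_all add: atLeast0LessThan)
    have "col_index d nu ` {..<d} = col_index d nu ` p ` {..<d}" by (simp add: im)
    also have "\<dots> = col_index d nu' ` p' ` {..<d}"
      unfolding image_image by (rule image_cong) (auto simp: eq')
    also have "\<dots> = col_index d nu' ` {..<d}" by (simp add: im)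
    finally have col: "col_index d nu j = col_index d nu' j" if "j < d" for j
      using strict_mono_image_eq[of d "col_index d nu" "col_index d nu'" j]
        col_index_strict_mono nu that by blast
    have "nu = nu'"
      by (rule col_index_inj[OF partitionsD(1)[OF nu(1)] partitionsD(1)[OF nu(2)] col])
    moreover have "p j = p' j" for j
    proof (cases "j < d")
      case True
      then show ?thesis
        using eq'[OF True] inj[OF nu(1)] pl[OF p(1) True] pl[OF p(2) True] \<open>nu = nu'\<close>
        by (auto dest: inj_onD)
    next
      case False
      then show ?thesis using p by (simp add: permutes_def)
    qed
    ultimately show "x = y" by (auto simp: xy)
  qed simp
  show "?g x \<in> ?B" if "x \<in> ?A" for x
  proof -
    obtain nu p where x: "x = (nu, p)" by (cases x)
    with that have nu: "nu \<in> partitions d n" and p: "p permutes {0..<d}" by auto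
    have "inj_on (\<lambda>j. col_index d nu (p j)) {..<d}"
    proof (rule inj_onI)
      fix i j assume ij: "i \<in> {..<d}" "j \<in> {..<d}" "col_index d nu (p i) = col_index d nu (p j)"
      then have "p i = p j" using inj_onD[OF inj[OF nu] ij(3)] pl[OF p] by auto
      then show "i = j" by (rule injD[OF permutes_inj[OF p]])
    qed
    then show ?thesis
      using col_index_less[OF nu _ assms] pl[OF p] by (simp add: x inj_on_restrict_eq)
  qed
  show "\<exists>x\<in>?A. y = ?g x" if "y \<in> ?B" for y
  proof -
    have y: "y \<in> {..<d} \<rightarrow>\<^sub>E {..<n}" and iy: "inj_on y {..<d}" using that by auto
    define xs where "xs = sorted_list_of_set (y ` {..<d})"
    define e where "e i = xs ! i" for i
    have len: "length xs = d" by (simp add: xs_def card_image[OF iy])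
    have set: "set xs = y ` {..<d}" by (simp add: xs_def)
    have e: "e i < e j" if "i < j" "j < d" for i j
      using that len sorted_wrt_nth_less[of "(<)" xs i j] by (simp add: e_def xs_def)
    have "e ` {..<d} = set xs"
      unfolding set_conv_nth len by (auto simp: e_def)
    then have im: "e ` {..<d} = y ` {..<d}" by (simp add: set)
    have en: "e i < n" if "i < d" for i
    proof -
      from im that obtain j where "j < d" "e i = y j" by blast
      then show ?thesis using PiE_mem[OF y, of j] by simp
    qed
    obtain nu where nu: "nu \<in> partitions d n" "\<And>i. i < d \<Longrightarrow> col_index d nu i = e i"
      by (rule partition_of_strict_mono[of d e n]) (use e en assms in auto)
    define p where "p j = (if j < d then inv_into {..<d} e (y j) else j)" for j
    have ep: "p j < d" "e (p j) = y j" if "j < d" for j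
      using that im inv_into_into[of "y j" e "{..<d}"] f_inv_into_f[of "y j" e "{..<d}"]
      by (auto simp: p_def)
    have "inj_on p {0..<d}"
      using iy ep by (metis atLeastLessThan_iff inj_on_def lessThan_iff)
    moreover have "p ` {0..<d} \<subseteq> {0..<d}" using ep by auto
    ultimately have "bij_betw p {0..<d} {0..<d}"
      by (simp add: bij_betw_def endo_inj_surj)
    then have "p permutes {0..<d}"
      by (rule bij_imp_permutes) (simp add: p_def)
    moreover have "y = ?g (nu, p)"
      using ep nu(2) y by (auto simp: fun_eq_iff PiE_def extensional_def)
    ultimately show ?thesis using nu(1) by blast
  qed
qed

lemma q_coef_eq_vandermonde: "q_coef d nu = vandermonde d (col_index d nu)"
  by (simp add: q_coef_def vandermonde_def kcol_eq_Suc)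

lemma minor_eq_det:
  "minor d f nu = Determinant.det (Matrix.mat d d (\<lambda>(i, j). Polynomial.coeff (f i) (col_index d nu j)))"
  by (simp add: minor_def kcol_eq_Suc)

text \<open>Only injective exponent choices have a nonzero Vandermonde factor. Those with the same
  set of values belong to one partition, and the signs of the permuted Vandermonde products assemble
  the Leibniz expansion of its minor.\<close>

lemma coeff_wronskian:
  fixes f :: "nat \<Rightarrow> puiseux poly"
  assumes "d < n" and deg: "\<And>j. j < d \<Longrightarrow> degree (f j) < n"
  shows "Polynomial.coeff (wronskian d f) k =
    (\<Sum>nu | nu \<in> partitions d n \<and> sum_list nu = k. vandermonde d (col_index d nu) * minor d f nu)"
proof -
  let ?P = "{p. p permutes {0..<d}}"
  let ?E = "{..<d} \<rightarrow>\<^sub>E {..<n}"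
  define t where "t \<phi> = (if (\<Sum>j<d. \<phi> j) - \<Sum>{..<d} = k then (\<Prod>j<d. Polynomial.coeff (f j) (\<phi> j)) * vandermonde d \<phi> else 0)" for \<phi>
  have fin: "finite ?E" by (intro finite_PiE) auto
  have "Polynomial.coeff (wronskian d f) k = (\<Sum>\<phi>\<in>?E. t \<phi>)"
    by (subst wronskian_expand_maps[OF deg]) (auto simp: coeff_sum t_def intro!: sum.cong)
  also have "\<dots> = (\<Sum>\<phi> | \<phi> \<in> ?E \<and> inj_on \<phi> {..<d}. t \<phi>)"
    by (rule sum.mono_neutral_right[OF fin]) (auto simp: t_def vandermonde_not_inj)
  also have "\<dots> = (\<Sum>(nu, p)\<in>partitions d n \<times> ?P. t (restrict (\<lambda>j. col_index d nu (p j)) {..<d}))"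
    by (subst sum.reindex_bij_betw[OF bij_betw_partitions_permutations[OF assms(1)], symmetric])
      (simp add: case_prod_beta)
  also have "\<dots> = (\<Sum>nu\<in>partitions d n. \<Sum>p\<in>?P. t (restrict (\<lambda>j. col_index d nu (p j)) {..<d}))"
    by (rule sum.cartesian_product[symmetric])
  also have "\<dots> = (\<Sum>nu\<in>partitions d n. if sum_list nu = k then vandermonde d (col_index d nu) * minor d f nu else 0)"
  proof (intro sum.cong refl)
    fix nu assume nu: "nu \<in> partitions d n"
    have "t (restrict (\<lambda>j. col_index d nu (p j)) {..<d}) =
       (if sum_list nu = k then vandermonde d (col_index d nu) *
          (of_int (sign p) * (\<Prod>j<d. Polynomial.coeff (f j) (col_index d nu (p j)))) else 0)"
      if p: "p permutes {0..<d}" for p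
    proof -
      have "(\<Sum>j<d. col_index d nu (p j)) = (\<Sum>j<d. col_index d nu j)"
        using sum.permute[OF p, of "col_index d nu"] by (simp add: atLeast0LessThan)
      moreover have "vandermonde d (restrict (\<lambda>j. col_index d nu (p j)) {..<d}) =
          (vandermonde d (\<lambda>j. col_index d nu (p j)) :: puiseux)"
        by (auto simp: vandermonde_def intro!: prod.cong)
      ultimately show ?thesis
        by (simp add: t_def sum_col_index[OF partitionsD(1)[OF nu]] vandermonde_permute[OF p] mult_ac)
    qed
    then have "(\<Sum>p\<in>?P. t (restrict (\<lambda>j. col_index d nu (p j)) {..<d})) =
       (\<Sum>p\<in>?P. if sum_list nu = k then vandermonde d (col_index d nu) *
          (of_int (sign p) * (\<Prod>j<d. Polynomial.coeff (f j) (col_index d nu (p j)))) else 0)"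
      by (intro sum.cong) auto
    also have "\<dots> = (if sum_list nu = k then vandermonde d (col_index d nu) * minor d f nu else 0)"
      unfolding minor_eq_det
      by (subst det_def'[where n = d])
        (auto simp: sum_distrib_left atLeast0LessThan permutes_def intro!: sum.cong prod.cong arg_cong2[where f = "(*)"])
    finally show "(\<Sum>p\<in>?P. t (restrict (\<lambda>j. col_index d nu (p j)) {..<d})) = \<dots>" .
  qed
  also have "\<dots> = (\<Sum>nu | nu \<in> partitions d n \<and> sum_list nu = k. vandermonde d (col_index d nu) * minor d f nu)"
    using sum.inter_filter[OF finite_partitions[of d n], of "\<lambda>nu. vandermonde d (col_index d nu) * minor d f nu" "\<lambda>nu. sum_list nu = k"] by simp
  finally show ?thesis .
qed

text \<open>\<open>wronski_fibre\<close> and \<open>plucker_coords\<close> choose spanning families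
  of the same space independently; this relates the two. Differentiation is linear over the scalars,
  so the Wronskian matrices differ by a constant factor matrix.\<close>

lemma wronskian_change_basis:
  assumes "\<And>i. i < d \<Longrightarrow> f i \<in> poly_vs.span (g ` {..<d})"
  obtains D where "wronskian d f = wronskian d g * [:D:]"
proof -
  have ex: "\<exists>c. p = (\<Sum>k<d. Polynomial.smult (c k) (g k))" if "p \<in> poly_vs.span (g ` {..<d})" for p
    using that
  proof (induction rule: poly_vs.span_induct_alt)
    case base
    show ?case by (intro exI[of _ "\<lambda>_. 0"]) simp
  next
    case (step c x y)
    then obtain k b where k: "k < d" "x = g k" and y: "y = (\<Sum>k<d. Polynomial.smult (b k) (g k))" by auto
    have "(\<Sum>i<d. Polynomial.smult (if i = k then c else 0) (g i)) = Polynomial.smult c x"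
      using k by (subst sum.remove[of _ k]) auto
    then show ?case
      by (intro exI[of _ "\<lambda>i. (if i = k then c else 0) + b i"])
        (simp only: smult_add_left sum.distrib y)
  qed
  then have "\<forall>i\<in>{..<d}. \<exists>c. f i = (\<Sum>k<d. Polynomial.smult (c k) (g k))"
    using assms by blast
  then obtain c where c: "\<And>i. i < d \<Longrightarrow> f i = (\<Sum>k<d. Polynomial.smult (c i k) (g k))"
    by (metis lessThan_iff)
  define W where "W = Matrix.mat d d (\<lambda>(i, j). (pderiv ^^ i) (g j))"
  define C where "C = Matrix.mat d d (\<lambda>(k, j). c j k)"
  have "Matrix.mat d d (\<lambda>(i, j). (pderiv ^^ i) (f j)) = W * map_mat (\<lambda>a. [:a:]) C"
    by (intro eq_matI)
      (auto simp: W_def C_def c scalar_prod_def higher_pderiv_sum higher_pderiv_smult atLeast0LessThan mult.commute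
        intro!: sum.cong)
  then have "wronskian d f = Determinant.det W * Determinant.det (map_mat (\<lambda>a. [:a:]) C)"
    unfolding wronskian_def by (simp only:) (rule det_mult[of _ d], auto simp: W_def C_def)
  also have "Determinant.det (map_mat (\<lambda>a. [:a:]) C) = [:Determinant.det C:]"
  proof -
    \<comment> \<open>Constants embed into the polynomials as a ring, so the determinant of the
      constant matrix is again a constant.\<close>
    interpret comm_ring_hom "\<lambda>a::puiseux. [:a:]"
      by unfold_locales (auto simp: one_pCons)
    show ?thesis by (rule hom_det)
  qed
  finally show ?thesis using that unfolding wronskian_def W_def by blast
qed

section \<open>A parametrization of the Richardson variety\<close>

text \<open>
  A pair \<open>(i, c)\<close> encodes the box in row \<open>d - 1 - i\<close> and column \<open>c - i\<close>: reversing the rows makes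
  the sequences \<open>col_index d nu\<close> increasing, and two boxes lie on the same diagonal iff they have
  the same \<open>c\<close>, the one with larger \<open>i\<close> being further north-west.
\<close>

definition slots :: "nat \<Rightarrow> (nat \<Rightarrow> nat) \<Rightarrow> (nat \<Rightarrow> nat) \<Rightarrow> (nat \<times> nat) set" where
  "slots d N L = (SIGMA i:{..<d}. {N i..<L i})"

text \<open>Selects the permutations whose Leibniz term can be nonzero when row \<open>i\<close> of
  the coefficient matrix is supported in columns \<open>M i\<close> to \<open>L i\<close>.\<close>

definition admissible :: "nat \<Rightarrow> (nat \<Rightarrow> nat) \<Rightarrow> (nat \<Rightarrow> nat) \<Rightarrow> (nat \<Rightarrow> nat) \<Rightarrow> (nat \<Rightarrow> nat) \<Rightarrow> bool" where
  "admissible d M N L p \<longleftrightarrow> (\<forall>i<d. M i \<le> N (p i) \<and> N (p i) \<le> L i)"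

lemma finite_slots [simp]: "finite (slots d N L)"
  by (simp add: slots_def)

lemma mem_slots: "(i, c) \<in> slots d N L \<longleftrightarrow> i < d \<and> N i \<le> c \<and> c < L i"
  by (auto simp: slots_def)

lemma permutes_less: "p permutes {0..<d} \<Longrightarrow> i < d \<Longrightarrow> p i < (d :: nat)"
  using permutes_in_image[of p "{0..<d}" i] by simp

text \<open>Pigeonhole: if \<open>N i < M i\<close>, then \<open>p\<close> must send all rows from
  \<open>i\<close> on to indices beyond \<open>i\<close>, of which there is one too few. An excess
  over \<open>L i\<close> is excluded symmetrically.\<close>

lemma admissible_between:
  assumes M: "\<And>i j. i < j \<Longrightarrow> j < d \<Longrightarrow> M i < M j" and N: "\<And>i j. i < j \<Longrightarrow> j < d \<Longrightarrow> N i < N j"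
    and L: "\<And>i j. i < j \<Longrightarrow> j < d \<Longrightarrow> L i < L j"
    and p: "p permutes {0..<d}" and adm: "admissible d M N L p" and i: "i < d"
  shows "M i \<le> N i \<and> N i \<le> L i"
proof (intro conjI; rule ccontr)
  have inj: "inj_on p A" for A using permutes_inj_on[OF p] .
  show False if "\<not> M i \<le> N i"
  proof -
    have "p j \<in> {i<..<d}" if j: "j \<in> {i..<d}" for j
    proof -
      have "M i \<le> M j" using M[of i j] j by (cases "i = j") auto
      then have "N i < N (p j)"
        using adm j \<open>\<not> M i \<le> N i\<close> by (force simp: admissible_def)
      moreover have "N (p j) \<le> N i" if "p j \<le> i"
        using N[of "p j" i] that i by (cases "p j = i") auto
      ultimately show ?thesis using permutes_less[OF p, of j] j by (force simp: not_le[symmetric])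
    qed
    then have "card {i..<d} \<le> card {i<..<d}"
      by (intro card_inj_on_le[of p]) (auto simp: inj)
    then show False using i by simp
  qed
  show False if "\<not> N i \<le> L i"
  proof -
    have "p j \<in> {..<i}" if j: "j \<in> {..i}" for j
    proof -
      have "L j \<le> L i" using L[of j i] j i by (cases "i = j") auto
      moreover have "N (p j) \<le> L j" using adm j i by (simp add: admissible_def)
      ultimately have "N (p j) < N i" using \<open>\<not> N i \<le> L i\<close> by simp
      moreover have "N i \<le> N (p j)" if "i \<le> p j"
        using N[of i "p j"] that i permutes_less[OF p, of j] j by (cases "p j = i") auto
      ultimately show ?thesis by (force simp: not_le[symmetric])
    qed
    then have "card {..i} \<le> card {..<i}"
      by (intro card_inj_on_le[of p]) (auto simp: inj)
    then show False by simp
  qed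
qed

text \<open>Diagonal \<open>c\<close> meets both sets in equally many rows, namely the number of
  \<open>i\<close> with \<open>N i \<le> c\<close> minus the number with \<open>L i \<le> c\<close>.
  Any bijection of the differences then moves rows upwards: a row \<open>i\<close> that leaves has
  \<open>N i \<le> c\<close>, while a row \<open>i'\<close> that enters has
  \<open>c < N i'\<close>.\<close>

lemma slots_exchange:
  assumes N: "\<And>i j. i < j \<Longrightarrow> j < d \<Longrightarrow> N i < N j"
    and p: "p permutes {0..<d}"
    and le: "\<And>i. i < d \<Longrightarrow> N i \<le> L i" and lep: "\<And>i. i < d \<Longrightarrow> N (p i) \<le> L i"
  obtains h where "bij_betw h (slots d N L - slots d (N \<circ> p) L) (slots d (N \<circ> p) L - slots d N L)"
    and "\<And>i c. (i, c) \<in> slots d N L - slots d (N \<circ> p) L \<Longrightarrow> \<exists>i'. h (i, c) = (i', c) \<and> i < i'"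
proof -
  define A where "A c = {i. i < d \<and> N i \<le> c \<and> c < L i}" for c
  define B where "B c = {i. i < d \<and> N (p i) \<le> c \<and> c < L i}" for c
  have fin: "finite (A c)" "finite (B c)" for c by (auto simp: A_def B_def)
  have cardAB: "card (A c) = card (B c)" for c
  proof -
    have "A c = {i. i < d \<and> N i \<le> c} - {i. i < d \<and> L i \<le> c}" by (auto simp: A_def)
    also have "card \<dots> = card {i. i < d \<and> N i \<le> c} - card {i. i < d \<and> L i \<le> c}"
      using le by (intro card_Diff_subset) (auto intro: le_trans)
    also have "card {i. i < d \<and> N i \<le> c} = card {i. i < d \<and> N (p i) \<le> c}"
    proof -
      have "p ` {i. i < d \<and> N (p i) \<le> c} = {i. i < d \<and> N i \<le> c}"
      proof (intro equalityI subsetI)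
        fix i assume i: "i \<in> {i. i < d \<and> N i \<le> c}"
        then have "i = p (Hilbert_Choice.inv p i)" "Hilbert_Choice.inv p i < d"
          using permutes_inverses(1)[OF p] permutes_less[OF permutes_inv[OF p]] by auto
        with i show "i \<in> p ` {i. i < d \<and> N (p i) \<le> c}" by (metis (mono_tags, lifting) image_eqI mem_Collect_eq)
      qed (use permutes_less[OF p] in auto)
      then show ?thesis using card_image[OF permutes_inj_on[OF p]] by metis
    qed
    also have "card {i. i < d \<and> N (p i) \<le> c} - card {i. i < d \<and> L i \<le> c} =
        card ({i. i < d \<and> N (p i) \<le> c} - {i. i < d \<and> L i \<le> c})"
      using lep by (intro card_Diff_subset[symmetric]) (auto intro: le_trans)
    also have "{i. i < d \<and> N (p i) \<le> c} - {i. i < d \<and> L i \<le> c} = B c" by (auto simp: B_def)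
    finally show ?thesis .
  qed
  have "card (A c - B c) = card (B c - A c)" for c
    using fin[of c] cardAB[of c] by (simp add: card_Diff_subset_Int Int_commute)
  then have "\<exists>h. bij_betw h (A c - B c) (B c - A c)" for c
    using fin[of c] by (intro finite_same_card_bij) auto
  then obtain h where h: "\<And>c. bij_betw (h c) (A c - B c) (B c - A c)" by metis
  have mem: "(i, c) \<in> slots d N L \<longleftrightarrow> i \<in> A c" "(i, c) \<in> slots d (N \<circ> p) L \<longleftrightarrow> i \<in> B c" for i c
    by (auto simp: mem_slots A_def B_def)
  show ?thesis
  proof (rule that[of "\<lambda>(i, c). (h c i, c)"])
    show "bij_betw (\<lambda>(i, c). (h c i, c)) (slots d N L - slots d (N \<circ> p) L) (slots d (N \<circ> p) L - slots d N L)"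
    proof (rule bij_betwI')
      fix x y assume "x \<in> slots d N L - slots d (N \<circ> p) L" "y \<in> slots d N L - slots d (N \<circ> p) L"
      then show "((case x of (i, c) \<Rightarrow> (h c i, c)) = (case y of (i, c) \<Rightarrow> (h c i, c))) = (x = y)"
        using bij_betw_imp_inj_on[OF h] by (cases x; cases y) (auto simp: mem dest: inj_onD)
    next
      fix x assume "x \<in> slots d N L - slots d (N \<circ> p) L"
      then show "(case x of (i, c) \<Rightarrow> (h c i, c)) \<in> slots d (N \<circ> p) L - slots d N L"
        using bij_betwE[OF h] by (cases x) (auto simp: mem)
    next
      fix y assume "y \<in> slots d (N \<circ> p) L - slots d N L"
      moreover obtain i c where "y = (i, c)" by (cases y)
      ultimately have "i \<in> B c - A c" by (auto simp: mem)
      then obtain j where "j \<in> A c - B c" "h c j = i"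
        using bij_betw_imp_surj_on[OF h[of c]] by (metis imageE)
      then show "\<exists>x\<in>slots d N L - slots d (N \<circ> p) L. y = (case x of (i, c) \<Rightarrow> (h c i, c))"
        using \<open>y = (i, c)\<close> by (intro bexI[of _ "(j, c)"]) (auto simp: mem)
    qed
    fix i c assume "(i, c) \<in> slots d N L - slots d (N \<circ> p) L"
    then have i: "i \<in> A c - B c" by (auto simp: mem)
    then have hi: "h c i \<in> B c - A c" using bij_betwE[OF h[of c]] by blast
    have "i < h c i"
    proof (rule ccontr)
      assume "\<not> i < h c i"
      then have "N (h c i) \<le> N i"
        using N[of "h c i" i] i by (cases "h c i = i") (auto simp: A_def)
      with i hi show False by (auto simp: A_def B_def)
    qed
    then show "\<exists>i'. (case (i, c) of (i, c) \<Rightarrow> (h c i, c)) = (i', c) \<and> i < i'" by auto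
  qed
qed

text \<open>If nothing moves, every row of boxes has the same starting column on both sides, so
  \<open>N i = N (p i)\<close>; for an empty row both starts equal \<open>L i\<close>.\<close>

lemma slots_exchange_nonempty:
  assumes N: "\<And>i j. i < j \<Longrightarrow> j < d \<Longrightarrow> N i < N j"
    and p: "p permutes {0..<d}" and "p \<noteq> id"
    and le: "\<And>i. i < d \<Longrightarrow> N i \<le> L i" and lep: "\<And>i. i < d \<Longrightarrow> N (p i) \<le> L i"
  shows "slots d N L - slots d (N \<circ> p) L \<noteq> {}"
proof
  assume e: "slots d N L - slots d (N \<circ> p) L = {}"
  obtain h where "bij_betw h (slots d N L - slots d (N \<circ> p) L) (slots d (N \<circ> p) L - slots d N L)"
    by (rule slots_exchange[where d = d and N = N and L = L and p = p, OF N p le lep])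
  then have "slots d (N \<circ> p) L - slots d N L = {}"
    unfolding e by (simp add: bij_betw_def)
  with e have eq: "slots d N L = slots d (N \<circ> p) L" by blast
  have "p i = i" for i
  proof (cases "i < d")
    case True
    have "N i \<le> c \<and> c < L i \<longleftrightarrow> N (p i) \<le> c \<and> c < L i" for c
      using arg_cong[OF eq, of "\<lambda>S. (i, c) \<in> S"] True by (simp add: mem_slots)
    from this[of "N i"] this[of "N (p i)"] have "N i = N (p i)"
      using le[OF True] lep[OF True] by auto
    then show ?thesis
      using N[of i "p i"] N[of "p i" i] True permutes_less[OF p True]
      by (cases i "p i" rule: linorder_cases) auto
  next
    case False
    then show ?thesis using p by (simp add: permutes_def)
  qed
  then show False using \<open>p \<noteq> id\<close> by auto
qed

text \<open>When \<open>M i \<le> L i\<close>, the coefficient at \<open>L i\<close> is an empty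
  product, so the polynomial is monic of degree \<open>L i\<close>. This gives the echelon form and
  normalizes the Pluecker coordinate of \<open>lam\<close> to 1.\<close>

definition row_poly :: "(nat \<Rightarrow> nat) \<Rightarrow> (nat \<Rightarrow> nat) \<Rightarrow> (nat \<times> nat \<Rightarrow> 'a :: comm_ring_1) \<Rightarrow> nat \<Rightarrow> 'a poly" where
  "row_poly M L Z i = (\<Sum>k\<in>{M i..L i}. Polynomial.monom (\<Prod>c\<in>{k..<L i}. Z (i, c)) k)"

lemma coeff_row_poly:
  "Polynomial.coeff (row_poly M L Z i) k = (if M i \<le> k \<and> k \<le> L i then \<Prod>c\<in>{k..<L i}. Z (i, c) else 0)"
  by (simp add: row_poly_def coeff_sum)

lemma degree_row_poly: "degree (row_poly M L Z i) \<le> L i"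
  by (rule degree_le) (simp add: coeff_row_poly)

text \<open>Row \<open>i\<close> contributes the product of \<open>Z\<close> over its segment from
  column \<open>N (p i)\<close> to the end; these segments together form
  \<open>slots d (N \<circ> p) L\<close>.\<close>

lemma det_row_poly:
  "Determinant.det (Matrix.mat d d (\<lambda>(i, j). Polynomial.coeff (row_poly M L Z i) (N j))) =
    (\<Sum>p | p permutes {0..<d} \<and> admissible d M N L p. of_int (sign p) * (\<Prod>b\<in>slots d (N \<circ> p) L. Z b))"
proof -
  have "Determinant.det (Matrix.mat d d (\<lambda>(i, j). Polynomial.coeff (row_poly M L Z i) (N j))) =
      (\<Sum>p | p permutes {0..<d}. of_int (sign p) * (\<Prod>i<d. Polynomial.coeff (row_poly M L Z i) (N (p i))))"
    by (subst det_def'[where n = d])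
      (auto simp: atLeast0LessThan permutes_less intro!: sum.cong prod.cong arg_cong2[where f = "(*)"])
  also have "\<dots> = (\<Sum>p | p permutes {0..<d}. if admissible d M N L p then
      of_int (sign p) * (\<Prod>b\<in>slots d (N \<circ> p) L. Z b) else 0)"
  proof (intro sum.cong refl)
    fix p
    show "of_int (sign p) * (\<Prod>i<d. Polynomial.coeff (row_poly M L Z i) (N (p i))) =
       (if admissible d M N L p then of_int (sign p) * (\<Prod>b\<in>slots d (N \<circ> p) L. Z b) else 0)"
    proof (cases "admissible d M N L p")
      case True
      then have "(\<Prod>i<d. Polynomial.coeff (row_poly M L Z i) (N (p i))) = (\<Prod>i<d. \<Prod>c\<in>{N (p i)..<L i}. Z (i, c))"
        by (intro prod.cong) (auto simp: admissible_def coeff_row_poly)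
      also have "\<dots> = (\<Prod>b\<in>slots d (N \<circ> p) L. Z b)"
        unfolding slots_def by (subst prod.Sigma) auto
      finally show ?thesis using True by simp
    next
      case False
      then obtain i where "i < d" "\<not> (M i \<le> N (p i) \<and> N (p i) \<le> L i)"
        by (auto simp: admissible_def)
      then have "(\<Prod>i<d. Polynomial.coeff (row_poly M L Z i) (N (p i))) = 0"
        by (intro prod_zero) (auto simp: coeff_row_poly)
      then show ?thesis using False by simp
    qed
  qed
  also have "\<dots> = (\<Sum>p | p permutes {0..<d} \<and> admissible d M N L p. of_int (sign p) * (\<Prod>b\<in>slots d (N \<circ> p) L. Z b))"
    using sum.inter_filter[of "{p. p permutes {0..<d}}" "\<lambda>p. of_int (sign p) * (\<Prod>b\<in>slots d (N \<circ> p) L. Z b)"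
        "admissible d M N L"] finite_permutations[of "{0..<d}"] by simp
  finally show ?thesis .
qed

lemma dim_span_echelon:
  fixes f :: "nat \<Rightarrow> 'a :: field poly"
  assumes L: "\<And>i j. i < j \<Longrightarrow> j < d \<Longrightarrow> L i < L j"
    and deg: "\<And>i. i < d \<Longrightarrow> degree (f i) \<le> L i" and lead: "\<And>i. i < d \<Longrightarrow> Polynomial.coeff (f i) (L i) \<noteq> 0"
  shows "poly_vs.dim (poly_vs.span (f ` {..<d})) = d"
proof -
  have degf: "degree (f i) = L i" if "i < d" for i
    using deg[OF that] le_degree[OF lead[OF that]] by simp
  have inj: "inj_on f {..<d}"
  proof (rule linorder_inj_onI)
    fix i j assume "i < j" "j \<in> {..<d}"
    then have "degree (f i) < degree (f j)" using L[of i j] by (simp add: degf)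
    then show "f i \<noteq> f j" by auto
  qed auto
  have "poly_vs.independent (f ` {..<d})"
  proof (rule ccontr)
    assume "\<not> ?thesis"
    then obtain u where u: "\<exists>v\<in>f ` {..<d}. u v \<noteq> 0" "(\<Sum>v\<in>f ` {..<d}. Polynomial.smult (u v) v) = 0"
      using poly_vs.dependent_finite[of "f ` {..<d}"] by auto
    define S where "S = {i. i < d \<and> u (f i) \<noteq> 0}"
    have S: "finite S" "S \<noteq> {}" using u(1) by (auto simp: S_def)
    \<comment> \<open>At exponent \<open>L k\<close>, polynomials of smaller index have too small a
      degree, and those of larger index do not occur in the relation.\<close>
    define k where "k = Max S"
    have k: "k < d" "u (f k) \<noteq> 0" using Max_in[OF S] by (auto simp: k_def S_def)
    have z: "Polynomial.coeff (Polynomial.smult (u (f i)) (f i)) (L k) = 0" if "i < d" "i \<noteq> k" for i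
    proof (cases "i < k")
      case True
      then have "degree (f i) < L k" using L[of i k] k by (simp add: degf)
      then show ?thesis by (simp add: coeff_eq_0)
    next
      case False
      then have "i \<notin> S" using that Max_ge[OF S(1), of i] by (auto simp: k_def)
      then show ?thesis using that by (simp add: S_def)
    qed
    have "(\<Sum>i<d. Polynomial.coeff (Polynomial.smult (u (f i)) (f i)) (L k)) =
        (\<Sum>i<d. if i = k then u (f k) * Polynomial.coeff (f k) (L k) else 0)"
    proof (intro sum.cong refl)
      fix i assume "i \<in> {..<d}"
      then show "Polynomial.coeff (Polynomial.smult (u (f i)) (f i)) (L k) =
          (if i = k then u (f k) * Polynomial.coeff (f k) (L k) else 0)"
        using z[of i] by (cases "i = k") (simp, simp del: mult_eq_0_iff)
    qed
    then have "(\<Sum>i<d. Polynomial.coeff (Polynomial.smult (u (f i)) (f i)) (L k)) = u (f k) * Polynomial.coeff (f k) (L k)"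
      using k by simp
    moreover have "(\<Sum>i<d. Polynomial.smult (u (f i)) (f i)) = 0"
      using u(2) by (simp add: sum.reindex[OF inj])
    then have "(\<Sum>i<d. Polynomial.coeff (Polynomial.smult (u (f i)) (f i)) (L k)) = 0"
      by (metis coeff_0 coeff_sum)
    ultimately show False using k lead[of k] by simp
  qed
  then show ?thesis
    by (simp add: poly_vs.dim_eq_card_independent card_image[OF inj])
qed

definition box_of :: "nat \<Rightarrow> nat \<times> nat \<Rightarrow> nat \<times> nat" where
  "box_of d = (\<lambda>(i, c). (d - Suc i, c - i))"

lemma mem_skew:
  assumes "length lam = d" "length mu = d"
  shows "(r, j) \<in> skew lam mu \<longleftrightarrow> r < d \<and> mu ! r \<le> j \<and> j < lam ! r"
  using assms by (auto simp: skew_def diagram_def)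

lemma bij_betw_box_of:
  assumes "length lam = d" "length nu = d"
  shows "bij_betw (box_of d) (slots d (col_index d nu) (col_index d lam)) (skew lam nu)"
proof (rule bij_betwI')
  fix x y assume "x \<in> slots d (col_index d nu) (col_index d lam)" "y \<in> slots d (col_index d nu) (col_index d lam)"
  then show "(box_of d x = box_of d y) = (x = y)"
    by (cases x; cases y) (auto simp: mem_slots col_index_def box_of_def)
next
  fix x assume "x \<in> slots d (col_index d nu) (col_index d lam)"
  then show "box_of d x \<in> skew lam nu"
    by (cases x) (auto simp: mem_slots col_index_def box_of_def mem_skew[OF assms])
next
  fix y assume "y \<in> skew lam nu"
  moreover obtain r j where "y = (r, j)" by (cases y)
  ultimately show "\<exists>x\<in>slots d (col_index d nu) (col_index d lam). y = box_of d x"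
    by (intro bexI[of _ "(d - Suc r, j + (d - Suc r))"])
      (auto simp: mem_slots col_index_def box_of_def mem_skew[OF assms] Suc_diff_Suc)
qed

lemma part_le_iff:
  assumes "length mu = d" "length nu = d"
  shows "mu \<preceq> nu \<longleftrightarrow> (\<forall>i<d. mu ! i \<le> nu ! i)"
proof
  assume le: "mu \<preceq> nu"
  show "\<forall>i<d. mu ! i \<le> nu ! i"
  proof (intro allI impI, rule ccontr)
    fix i assume "i < d" "\<not> mu ! i \<le> nu ! i"
    then have "(i, nu ! i) \<in> diagram mu" using assms by (simp add: diagram_def)
    with le show False by (auto simp: part_le_def diagram_def)
  qed
qed (use assms in \<open>fastforce simp: part_le_def diagram_def\<close>)

lemma part_le_iff_col_index:
  assumes "length mu = d" "length nu = d"
  shows "mu \<preceq> nu \<longleftrightarrow> (\<forall>i<d. col_index d mu i \<le> col_index d nu i)"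
proof -
  have "(\<forall>i<d. mu ! i \<le> nu ! i) \<longleftrightarrow> (\<forall>i<d. mu ! (d - Suc i) \<le> nu ! (d - Suc i))"
  proof
    assume *: "\<forall>i<d. mu ! (d - Suc i) \<le> nu ! (d - Suc i)"
    show "\<forall>i<d. mu ! i \<le> nu ! i"
    proof (intro allI impI)
      fix i assume "i < d"
      then show "mu ! i \<le> nu ! i" using *[rule_format, of "d - Suc i"] by (simp add: Suc_diff_Suc)
    qed
  qed auto
  then show ?thesis by (simp add: part_le_iff[OF assms] col_index_def)
qed

section \<open>Minimal subtableaux\<close>

instance extended :: (ordered_comm_monoid_add) ordered_comm_monoid_add ..

text \<open>Exchange along a bijection of the differences. The common part is added back rather than
  cancelled, since in the application sums may be infinite.\<close>

lemma sum_exchange_le: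
  fixes v :: "'b \<Rightarrow> 'a :: ordered_comm_monoid_add"
  assumes "finite A" "finite B" "card A = card B"
    and le: "\<And>a b. a \<in> A - B \<Longrightarrow> b \<in> B - A \<Longrightarrow> v a \<le> v b"
  shows "(\<Sum>a\<in>A. v a) \<le> (\<Sum>b\<in>B. v b)"
proof -
  have "card (A - B) = card (B - A)"
    using assms(1-3) by (simp add: card_Diff_subset_Int Int_commute)
  then obtain h where h: "bij_betw h (A - B) (B - A)"
    using finite_same_card_bij[of "A - B" "B - A"] assms(1,2) by auto
  have "(\<Sum>a\<in>A. v a) = (\<Sum>a\<in>A - B. v a) + (\<Sum>a\<in>A \<inter> B. v a)"
    using assms(1) by (subst sum.union_disjoint[symmetric]) (auto intro!: sum.cong)
  also have "\<dots> \<le> (\<Sum>a\<in>A - B. v (h a)) + (\<Sum>a\<in>A \<inter> B. v a)"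
    using bij_betwE[OF h] le by (intro add_right_mono sum_mono) auto
  also have "(\<Sum>a\<in>A - B. v (h a)) = (\<Sum>b\<in>B - A. v b)"
    by (rule sum.reindex_bij_betw[OF h])
  also have "\<dots> + (\<Sum>a\<in>A \<inter> B. v a) = (\<Sum>b\<in>B. v b)"
    using assms(2) by (subst sum.union_disjoint[symmetric]) (auto intro!: sum.cong)
  finally show ?thesis .
qed

lemma finite_skew [simp]:
  assumes "length lam = d" "length mu = d"
  shows "finite (skew lam mu)"
  using bij_betw_finite[OF bij_betw_box_of[OF assms]] by simp

lemma card_skew:
  assumes "length lam = d" "length mu = d" "mu \<preceq> lam"
  shows "card (skew lam mu) + sum_list mu = sum_list lam"
proof -
  have "skew lam mu = (SIGMA r:{..<d}. {mu ! r..<lam ! r})"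
    using mem_skew[OF assms(1,2)] by auto
  then have "card (skew lam mu) = (\<Sum>r<d. lam ! r - mu ! r)"
    by simp
  moreover have "(\<Sum>r<d. lam ! r - mu ! r) + (\<Sum>r<d. mu ! r) = (\<Sum>r<d. lam ! r)"
    unfolding sum.distrib[symmetric] using assms by (intro sum.cong) (auto simp: part_le_iff)
  ultimately show ?thesis
    using assms by (simp add: sum_list_sum_nth atLeast0LessThan)
qed

text \<open>Greedy growth: each step adds a box with the largest remaining value. Among ties one
  with least coordinate sum is taken, and monotonicity of \<open>v\<close> then makes it an addable
  corner.\<close>

lemma ordered_subpartition:
  fixes v :: "nat \<times> nat \<Rightarrow> 'o :: linorder"
  assumes lam: "lam \<in> partitions d n" and mu: "mu \<in> partitions d n" and le: "mu \<preceq> lam"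
    and row: "\<And>r j j'. (r, j) \<in> skew lam mu \<Longrightarrow> (r, j') \<in> skew lam mu \<Longrightarrow> j < j' \<Longrightarrow> v (r, j') \<le> v (r, j)"
    and col: "\<And>r r' j. (r, j) \<in> skew lam mu \<Longrightarrow> (r', j) \<in> skew lam mu \<Longrightarrow> r < r' \<Longrightarrow> v (r', j) \<le> v (r, j)"
    and "i \<le> card (skew lam mu)"
  shows "\<exists>nu\<in>partitions d n. mu \<preceq> nu \<and> nu \<preceq> lam \<and> sum_list nu = sum_list mu + i \<and>
    (\<forall>b\<in>skew nu mu. \<forall>b'\<in>skew lam nu. v b' \<le> v b)"
  using assms(6)
proof (induction i)
  case 0
  have "skew mu mu = {}" by (simp add: skew_def)
  then show ?case using mu le by (intro bexI[of _ mu]) (auto simp: part_le_def)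
next
  case (Suc i)
  then obtain nu where nu: "nu \<in> partitions d n" "mu \<preceq> nu" "nu \<preceq> lam" "sum_list nu = sum_list mu + i"
    and good: "\<And>b b'. b \<in> skew nu mu \<Longrightarrow> b' \<in> skew lam nu \<Longrightarrow> v b' \<le> v b" by auto
  note len = partitionsD(1)[OF lam] partitionsD(1)[OF mu] partitionsD(1)[OF nu(1)]
  have mem: "(r, j) \<in> skew lam nu \<longleftrightarrow> r < d \<and> nu ! r \<le> j \<and> j < lam ! r"
    "(r, j) \<in> skew lam mu \<longleftrightarrow> r < d \<and> mu ! r \<le> j \<and> j < lam ! r"
    "(r, j) \<in> skew nu mu \<longleftrightarrow> r < d \<and> mu ! r \<le> j \<and> j < nu ! r" for r j
    by (simp_all add: mem_skew[OF len(1,3)] mem_skew[OF len(1,2)] mem_skew[OF len(3,2)])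
  have munu: "mu ! r \<le> nu ! r" "nu ! r \<le> lam ! r" if "r < d" for r
    using nu(2,3) that len by (auto simp: part_le_iff)
  define S where "S = skew lam nu"
  have "finite S" using len by (simp add: S_def)
  have "card S > 0"
    using card_skew[OF len(1,3) nu(3)] card_skew[OF len(1,2) le] nu(4) Suc.prems by (simp add: S_def)
  then have "S \<noteq> {}" by auto
  define S' where "S' = {b \<in> S. v b = Max (v ` S)}"
  have "Max (v ` S) \<in> v ` S" using \<open>finite S\<close> \<open>S \<noteq> {}\<close> by (intro Max_in) auto
  then obtain b0 where "b0 \<in> S'" unfolding S'_def by force
  then obtain b where b: "b \<in> S'" and bmin: "\<And>b'. b' \<in> S' \<Longrightarrow> fst b + snd b \<le> fst b' + snd b'"
    using ex_has_least_nat[of "\<lambda>b. b \<in> S'" b0 "\<lambda>b. fst b + snd b"] by blast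
  obtain r j where rj: "b = (r, j)" by (cases b)
  have bmax: "v b' \<le> v (r, j)" if "b' \<in> S" for b'
    using b that \<open>finite S\<close> by (auto simp: S'_def rj)
  have bS: "(r, j) \<in> skew lam nu" using b by (auto simp: S'_def S_def rj)
  \<comment> \<open>The tie-breaking makes weak monotonicity sufficient: a remaining box with
    smaller coordinate sum has strictly smaller value, so neither the left nor the upper neighbour
    of the chosen box can remain.\<close>
  have low: "b' \<notin> S \<or> \<not> v (r, j) \<le> v b'" if "fst b' + snd b' < r + j" for b'
  proof (rule ccontr)
    assume "\<not> ?thesis"
    then have b': "b' \<in> S" "v (r, j) \<le> v b'" by auto
    then have "v b' = v (r, j)" using bmax by (simp add: antisym)
    then have "b' \<in> S'" using b b' by (simp add: S'_def rj)
    then show False using bmin[of b'] that by (simp add: rj)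
  qed
  have r: "r < d" "nu ! r \<le> j" "j < lam ! r" using bS by (auto simp: mem)
  have j: "j = nu ! r"
  proof (rule ccontr)
    assume "j \<noteq> nu ! r"
    then have "(r, j - 1) \<in> S" "j - 1 < j" using r by (auto simp: S_def mem)
    moreover have "v (r, j) \<le> v (r, j - 1)"
      by (rule row) (use r \<open>j \<noteq> nu ! r\<close> munu(1)[of r] in \<open>auto simp: mem\<close>)
    ultimately show False using low[of "(r, j - 1)"] by auto
  qed
  have up: "j < nu ! (r - 1)" if "0 < r"
  proof (rule ccontr)
    assume nless: "\<not> j < nu ! (r - 1)"
    have "lam ! r \<le> lam ! (r - 1)" by (rule partitionsD(2)[OF lam]) (use r in auto)
    then have s: "(r - 1, j) \<in> S" using nless r by (auto simp: S_def mem)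
    have "v (r, j) \<le> v (r - 1, j)"
      by (rule col) (use r s that munu(1)[of r] munu(1)[of "r - 1"] in \<open>auto simp: S_def mem\<close>)
    then show False using low[of "(r - 1, j)"] s that by auto
  qed
  define nu' where "nu' = nu[r := Suc j]"
  have nth: "nu' ! s = (if s = r then Suc j else nu ! s)" if "s < d" for s
    using len that by (simp add: nu'_def)
  have nu': "nu' \<in> partitions d n"
  proof (rule partitionsI)
    show "length nu' = d" using len by (simp add: nu'_def)
    show "nu' ! Suc s \<le> nu' ! s" if "Suc s < d" for s
      using partitionsD(2)[OF nu(1), of s "Suc s"] that up j by (auto simp: nth Suc_le_eq)
    show "nu' ! s \<le> n - d" if "s < d" for s
      using partitionsD(3)[OF nu(1) that] partitionsD(3)[OF lam that] r that by (auto simp: nth)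
  qed
  note len' = partitionsD(1)[OF nu']
  have "mu \<preceq> nu'"
    unfolding part_le_iff[OF len(2) len'] using munu j by (auto simp: nth le_Suc_eq)
  moreover have "nu' \<preceq> lam"
    unfolding part_le_iff[OF len' len(1)] using munu r by (auto simp: nth)
  moreover have "sum_list nu' = sum_list mu + Suc i"
    using nu(4) r len j by (simp add: nu'_def sum_list_update)
  moreover have "v b2 \<le> v b1" if b1: "b1 \<in> skew nu' mu" and b2: "b2 \<in> skew lam nu'" for b1 b2
  proof -
    obtain r1 j1 r2 j2 where e: "b1 = (r1, j1)" "b2 = (r2, j2)" by (cases b1, cases b2)
    have "b1 = (r, j) \<or> b1 \<in> skew nu mu"
      using b1 j by (auto simp: e mem mem_skew[OF len' len(2)] nth split: if_splits)
    moreover have "b2 \<in> S"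
      using b2 j by (auto simp: e mem mem_skew[OF len(1) len'] nth S_def split: if_splits)
    ultimately show ?thesis using bmax[of b2] good[of b1 b2] by (auto simp: S_def)
  qed
  ultimately show ?case using nu' by blast
qed

section \<open>Hensel's lemma in several variables\<close>

text \<open>Componentwise congruence modulo the k-th power of the maximal ideal.\<close>

definition agree_below :: "nat \<Rightarrow> nat \<Rightarrow> (nat \<Rightarrow> 'a :: zero fps) \<Rightarrow> (nat \<Rightarrow> 'a fps) \<Rightarrow> bool" where
  "agree_below m k Y Y' \<longleftrightarrow> (\<forall>j<m. \<forall>l<k. fps_nth (Y j) l = fps_nth (Y' j) l)"

definition null_const :: "nat \<Rightarrow> (nat \<Rightarrow> 'a :: zero fps) \<Rightarrow> bool" where
  "null_const m Y \<longleftrightarrow> (\<forall>j<m. fps_nth (Y j) 0 = 0)"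

text \<open>
  \<open>G\<close> has gradient \<open>g\<close> at the origin if it is affine with linear part \<open>g\<close> up to the first order in
  which two arguments differ; this makes the Newton iteration with the constant Jacobian contract.
\<close>

definition has_gradient ::
    "nat \<Rightarrow> ((nat \<Rightarrow> 'a :: field fps) \<Rightarrow> 'a fps) \<Rightarrow> (nat \<Rightarrow> 'a) \<Rightarrow> bool" where
  "has_gradient m G g \<longleftrightarrow> (\<forall>Y Y' k l. null_const m Y \<longrightarrow> null_const m Y' \<longrightarrow> agree_below m k Y Y' \<longrightarrow> l \<le> k \<longrightarrow>
     fps_nth (G Y - G Y') l = (\<Sum>j<m. g j * fps_nth (Y j - Y' j) l))"

lemma has_gradientD:
  assumes "has_gradient m G g" "null_const m Y" "null_const m Y'" "agree_below m k Y Y'" "l \<le> k"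
  shows "fps_nth (G Y - G Y') l = (\<Sum>j<m. g j * fps_nth (Y j - Y' j) l)"
  using assms unfolding has_gradient_def by blast

lemma has_gradient_low:
  assumes "has_gradient m G g" "null_const m Y" "null_const m Y'" "agree_below m k Y Y'" "l < k"
  shows "fps_nth (G Y - G Y') l = 0"
  using has_gradientD[OF assms(1-4), of l] assms(4,5) by (simp add: agree_below_def)

lemma null_const_0: "null_const m (\<lambda>_. 0)"
  by (simp add: null_const_def)

lemma has_gradient_nth_0:
  assumes "has_gradient m G g" "null_const m Y"
  shows "fps_nth (G Y) 0 = fps_nth (G (\<lambda>_. 0)) 0"
  using has_gradientD[OF assms null_const_0, of 0 0] assms(2)
  by (simp add: agree_below_def null_const_def)

lemma has_gradient_const: "has_gradient m (\<lambda>_. c) (\<lambda>_. 0)"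
  by (simp add: has_gradient_def)

lemma has_gradient_var:
  assumes "k < m"
  shows "has_gradient m (\<lambda>Y. c + Y k) (\<lambda>j. if j = k then 1 else 0)"
proof -
  have "(if j = k then 1 else 0) * x = (if j = k then x else (0::'a))" for j x by simp
  then show ?thesis using assms by (simp add: has_gradient_def)
qed

text \<open>Product rule: up to order \<open>k\<close>, a difference that vanishes below order
  \<open>k\<close> meets only the constant term of the other factor, and this constant term is the
  same for all arguments in the maximal ideal.\<close>

lemma has_gradient_mult:
  assumes G: "has_gradient m G g" and H: "has_gradient m H h"
  shows "has_gradient m (\<lambda>Y. G Y * H Y)
    (\<lambda>j. fps_nth (G (\<lambda>_. 0)) 0 * h j + fps_nth (H (\<lambda>_. 0)) 0 * g j)"
  unfolding has_gradient_def
proof (intro allI impI)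
  fix Y Y' :: "nat \<Rightarrow> 'a fps" and k l
  assume Y: "null_const m Y" "null_const m Y'" and agr: "agree_below m k Y Y'" and l: "l \<le> k"
  have low: "fps_nth (D * E) l = fps_nth D l * fps_nth E 0"
    if "\<And>i. i < k \<Longrightarrow> fps_nth D i = 0" for D E :: "'a fps"
  proof -
    have "fps_nth (D * E) l = (\<Sum>i\<in>{0..l}. fps_nth D i * fps_nth E (l - i))"
      by (rule fps_mult_nth)
    also have "\<dots> = (\<Sum>i\<in>{l}. fps_nth D i * fps_nth E (l - i))"
      by (rule sum.mono_neutral_right) (use that l in auto)
    finally show ?thesis by simp
  qed
  have "G Y * H Y - G Y' * H Y' = (G Y - G Y') * H Y + (H Y - H Y') * G Y'"
    by (simp add: algebra_simps)
  then have "fps_nth (G Y * H Y - G Y' * H Y') l =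
      fps_nth (G Y - G Y') l * fps_nth (H Y) 0 + fps_nth (H Y - H Y') l * fps_nth (G Y') 0"
    using low[of "G Y - G Y'" "H Y"] low[of "H Y - H Y'" "G Y'"]
      has_gradient_low[OF G Y agr] has_gradient_low[OF H Y agr] by (simp only: fps_add_nth)
  also have "\<dots> = (\<Sum>j<m. (fps_nth (G (\<lambda>_. 0)) 0 * h j + fps_nth (H (\<lambda>_. 0)) 0 * g j) * fps_nth (Y j - Y' j) l)"
    unfolding has_gradientD[OF G Y agr l] has_gradientD[OF H Y agr l]
      has_gradient_nth_0[OF G Y(2)] has_gradient_nth_0[OF H Y(1)]
    unfolding sum_distrib_right sum.distrib[symmetric]
    by (intro sum.cong refl) (simp only: distrib_left distrib_right mult_ac add_ac)
  finally show "fps_nth (G Y * H Y - G Y' * H Y') l = \<dots>" .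
qed

lemma has_gradient_sum:
  fixes G :: "'x \<Rightarrow> (nat \<Rightarrow> 'a :: field fps) \<Rightarrow> 'a fps"
  assumes "\<And>x. x \<in> A \<Longrightarrow> has_gradient m (G x) (g x)"
  shows "has_gradient m (\<lambda>Y. \<Sum>x\<in>A. G x Y) (\<lambda>j. \<Sum>x\<in>A. g x j)"
  unfolding has_gradient_def
proof (intro allI impI)
  fix Y Y' :: "nat \<Rightarrow> 'a fps" and k l
  assume Y: "null_const m Y" "null_const m Y'" "agree_below m k Y Y'" "l \<le> k"
  have "fps_nth ((\<Sum>x\<in>A. G x Y) - (\<Sum>x\<in>A. G x Y')) l = (\<Sum>x\<in>A. fps_nth (G x Y - G x Y') l)"
    by (simp add: fps_sum_nth sum_subtractf)
  also have "\<dots> = (\<Sum>x\<in>A. \<Sum>j<m. g x j * fps_nth (Y j - Y' j) l)"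
    by (intro sum.cong refl has_gradientD[OF assms Y])
  also have "\<dots> = (\<Sum>j<m. (\<Sum>x\<in>A. g x j) * fps_nth (Y j - Y' j) l)"
    by (subst sum.swap) (simp only: sum_distrib_right)
  finally show "fps_nth ((\<Sum>x\<in>A. G x Y) - (\<Sum>x\<in>A. G x Y')) l = \<dots>" .
qed

lemma fps_prod_nth_0: "fps_nth (\<Prod>x\<in>A. f x) 0 = (\<Prod>x\<in>A. fps_nth (f x :: 'a :: comm_semiring_1 fps) 0)"
  by (induction A rule: infinite_finite_induct) auto

lemma fps_const_sum: "fps_const (\<Sum>x\<in>A. f x) = (\<Sum>x\<in>A. fps_const (f x :: 'a :: comm_monoid_add))"
  by (rule fps_ext) (simp add: fps_sum_nth)

lemma has_gradient_prod:
  assumes "finite B" "B \<subseteq> {..<m}"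
  shows "has_gradient m (\<lambda>Y. \<Prod>k\<in>B. fps_const (w k) + Y k)
    (\<lambda>j. if j \<in> B then \<Prod>k\<in>B - {j}. w k else 0)"
  using assms
proof (induction B rule: finite_induct)
  case empty
  then show ?case by (simp add: has_gradient_const)
next
  case (insert b B)
  have nth: "fps_nth (\<Prod>k\<in>B. fps_const (w k)) 0 = (\<Prod>k\<in>B. w k)"
    by (simp add: fps_prod_nth_0)
  have "has_gradient m (\<lambda>Y. (fps_const (w b) + Y b) * (\<Prod>k\<in>B. fps_const (w k) + Y k))
    (\<lambda>j. w b * (if j \<in> B then \<Prod>k\<in>B - {j}. w k else 0) + (\<Prod>k\<in>B. w k) * (if j = b then 1 else 0))"
    using has_gradient_mult[OF has_gradient_var[of b m "fps_const (w b)"] insert.IH] insert.prems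
    by (simp add: nth)
  also have "(\<lambda>j. w b * (if j \<in> B then \<Prod>k\<in>B - {j}. w k else 0) + (\<Prod>k\<in>B. w k) * (if j = b then 1 else 0))
     = (\<lambda>j. if j \<in> insert b B then \<Prod>k\<in>insert b B - {j}. w k else 0)"
  proof
    fix j
    show "w b * (if j \<in> B then \<Prod>k\<in>B - {j}. w k else 0) + (\<Prod>k\<in>B. w k) * (if j = b then 1 else 0)
      = (if j \<in> insert b B then \<Prod>k\<in>insert b B - {j}. w k else 0)"
    proof (cases "j = b")
      case True
      then show ?thesis using insert.hyps by simp
    next
      case False
      then have "insert b B - {j} = insert b (B - {j})" by auto
      then show ?thesis using insert.hyps False by simp
    qed
  qed
  finally show ?case using insert.hyps by simp
qed

text \<open>Newton iteration with the inverse \<open>K\<close> of the Jacobian at the origin kept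
  fixed. Each step makes one more coefficient stationary, so the iterates converge to a fixed
  point.\<close>

lemma multivariate_hensel:
  fixes F :: "nat \<Rightarrow> (nat \<Rightarrow> 'a :: field fps) \<Rightarrow> 'a fps"
  assumes J: "J \<in> carrier_mat m m" "Determinant.det J \<noteq> 0"
    and grad: "\<And>i. i < m \<Longrightarrow> has_gradient m (F i) (\<lambda>j. J $$ (i, j))"
    and F0: "\<And>i. i < m \<Longrightarrow> fps_nth (F i (\<lambda>_. 0)) 0 = 0"
  obtains Y where "null_const m Y" "\<And>i. i < m \<Longrightarrow> F i Y = 0"
proof -
  have "J \<in> Units (ring_mat TYPE('a) m ())" by (rule det_non_zero_imp_unit[OF J])
  then obtain K where K: "K \<in> carrier_mat m m" "K * J = 1\<^sub>m m" "J * K = 1\<^sub>m m"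
    by (auto simp: Units_def ring_mat_def)
  have KJ: "(\<Sum>i<m. K $$ (j, i) * J $$ (i, t)) = (if j = t then 1 else 0)" if "j < m" "t < m" for j t
    using arg_cong[OF K(2), of "\<lambda>A. A $$ (j, t)"] J(1) K(1) that
    by (simp add: scalar_prod_def atLeast0LessThan)
  have JK: "(\<Sum>i<m. J $$ (j, i) * K $$ (i, t)) = (if j = t then 1 else 0)" if "j < m" "t < m" for j t
    using arg_cong[OF K(3), of "\<lambda>A. A $$ (j, t)"] J(1) K(1) that
    by (simp add: scalar_prod_def atLeast0LessThan)
  define N where "N Y j = Y j - (\<Sum>i<m. fps_const (K $$ (j, i)) * F i Y)" for Y j
  have N0: "null_const m (N Y)" if Y: "null_const m Y" for Y
    using Y has_gradient_nth_0[OF grad Y] F0 by (simp add: null_const_def N_def fps_sum_nth)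
  have contr: "agree_below m (Suc k) (N Y) (N Y')"
    if Y: "null_const m Y" "null_const m Y'" "agree_below m k Y Y'" for Y Y' k
    unfolding agree_below_def
  proof (intro allI impI)
    fix j l assume j: "j < m" and "l < Suc k"
    then have l: "l \<le> k" by simp
    have "fps_nth (N Y j - N Y' j) l =
        fps_nth (Y j - Y' j) l - (\<Sum>i<m. K $$ (j, i) * fps_nth (F i Y - F i Y') l)"
      by (simp add: N_def fps_sum_nth sum_subtractf algebra_simps)
    also have "(\<Sum>i<m. K $$ (j, i) * fps_nth (F i Y - F i Y') l) =
        (\<Sum>i<m. K $$ (j, i) * (\<Sum>t<m. J $$ (i, t) * fps_nth (Y t - Y' t) l))"
      using has_gradientD[OF grad Y l] by simp
    also have "\<dots> = (\<Sum>i<m. \<Sum>t<m. K $$ (j, i) * J $$ (i, t) * fps_nth (Y t - Y' t) l)"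
      by (simp only: sum_distrib_left mult.assoc)
    also have "\<dots> = (\<Sum>t<m. (\<Sum>i<m. K $$ (j, i) * J $$ (i, t)) * fps_nth (Y t - Y' t) l)"
      by (subst sum.swap) (simp only: sum_distrib_right)
    also have "\<dots> = (\<Sum>t<m. if j = t then fps_nth (Y t - Y' t) l else 0)"
      using KJ[OF j] by (intro sum.cong) auto
    also have "\<dots> = fps_nth (Y j - Y' j) l" using j by simp
    finally show "fps_nth (N Y j) l = fps_nth (N Y' j) l" by simp
  qed
  define y where "y k = (N ^^ k) (\<lambda>_. 0)" for k
  have y_Suc: "y (Suc k) = N (y k)" for k by (simp add: y_def)
  have y0: "null_const m (y k)" for k
    by (induction k) (simp_all add: y_Suc N0, simp add: y_def null_const_0)
  have ysuc: "agree_below m (Suc k) (y k) (y (Suc k))" for k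
  proof (induction k)
    case 0
    then show ?case using y0[of 0] y0[of 1] by (simp add: agree_below_def null_const_def)
  next
    case (Suc k)
    then show ?case using contr[OF y0 y0 Suc] by (simp add: y_Suc)
  qed
  have yle: "fps_nth (y k j) l = fps_nth (y l j) l" if "l \<le> k" "j < m" for k l j
    using that
  proof (induction k rule: dec_induct)
    case (step k)
    then show ?case using ysuc[of k] by (simp add: agree_below_def)
  qed simp
  \<comment> \<open>Coefficient \<open>l\<close> no longer changes from the l-th iterate on, so the
    diagonal is the limit.\<close>
  define Y where "Y j = Abs_fps (\<lambda>l. fps_nth (y l j) l)" for j
  have Yy: "agree_below m (Suc k) Y (y k)" for k
    using yle[of _ k] by (simp add: agree_below_def Y_def)
  have Y0: "null_const m Y"
    using y0[of 0] by (simp add: null_const_def Y_def)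
  have fix_Y: "N Y j = Y j" if "j < m" for j
  proof (rule fps_ext)
    fix l
    have "fps_nth (N Y j) l = fps_nth (N (y l) j) l"
      using contr[OF Y0 y0 Yy, of l] that by (simp add: agree_below_def)
    also have "\<dots> = fps_nth (Y j) l"
      using Yy[of "Suc l"] that by (simp add: agree_below_def y_Suc)
    finally show "fps_nth (N Y j) l = fps_nth (Y j) l" .
  qed
  \<comment> \<open>The fixed point equation says that \<open>K\<close> annihilates the vector of
    all \<open>F t Y\<close>; multiplication by \<open>J\<close> undoes \<open>K\<close>.\<close>
  have "F i Y = 0" if i: "i < m" for i
  proof -
    have "0 = (\<Sum>j<m. fps_const (J $$ (i, j)) * (\<Sum>t<m. fps_const (K $$ (j, t)) * F t Y))"
      using fix_Y by (simp add: N_def)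
    also have "\<dots> = (\<Sum>j<m. \<Sum>t<m. fps_const (J $$ (i, j) * K $$ (j, t)) * F t Y)"
      by (simp only: sum_distrib_left mult.assoc[symmetric] fps_const_mult)
    also have "\<dots> = (\<Sum>t<m. fps_const (\<Sum>j<m. J $$ (i, j) * K $$ (j, t)) * F t Y)"
      by (subst sum.swap) (simp only: sum_distrib_right fps_const_sum)
    also have "\<dots> = (\<Sum>t<m. if i = t then F t Y else 0)"
      using JK[OF i] by (intro sum.cong) auto
    also have "\<dots> = F i Y" using i by simp
    finally show ?thesis by simp
  qed
  then show ?thesis using that Y0 by blast
qed

text \<open>For square-free monomials a partial derivative just deletes the variable, so the
  Jacobian has the explicit form that \<open>deriv_multiaffine\<close> also yields.\<close>

lemma hensel_multiaffine:
  fixes C :: "nat \<Rightarrow> 'x \<Rightarrow> 'a :: field fps" and B :: "'x \<Rightarrow> nat set"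
  assumes B: "\<And>x. B x \<subseteq> {..<m}"
    and lead: "\<And>i. i < m \<Longrightarrow> (\<Sum>x\<in>A i. fps_nth (C i x) 0 * (\<Prod>k\<in>B x. w k)) = fps_nth (c i) 0"
    and det: "Determinant.det (Matrix.mat m m (\<lambda>(i, j).
      \<Sum>x\<in>A i. fps_nth (C i x) 0 * (if j \<in> B x then \<Prod>k\<in>B x - {j}. w k else 0))) \<noteq> 0"
  obtains Y where "\<And>j. j < m \<Longrightarrow> fps_nth (Y j) 0 = 0"
    "\<And>i. i < m \<Longrightarrow> (\<Sum>x\<in>A i. C i x * (\<Prod>k\<in>B x. fps_const (w k) + Y k)) = c i"
proof -
  have fin: "finite (B x)" for x using B finite_subset by blast
  define J where "J = Matrix.mat m m (\<lambda>(i, j).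
      \<Sum>x\<in>A i. fps_nth (C i x) 0 * (if j \<in> B x then \<Prod>k\<in>B x - {j}. w k else 0))"
  define F where "F i Y = (\<Sum>x\<in>A i. C i x * (\<Prod>k\<in>B x. fps_const (w k) + Y k)) - c i" for i Y
  have grad: "has_gradient m (F i) (\<lambda>j. J $$ (i, j))" if "i < m" for i
  proof -
    have "has_gradient m (\<lambda>Y. C i x * (\<Prod>k\<in>B x. fps_const (w k) + Y k))
      (\<lambda>j. fps_nth (C i x) 0 * (if j \<in> B x then \<Prod>k\<in>B x - {j}. w k else 0))" for x
      using has_gradient_mult[OF has_gradient_const[of m "C i x"] has_gradient_prod[OF fin B]] by simp
    then have "has_gradient m (\<lambda>Y. \<Sum>x\<in>A i. C i x * (\<Prod>k\<in>B x. fps_const (w k) + Y k))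
      (\<lambda>j. \<Sum>x\<in>A i. fps_nth (C i x) 0 * (if j \<in> B x then \<Prod>k\<in>B x - {j}. w k else 0))"
      by (intro has_gradient_sum)
    then show ?thesis using that by (simp add: has_gradient_def F_def J_def)
  qed
  have F0: "fps_nth (F i (\<lambda>_. 0)) 0 = 0" if "i < m" for i
    using lead[OF that] by (simp add: F_def fps_sum_nth fps_prod_nth_0)
  have "Determinant.det J \<noteq> 0" "J \<in> carrier_mat m m" using det by (simp_all add: J_def)
  then obtain Y where "null_const m Y" "\<And>i. i < m \<Longrightarrow> F i Y = 0"
    using multivariate_hensel[OF _ _ grad F0] by blast
  then show ?thesis using that[of Y] by (simp add: null_const_def F_def)
qed

section \<open>The system of leading coefficients\<close>

lemma pnorm_less_iff:
  assumes "0 < \<epsilon>" "\<epsilon> < 1"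
  shows "pnorm \<epsilon> x < pnorm \<epsilon> y \<longleftrightarrow> val y < val x"
proof -
  have "ln \<epsilon> < 0" using assms by simp
  then show ?thesis using assms
    by (cases x rule: val_cases; cases y rule: val_cases)
      (auto simp: pnorm_def powr_def mult_less_cancel_right of_rat_less)
qed

lemma pnorm_le_iff:
  assumes "0 < \<epsilon>" "\<epsilon> < 1"
  shows "pnorm \<epsilon> x \<le> pnorm \<epsilon> y \<longleftrightarrow> val y \<le> val x"
  using pnorm_less_iff[OF assms, of y x] by (simp add: not_less[symmetric])

lemma sum_eq_Pinf_iff:
  fixes v :: "'b \<Rightarrow> 'a :: comm_monoid_add extended"
  assumes "finite A" "\<And>a. v a \<noteq> Minf"
  shows "(\<Sum>a\<in>A. v a) \<noteq> Minf \<and> ((\<Sum>a\<in>A. v a) = Pinf \<longleftrightarrow> (\<exists>a\<in>A. v a = Pinf))"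
  using assms(1)
proof (induction A rule: finite_induct)
  case empty
  then show ?case by (simp add: zero_extended_def)
next
  case (insert a A)
  then show ?case using assms(2)[of a] by (cases "v a"; cases "\<Sum>a\<in>A. v a") auto
qed

lemma sum_Fin: "(\<Sum>a\<in>A. Fin (f a)) = Fin (\<Sum>a\<in>A. f a :: 'a :: comm_monoid_add)"
  by (induction A rule: infinite_finite_induct) (auto simp: zero_extended_def)

text \<open>Adding a common part preserves strictness only for finite values. If the sum over
  \<open>B\<close> is infinite there is nothing to compare; otherwise all terms are finite and the
  inequality is one between rationals.\<close>

lemma sum_exchange_less:
  fixes v :: "'b \<Rightarrow> rat extended"
  assumes fin: "finite A" "finite B" and v: "\<And>a. v a \<noteq> Minf"
    and h: "bij_betw h (A - B) (B - A)" and less: "\<And>a. a \<in> A - B \<Longrightarrow> v a < v (h a)" and ne: "A - B \<noteq> {}"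
    and Aw: "(\<Sum>a\<in>A. v a) = Fin w"
  shows "Fin w < (\<Sum>b\<in>B. v b)"
proof (cases "(\<Sum>b\<in>B. v b) = Pinf")
  case False
  have "\<forall>a\<in>A. v a \<noteq> Pinf" "\<forall>b\<in>B. v b \<noteq> Pinf"
    using Aw False sum_eq_Pinf_iff[where v = v, OF fin(1) v] sum_eq_Pinf_iff[where v = v, OF fin(2) v] by auto
  define u where "u a = (case v a of Fin q \<Rightarrow> q | _ \<Rightarrow> 0)" for a
  have vu: "v a = Fin (u a)" if "a \<in> A \<union> B" for a
    using that v[of a] \<open>\<forall>a\<in>A. v a \<noteq> Pinf\<close> \<open>\<forall>b\<in>B. v b \<noteq> Pinf\<close>
    by (cases "v a") (auto simp: u_def)
  have "(\<Sum>a\<in>A. u a) = (\<Sum>a\<in>A - B. u a) + (\<Sum>a\<in>A \<inter> B. u a)"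
    using fin(1) by (subst sum.union_disjoint[symmetric]) (auto intro!: sum.cong)
  also have "(\<Sum>a\<in>A - B. u a) < (\<Sum>a\<in>A - B. u (h a))"
  proof (rule sum_strict_mono)
    fix a assume a: "a \<in> A - B"
    then have "h a \<in> B" using bij_betwE[OF h] by auto
    then show "u a < u (h a)" using less[OF a] a by (simp add: vu)
  qed (use fin ne in auto)
  also have "(\<Sum>a\<in>A - B. u (h a)) = (\<Sum>b\<in>B - A. u b)"
    by (rule sum.reindex_bij_betw[OF h])
  also have "\<dots> + (\<Sum>a\<in>A \<inter> B. u a) = (\<Sum>b\<in>B. u b)"
    using fin(2) by (subst sum.union_disjoint[symmetric]) (auto intro!: sum.cong)
  finally have "(\<Sum>a\<in>A. u a) < (\<Sum>b\<in>B. u b)" by simp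
  moreover have "(\<Sum>a\<in>A. v a) = Fin (\<Sum>a\<in>A. u a)" "(\<Sum>b\<in>B. v b) = Fin (\<Sum>b\<in>B. u b)"
    using vu by (simp_all flip: sum_Fin)
  ultimately show ?thesis using Aw by simp
qed simp

lemma coeff_prod_linear_factors:
  fixes a :: "nat \<Rightarrow> puiseux"
  assumes "i \<le> m"
  shows "Polynomial.coeff (\<Prod>k<m. [:a k, 1:]) i = elem_sym m a i"
proof -
  have "(\<Prod>k<m. [:a k, 1:]) = (\<Prod>k<m. [:a k:] + Polynomial.monom 1 1)"
    by (simp add: monom_altdef)
  also have "\<dots> = (\<Sum>S\<in>Pow {..<m}. (\<Prod>k\<in>S. [:a k:]) * (\<Prod>k\<in>{..<m} - S. Polynomial.monom 1 1))"
    by (rule prod_add) simp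
  also have "\<dots> = (\<Sum>S\<in>Pow {..<m}. Polynomial.monom (\<Prod>k\<in>S. a k) (m - card S))"
  proof (intro sum.cong refl)
    fix S assume "S \<in> Pow {..<m}"
    then have S: "S \<subseteq> {..<m}" "finite S" using finite_subset by auto
    have "(\<Prod>k\<in>S. [:a k:]) = Polynomial.monom (\<Prod>k\<in>S. a k) 0"
      using prod_monom[of a "\<lambda>_. 0" S] by (simp add: monom_0)
    moreover have "(\<Prod>k\<in>{..<m} - S. Polynomial.monom (1::puiseux) 1) = Polynomial.monom 1 (m - card S)"
      using prod_monom[of "\<lambda>_. 1" "\<lambda>_. 1" "{..<m} - S"] S by (simp add: card_Diff_subset)
    ultimately show "(\<Prod>k\<in>S. [:a k:]) * (\<Prod>k\<in>{..<m} - S. Polynomial.monom 1 1) =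
        Polynomial.monom (\<Prod>k\<in>S. a k) (m - card S)"
      by (simp add: mult_monom)
  qed
  finally have "Polynomial.coeff (\<Prod>k<m. [:a k, 1:]) i =
      (\<Sum>S\<in>Pow {..<m}. if m - card S = i then \<Prod>k\<in>S. a k else 0)"
    by (simp add: coeff_sum)
  also have "\<dots> = (\<Sum>S | S \<in> Pow {..<m} \<and> m - card S = i. \<Prod>k\<in>S. a k)"
    by (rule sum.inter_filter[symmetric]) simp
  also have "{S. S \<in> Pow {..<m} \<and> m - card S = i} = {S. S \<subseteq> {..<m} \<and> card S = m - i}"
  proof -
    have "card S \<le> m" if "S \<subseteq> {..<m}" for S using card_mono[OF _ that] by simp
    then show ?thesis using assms by fastforce
  qed
  finally show ?thesis by (simp add: elem_sym_def)
qed

text \<open>The added zeros shift exponents by \<open>sum_list mu\<close>, and the points at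
  infinity contribute the factor 1.\<close>

lemma coeff_root_factors:
  fixes a :: "nat \<Rightarrow> puiseux"
  shows "Polynomial.coeff (\<Prod>\<^sub># (image_mset root_factor (a_plus d n lam mu (image_mset a (mset_set {..<m}))))) k =
    (if sum_list mu \<le> k \<and> k \<le> sum_list mu + m then elem_sym m a (k - sum_list mu) else 0)"
proof -
  have "\<Prod>\<^sub># (image_mset root_factor (a_plus d n lam mu (image_mset a (mset_set {..<m})))) =
      (\<Prod>k<m. [:a k, 1:]) * [:0, 1:] ^ sum_list mu"
    by (simp add: a_plus_def root_factor_def image_mset.compositionality comp_def prod_unfold_prod_mset)
  also have "[:0, 1:] ^ sum_list mu = Polynomial.monom (1::puiseux) (sum_list mu)"
    by (simp add: monom_altdef)
  finally have *: "\<Prod>\<^sub># (image_mset root_factor (a_plus d n lam mu (image_mset a (mset_set {..<m})))) =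
      Polynomial.monom 1 (sum_list mu) * (\<Prod>k<m. [:a k, 1:])"
    by (simp add: mult.commute)
  have "degree (\<Prod>k<m. [:a k, 1:]) \<le> m"
    using degree_prod_sum_le[of "{..<m}" "\<lambda>k. [:a k, 1:]"] by simp
  then have high: "Polynomial.coeff (\<Prod>k<m. [:a k, 1:]) i = 0" if "m < i" for i
    using that by (intro coeff_eq_0) simp
  show ?thesis
    unfolding * coeff_monom_mult using coeff_prod_linear_factors[of "k - sum_list mu" m a] high
    by auto
qed

text \<open>The product is an integer, and \<open>of_int\<close> carries it from one ring to
  another.\<close>

lemma vandermonde_of_int: "(vandermonde d \<phi> :: 'a :: idom) = of_int (vandermonde d \<phi>)"
  by (simp add: vandermonde_def of_int_prod)

lemma vandermonde_eq_q_coef: "vandermonde d (col_index d nu) = fin_monom (q_coef d nu) 0"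
  unfolding q_coef_eq_vandermonde
  by (subst (1 2) vandermonde_of_int) (rule of_int_puiseux)

lemma q_coef_nz:
  assumes "nu \<in> partitions d n"
  shows "q_coef d nu \<noteq> 0"
proof -
  have "col_index d nu i \<noteq> col_index d nu j" if "i < j" "j < d" for i j
    using col_index_strict_mono[OF assms that] by simp
  then show ?thesis
    unfolding q_coef_eq_vandermonde vandermonde_def by (fastforce simp: prod_zero_iff)
qed

lemma deriv_multiaffine:
  fixes w :: "nat \<Rightarrow> complex"
  assumes "\<And>x. x \<in> A \<Longrightarrow> finite (K x)"
  shows "deriv (\<lambda>t. \<Sum>x\<in>A. q x * (\<Prod>k\<in>K x. (w(j := t)) k)) (w j) =
    (\<Sum>x\<in>A. q x * (if j \<in> K x then \<Prod>k\<in>K x - {j}. w k else 0))"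
proof (rule DERIV_imp_deriv)
  show "((\<lambda>t. \<Sum>x\<in>A. q x * (\<Prod>k\<in>K x. (w(j := t)) k)) has_field_derivative
    (\<Sum>x\<in>A. q x * (if j \<in> K x then \<Prod>k\<in>K x - {j}. w k else 0))) (at (w j))"
  proof (rule DERIV_sum)
    fix x assume "x \<in> A"
    show "((\<lambda>t. q x * (\<Prod>k\<in>K x. (w(j := t)) k)) has_field_derivative
      q x * (if j \<in> K x then \<Prod>k\<in>K x - {j}. w k else 0)) (at (w j))"
    proof (cases "j \<in> K x")
      case True
      have "(\<Prod>k\<in>K x. (w(j := t)) k) = t * (\<Prod>k\<in>K x - {j}. w k)" for t
        using assms[OF \<open>x \<in> A\<close>] True by (subst prod.remove[of _ j]) (auto intro!: prod.cong)
      then show ?thesis using True by (auto intro!: derivative_eq_intros)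
    next
      case False
      then have "(\<Prod>k\<in>K x. (w(j := t)) k) = (\<Prod>k\<in>K x. w k)" for t
        by (intro prod.cong) auto
      then show ?thesis using False by simp
    qed
  qed
qed

section \<open>Entries of the tableau and minimal valuations\<close>

locale tableau_setup =
  fixes d n m :: nat and \<epsilon> :: real and lam mu :: "nat list" and a :: "nat \<Rightarrow> puiseux"
    and T :: "nat \<times> nat \<Rightarrow> puiseux" and pos :: "nat \<Rightarrow> nat \<times> nat"
  assumes d: "0 < d" "d < n"
    and eps: "0 < \<epsilon>" "\<epsilon> < 1"
    and lam: "lam \<in> partitions d n" and mu: "mu \<in> partitions d n" and mu_lam: "mu \<preceq> lam"
    and m: "m = card (skew lam mu)"
    and T: "T \<in> DIT \<epsilon> lam mu (image_mset a (mset_set {..<m}))"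
    and pos: "bij_betw pos {..<m} (skew lam mu)" and T_pos: "\<And>k. k < m \<Longrightarrow> T (pos k) = a k"
begin

abbreviation "cM \<equiv> col_index d mu"
abbreviation "cL \<equiv> col_index d lam"

lemmas len_lam = partitionsD(1)[OF lam] and len_mu = partitionsD(1)[OF mu]

definition rank_set :: "nat \<Rightarrow> nat list set" where
  "rank_set i = {nu \<in> partitions d n. sum_list nu = sum_list mu + i}"

definition between :: "nat list \<Rightarrow> bool" where
  "between nu \<longleftrightarrow> nu \<in> partitions d n \<and> mu \<preceq> nu \<and> nu \<preceq> lam"

lemma finite_rank_set: "finite (rank_set i)"
  using finite_partitions by (simp add: rank_set_def)

lemma betweenD:
  assumes "between nu"
  shows "nu \<in> partitions d n" "length nu = d" "mu \<preceq> nu" "nu \<preceq> lam"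
    and "skew lam nu \<subseteq> skew lam mu" "finite (skew lam nu)"
    and "card (skew lam nu) + sum_list nu = sum_list mu + m"
proof -
  show nu: "nu \<in> partitions d n" "mu \<preceq> nu" "nu \<preceq> lam" using assms by (auto simp: between_def)
  show len: "length nu = d" by (rule partitionsD(1)[OF nu(1)])
  show "skew lam nu \<subseteq> skew lam mu" using nu(2) by (auto simp: skew_def part_le_def)
  show "finite (skew lam nu)" using len_lam len by simp
  show "card (skew lam nu) + sum_list nu = sum_list mu + m"
    using card_skew[OF len_lam len nu(3)] card_skew[OF len_lam len_mu mu_lam] m by simp
qed

lemma between_lam: "between lam"
  using lam mu_lam by (auto simp: between_def part_le_def)

lemma sum_lam: "sum_list lam = sum_list mu + m"
  using betweenD(7)[OF between_lam] by (simp add: skew_def)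

text \<open>Indexes the entries in \<open>lam/nu\<close>, so that sums over boxes become sums over
  subsets of \<open>{..<m}\<close>, as in the elementary symmetric functions.\<close>

definition rest :: "nat list \<Rightarrow> nat set" where
  "rest nu = {k. k < m \<and> pos k \<notin> diagram nu}"

lemma finite_rest [simp]: "finite (rest nu)"
  by (simp add: rest_def)

lemma rest_subset: "rest nu \<subseteq> {..<m}"
  by (auto simp: rest_def)

lemma pos_in: "k < m \<Longrightarrow> pos k \<in> skew lam mu"
  using bij_betwE[OF pos] by auto

lemma bij_betw_rest: "bij_betw pos (rest nu) (skew lam nu)" if "between nu"
proof (rule bij_betw_subset[OF pos])
  show "rest nu \<subseteq> {..<m}" by (rule rest_subset)
  show "pos ` rest nu = skew lam nu"
  proof (intro equalityI subsetI)
    fix b assume b: "b \<in> skew lam nu"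
    then have "b \<in> pos ` {..<m}" using betweenD(5)[OF that] bij_betw_imp_surj_on[OF pos] by blast
    with b show "b \<in> pos ` rest nu" by (auto simp: rest_def skew_def)
  qed (use pos_in in \<open>auto simp: rest_def skew_def\<close>)
qed

lemma card_rest: "between nu \<Longrightarrow> card (rest nu) + sum_list nu = sum_list mu + m"
  using bij_betw_same_card[OF bij_betw_rest] betweenD(7) by simp

lemma val_tab_eq:
  assumes "between nu"
  shows "val_tab T lam nu = (\<Sum>k\<in>rest nu. val (a k))"
proof -
  have "val_tab T lam nu = (\<Sum>k\<in>rest nu. val (T (pos k)))"
    unfolding val_tab_def by (rule sum.reindex_bij_betw[OF bij_betw_rest[OF assms], symmetric])
  then show ?thesis using T_pos by (simp add: rest_def)
qed

lemma Omega_eq: "between nu \<Longrightarrow> Omega lam mu m pos \<omega> nu = (\<Prod>k\<in>rest nu. \<omega> k)"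
  by (simp add: Omega_def rest_def between_def)

lemma Omega_0: "nu \<in> partitions d n \<Longrightarrow> \<not> between nu \<Longrightarrow> Omega lam mu m pos \<omega> nu = 0"
  by (auto simp: Omega_def between_def)

text \<open>Since \<open>\<epsilon> < 1\<close>, a larger norm means a smaller valuation, which
  reverses the three conditions on the tableau.\<close>

lemma val_row: "(r, j) \<in> skew lam mu \<Longrightarrow> (r, j') \<in> skew lam mu \<Longrightarrow> j < j' \<Longrightarrow> val (T (r, j')) \<le> val (T (r, j))"
  and val_col: "(r, j) \<in> skew lam mu \<Longrightarrow> (r', j) \<in> skew lam mu \<Longrightarrow> r < r' \<Longrightarrow> val (T (r', j)) \<le> val (T (r, j))"
  and val_diag: "(r, j) \<in> skew lam mu \<Longrightarrow> (r + k, j + k) \<in> skew lam mu \<Longrightarrow> 0 < k \<Longrightarrow>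
    val (T (r + k, j + k)) < val (T (r, j))"
  using T unfolding DIT_def pnorm_less_iff[OF eps] pnorm_le_iff[OF eps] by blast+

lemma ell_set: "finite {S. S \<subseteq> {..<m} \<and> card S = m - i}" "{S. S \<subseteq> {..<m} \<and> card S = m - i} \<noteq> {}"
proof -
  show "finite {S. S \<subseteq> {..<m} \<and> card S = m - i}"
    by (rule finite_subset[of _ "Pow {..<m}"]) auto
  have "{..<m - i} \<in> {S. S \<subseteq> {..<m} \<and> card S = m - i}" by auto
  then show "{S. S \<subseteq> {..<m} \<and> card S = m - i} \<noteq> {}" by blast
qed

lemma ell_le: "S \<subseteq> {..<m} \<Longrightarrow> card S = m - i \<Longrightarrow> ell m a i \<le> (\<Sum>k\<in>S. val (a k))"
  unfolding ell_def using ell_set(1)[of i] by (intro Min_le) (auto simp: val_prod)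

text \<open>The product of the entries outside \<open>nu\<close> is one of the terms over which
  \<open>ell\<close> is the minimum.\<close>

lemma ell_le_val_tab:
  assumes "between nu" "sum_list nu = sum_list mu + i"
  shows "ell m a i \<le> val_tab T lam nu"
  using ell_le[OF rest_subset, of nu i] card_rest[OF assms(1)] assms val_tab_eq by simp

lemma ell_attained:
  assumes "i \<le> m"
  shows "\<exists>nu. between nu \<and> sum_list nu = sum_list mu + i \<and> val_tab T lam nu = ell m a i"
proof -
  obtain nu where nu: "nu \<in> partitions d n" "mu \<preceq> nu" "nu \<preceq> lam" "sum_list nu = sum_list mu + i"
    and good: "\<And>b b'. b \<in> skew nu mu \<Longrightarrow> b' \<in> skew lam nu \<Longrightarrow> val (T b') \<le> val (T b)"
    using ordered_subpartition[OF lam mu mu_lam, of "\<lambda>b. val (T b)" i] val_row val_col assms m by blast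
  have bet: "between nu" using nu by (simp add: between_def)
  have "val_tab T lam nu \<le> (\<Sum>k\<in>S. val (a k))" if S: "S \<subseteq> {..<m}" "card S = m - i" for S
    unfolding val_tab_eq[OF bet]
  proof (rule sum_exchange_le)
    show "finite S" using S(1) finite_subset by blast
    show "card (rest nu) = card S" using card_rest[OF bet] nu(4) S(2) by simp
    \<comment> \<open>Entry \<open>k\<close> lies outside \<open>nu\<close> and entry
      \<open>l\<close> inside, so the greedy choice of \<open>nu\<close> orders their
      valuations.\<close>
    fix k l assume k: "k \<in> rest nu - S" and l: "l \<in> S - rest nu"
    have "pos k \<in> skew lam nu" using k pos_in by (auto simp: rest_def skew_def)
    moreover have "pos l \<in> skew nu mu"
      using l S(1) pos_in[of l] by (auto simp: rest_def skew_def)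
    ultimately have "val (T (pos k)) \<le> val (T (pos l))" by (rule good[rotated])
    moreover have "k < m" "l < m" using k l S(1) by (auto simp: rest_def)
    ultimately show "val (a k) \<le> val (a l)" by (simp add: T_pos)
  qed simp
  then have "val_tab T lam nu \<le> ell m a i"
    unfolding ell_def using ell_set[of i] by (intro Min.boundedI) (auto simp: val_prod)
  with ell_le_val_tab[OF bet nu(4)] have "val_tab T lam nu = ell m a i" by simp
  then show ?thesis using bet nu(4) by blast
qed

text \<open>Minimality among partitions of one rank becomes an equation with a fixed exponent, the
  one at which the Wronskian coefficients are compared.\<close>

lemma M_set_eq:
  assumes "i \<le> m"
  shows "M_set d n lam mu T i = {nu. between nu \<and> sum_list nu = sum_list mu + i \<and> val_tab T lam nu = ell m a i}"
proof -
  obtain nu0 where nu0: "between nu0" "sum_list nu0 = sum_list mu + i" "val_tab T lam nu0 = ell m a i"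
    using ell_attained[OF assms] by blast
  show ?thesis
  proof (intro equalityI subsetI)
    fix nu assume nu: "nu \<in> M_set d n lam mu T i"
    then have bet: "between nu" "sum_list nu = sum_list mu + i" by (auto simp: M_set_def between_def)
    have "val_tab T lam nu \<le> val_tab T lam nu0"
      using nu nu0 by (auto simp: M_set_def between_def)
    then show "nu \<in> {nu. between nu \<and> sum_list nu = sum_list mu + i \<and> val_tab T lam nu = ell m a i}"
      using bet ell_le_val_tab[OF bet] nu0(3) by simp
  next
    fix nu assume "nu \<in> {nu. between nu \<and> sum_list nu = sum_list mu + i \<and> val_tab T lam nu = ell m a i}"
    then show "nu \<in> M_set d n lam mu T i"
      using ell_le_val_tab by (auto simp: M_set_def between_def)
  qed
qed

lemma lead_sum_eq:
  assumes "i \<le> m"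
  shows "lead_sum d n lam mu m T pos i \<omega> = (\<Sum>nu\<in>M_set d n lam mu T i. q_coef d nu * (\<Prod>k\<in>rest nu. \<omega> k))"
  unfolding lead_sum_def by (intro sum.cong refl) (auto simp: M_set_eq[OF assms] Omega_eq)

lemma jacobian_eq:
  "jacobian d n lam mu m T pos \<omega> = Matrix.mat m m (\<lambda>(i, j).
    \<Sum>nu\<in>M_set d n lam mu T i. q_coef d nu * (if j \<in> rest nu then \<Prod>k\<in>rest nu - {j}. \<omega> k else 0))"
  unfolding jacobian_def
  by (intro eq_matI) (auto simp: lead_sum_eq deriv_multiaffine simp del: fun_upd_apply)

section \<open>Necessity of the leading coefficient equations\<close>

lemma elem_sym_ord: "Fin w \<le> ell m a i \<Longrightarrow> ord_ge (elem_sym m a i) w"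
  unfolding elem_sym_def
  by (intro ord_ge_sum ord_ge_if_val_ge) (use ell_le in \<open>auto simp: val_prod intro: order.trans\<close>)

lemma elem_sym_0: "ell m a i = Pinf \<Longrightarrow> elem_sym m a i = 0"
  unfolding elem_sym_def
proof (intro sum.neutral ballI)
  fix S assume inf: "ell m a i = Pinf" and "S \<in> {S. S \<subseteq> {..<m} \<and> card S = m - i}"
  then have "val (\<Prod>k\<in>S. a k) = Pinf" using ell_le[of S i] by (simp add: val_prod)
  then show "(\<Prod>k\<in>S. a k) = 0" by (simp only: val_eq_Pinf)
qed

lemma elem_sym_m: "elem_sym m a m = 1"
proof -
  have "{S. S \<subseteq> {..<m} \<and> card S = m - m} = {{}}"
    by (auto dest: finite_subset)
  then show ?thesis by (simp add: elem_sym_def)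
qed

lemma ell_neq_Minf: "ell m a i \<noteq> Minf"
proof -
  have "ell m a i \<in> (\<lambda>S. val (\<Prod>k\<in>S. a k)) ` {S. S \<subseteq> {..<m} \<and> card S = m - i}"
    unfolding ell_def using ell_set by (intro Min_in) auto
  then obtain S where "ell m a i = val (\<Prod>k\<in>S. a k)" by blast
  then show ?thesis using val_neq_Minf[of "\<Prod>k\<in>S. a k"] by (simp only: not_False_eq_True)
qed

lemma between_rank_m: "between nu \<Longrightarrow> sum_list nu = sum_list mu + m \<Longrightarrow> nu = lam"
proof -
  assume nu: "between nu" "sum_list nu = sum_list mu + m"
  then have "skew lam nu = {}" using betweenD(6,7)[OF nu(1)] by simp
  then have "lam \<preceq> nu" by (auto simp: skew_def part_le_def)
  with betweenD(4)[OF nu(1)] show "nu = lam"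
    using betweenD(2)[OF nu(1)] len_lam by (intro nth_equalityI) (auto simp: part_le_iff antisym)
qed

text \<open>In rank \<open>m\<close> only \<open>lam\<close> contributes to the Wronskian, so
  dividing by that coefficient removes all unknown scalars. In the remaining identity the
  coefficient of \<open>u^w\<close> sees only partitions of minimal valuation.\<close>

lemma leading_coefficients:
  assumes x: "x \<in> wronski_fibre d n (a_plus d n lam mu (image_mset a (mset_set {..<m})))"
    and p: "plucker_coords d n x p"
    and LT: "\<And>nu. nu \<in> partitions d n \<Longrightarrow> LT (p nu) = pmonom (Omega lam mu m pos \<omega> nu) (val_tab T lam nu)"
    and i: "i < m" and fin: "ell m a i \<noteq> Pinf"
  shows "lead_sum d n lam mu m T pos i \<omega> = q_coef d lam * e_coef m a i"
proof -
  obtain w where w: "ell m a i = Fin w" using fin ell_neq_Minf by (cases "ell m a i") auto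
  define R where "R = \<Prod>\<^sub># (image_mset root_factor (a_plus d n lam mu (image_mset a (mset_set {..<m}))))"
  obtain f c where xG: "x \<in> Gr d n" and c: "c \<noteq> 0" and f: "spans d f x" "wronskian d f = Polynomial.smult c R"
    using x by (auto simp: wronski_fibre_def R_def)
  obtain g c' where c': "c' \<noteq> 0" and g: "spans d g x" and pg: "\<And>nu. nu \<in> partitions d n \<Longrightarrow> p nu = c' * minor d g nu"
    using p by (auto simp: plucker_coords_def)
  have "f j \<in> poly_vs.span (g ` {..<d})" if "j < d" for j
    using f(1) g that poly_vs.span_base[of "f j" "f ` {..<d}"] by (auto simp: spans_def)
  then obtain D where D: "wronskian d f = wronskian d g * [:D:]"
    by (rule wronskian_change_basis)
  have deg: "degree (g j) < n" if "j < d" for j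
  proof -
    have "g j \<in> x" using g that poly_vs.span_base[of "g j" "g ` {..<d}"] by (auto simp: spans_def)
    then have "degree (g j) \<le> n - 1" using xG by (auto simp: Gr_def)
    then show ?thesis using d by simp
  qed
  \<comment> \<open>Multiplying by \<open>c'\<close> turns the minors of \<open>g\<close> into the
    given Pluecker coordinates.\<close>
  have eq: "c * elem_sym m a i * c' = D * (\<Sum>nu\<in>rank_set i. fin_monom (q_coef d nu) 0 * p nu)" if "i \<le> m" for i
  proof -
    have "c * elem_sym m a i = Polynomial.coeff (wronskian d f) (sum_list mu + i)"
      using that by (simp add: f(2) R_def coeff_root_factors)
    also have "\<dots> = D * Polynomial.coeff (wronskian d g) (sum_list mu + i)"
      by (simp add: D mult.commute)
    also have "Polynomial.coeff (wronskian d g) (sum_list mu + i) =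
        (\<Sum>nu\<in>rank_set i. fin_monom (q_coef d nu) 0 * minor d g nu)"
      using coeff_wronskian[OF d(2), of g] deg by (simp add: rank_set_def vandermonde_eq_q_coef)
    finally have "c * elem_sym m a i * c' = D * ((\<Sum>nu\<in>rank_set i. fin_monom (q_coef d nu) 0 * minor d g nu) * c')"
      by (simp add: mult.assoc)
    also have "(\<Sum>nu\<in>rank_set i. fin_monom (q_coef d nu) 0 * minor d g nu) * c' =
        (\<Sum>nu\<in>rank_set i. fin_monom (q_coef d nu) 0 * p nu)"
      unfolding sum_distrib_right by (intro sum.cong refl) (simp add: pg rank_set_def mult_ac)
    finally show ?thesis .
  qed
  have p0: "p nu = 0" if "nu \<in> partitions d n" "\<not> between nu" for nu
    using LT[OF that(1)] Omega_0[OF that] by simp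
  have m_eq: "c * c' = D * (fin_monom (q_coef d lam) 0 * p lam)"
  proof -
    have "(\<Sum>nu\<in>rank_set m. fin_monom (q_coef d nu) 0 * p nu) = (\<Sum>nu\<in>{lam}. fin_monom (q_coef d nu) 0 * p nu)"
    proof (rule sum.mono_neutral_right[OF finite_rank_set])
      show "\<forall>nu\<in>rank_set m - {lam}. fin_monom (q_coef d nu) 0 * p nu = 0"
        using p0 between_rank_m by (auto simp: rank_set_def)
    qed (use lam sum_lam in \<open>simp add: rank_set_def\<close>)
    then show ?thesis using eq[of m] by (simp add: elem_sym_m)
  qed
  \<comment> \<open>The change of basis lemma does not exclude \<open>D = 0\<close>; the nonzero
    scalars \<open>c\<close> and \<open>c'\<close> do.\<close>
  then have "D \<noteq> 0" using c c' by auto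
  have main: "fin_monom (q_coef d lam) 0 * p lam * elem_sym m a i =
     (\<Sum>nu\<in>rank_set i. fin_monom (q_coef d nu) 0 * p nu)"
  proof -
    have "D * (fin_monom (q_coef d lam) 0 * p lam * elem_sym m a i) = c * c' * elem_sym m a i"
      unfolding m_eq by (simp only: mult.assoc)
    also have "\<dots> = D * (\<Sum>nu\<in>rank_set i. fin_monom (q_coef d nu) 0 * p nu)"
      using eq[of i] i by (simp only: mult_ac less_imp_le)
    finally show ?thesis using \<open>D \<noteq> 0\<close> by simp
  qed
  have "val_tab T lam lam = Fin 0"
    by (simp add: val_tab_def skew_def zero_extended_def)
  moreover have "Omega lam mu m pos \<omega> lam = 1"
  proof -
    have "rest lam = {}" using card_rest[OF between_lam] sum_lam by simp
    then show ?thesis by (simp add: Omega_eq[OF between_lam])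
  qed
  ultimately have "LT (p lam) = pmonom 1 (Fin 0)" using LT[OF lam] by simp
  note plam = LT_eq_monomD[OF this]
  \<comment> \<open>\<open>p lam\<close> has no terms of negative order and constant coefficient 1,
    so multiplication by it does not affect the lowest coefficient, at \<open>u^w\<close>.\<close>
  have "q_coef d lam * e_coef m a i = q_coef d lam * (pcoeff (p lam) 0 * pcoeff (elem_sym m a i) w)"
    by (simp add: plam e_coef_def w coeff_at_def)
  also have "\<dots> = q_coef d lam * pcoeff (p lam * elem_sym m a i) (0 + w)"
    using pcoeff_mult_low[OF plam(1) elem_sym_ord[of w i]] by (simp add: w)
  also have "\<dots> = pcoeff (fin_monom (q_coef d lam) 0 * p lam * elem_sym m a i) w"
    by (simp add: mult.assoc pcoeff_fin_monom_mult)
  also have "\<dots> = (\<Sum>nu\<in>rank_set i. q_coef d nu * pcoeff (p nu) w)"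
    by (simp add: main pcoeff_fin_monom_mult)
  also have "\<dots> = (\<Sum>nu\<in>M_set d n lam mu T i. q_coef d nu * pcoeff (p nu) w)"
  proof (rule sum.mono_neutral_right[OF finite_rank_set])
    show "M_set d n lam mu T i \<subseteq> rank_set i" by (auto simp: M_set_def rank_set_def)
    show "\<forall>nu\<in>rank_set i - M_set d n lam mu T i. q_coef d nu * pcoeff (p nu) w = 0"
    proof
      fix nu assume nu: "nu \<in> rank_set i - M_set d n lam mu T i"
      then have nuP: "nu \<in> partitions d n" "sum_list nu = sum_list mu + i" by (auto simp: rank_set_def)
      have "pcoeff (p nu) w = 0"
      proof (cases "between nu")
        case True
        then have "Fin w \<le> val_tab T lam nu" "val_tab T lam nu \<noteq> Fin w"
          using ell_le_val_tab[OF True nuP(2)] nu i w nuP by (auto simp: M_set_eq)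
        then have less: "Fin w < val_tab T lam nu" by simp
        show ?thesis
        proof (cases "val_tab T lam nu")
          case (Fin w')
          then have "ord_ge (p nu) w'" using LT_eq_monomD(1) LT[OF nuP(1)] by simp
          then show ?thesis using less Fin by (simp add: ord_ge_def)
        next
          case Pinf
          then show ?thesis using LT[OF nuP(1)] by simp
        next
          case Minf
          then show ?thesis using less by simp
        qed
      next
        case False
        then show ?thesis using p0 nuP by simp
      qed
      then show "q_coef d nu * pcoeff (p nu) w = 0" by simp
    qed
  qed
  also have "\<dots> = lead_sum d n lam mu m T pos i \<omega>"
    unfolding lead_sum_def
  proof (intro sum.cong refl)
    fix nu assume "nu \<in> M_set d n lam mu T i"
    then have "nu \<in> partitions d n" "val_tab T lam nu = Fin w" using i w by (auto simp: M_set_eq between_def)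
    then show "q_coef d nu * pcoeff (p nu) w = q_coef d nu * Omega lam mu m pos \<omega> nu"
      using LT_eq_monomD(2)[of "p nu"] LT[of nu] by simp
  qed
  finally show ?thesis by simp
qed

section \<open>Leibniz terms of the minors as sets of entries\<close>

definition slot :: "nat \<Rightarrow> nat \<times> nat" where
  "slot k = (let (r, j) = pos k in (d - Suc r, j + (d - Suc r)))"

lemma box_of_slot:
  assumes "k < m"
  shows "box_of d (slot k) = pos k" "slot k \<in> slots d cM cL"
proof -
  obtain r j where rj: "pos k = (r, j)" by (cases "pos k")
  then have "r < d" "mu ! r \<le> j" "j < lam ! r"
    using pos_in[OF assms] mem_skew[OF len_lam len_mu] by auto
  then show "box_of d (slot k) = pos k" "slot k \<in> slots d cM cL"
    by (auto simp: rj slot_def box_of_def mem_slots col_index_def Suc_diff_Suc)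
qed

lemma bij_betw_slot: "bij_betw slot {..<m} (slots d cM cL)"
proof -
  have "inj_on slot {..<m}"
  proof (rule inj_onI)
    fix k l assume "k \<in> {..<m}" "l \<in> {..<m}" "slot k = slot l"
    then have "pos k = pos l" using box_of_slot(1)[of k] box_of_slot(1)[of l] by simp
    then show "k = l" using \<open>k \<in> {..<m}\<close> \<open>l \<in> {..<m}\<close> bij_betw_imp_inj_on[OF pos] by (auto dest: inj_onD)
  qed
  moreover have "card (slots d cM cL) = card {..<m}"
    using bij_betw_same_card[OF bij_betw_box_of[OF len_lam len_mu]] m by simp
  moreover have "slot ` {..<m} \<subseteq> slots d cM cL" using box_of_slot(2) by auto
  ultimately show ?thesis
    by (simp add: bij_betw_def card_subset_eq card_image)
qed

definition entries :: "(nat \<times> nat) set \<Rightarrow> nat set" where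
  "entries Q = {k. k < m \<and> slot k \<in> Q}"

lemma entries_subset: "entries Q \<subseteq> {..<m}" and finite_entries [simp]: "finite (entries Q)"
  by (auto simp: entries_def)

lemma bij_betw_entries: "Q \<subseteq> slots d cM cL \<Longrightarrow> bij_betw slot (entries Q) Q"
proof (rule bij_betw_subset[OF bij_betw_slot entries_subset])
  assume Q: "Q \<subseteq> slots d cM cL"
  then have "Q \<subseteq> slot ` {..<m}" using bij_betw_imp_surj_on[OF bij_betw_slot] by simp
  then show "slot ` entries Q = Q" by (auto simp: entries_def)
qed

lemma rest_eq_entries:
  assumes "between nu"
  shows "rest nu = entries (slots d (col_index d nu) cL)"
proof -
  have "pos k \<notin> diagram nu \<longleftrightarrow> slot k \<in> slots d (col_index d nu) cL" if k: "k < m" for k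
  proof -
    obtain i c where ic: "slot k = (i, c)" by (cases "slot k")
    with box_of_slot[OF k] have b: "(i, c) \<in> slots d cM cL" "pos k = (d - Suc i, c - i)"
      by (simp_all add: box_of_def)
    then have "i < d" "i \<le> c" "c < cL i" by (auto simp: mem_slots col_index_def)
    then show ?thesis
      using betweenD(2)[OF assms] by (auto simp: ic b(2) diagram_def mem_slots col_index_def)
  qed
  then show ?thesis by (auto simp: rest_def entries_def)
qed

definition slot_val :: "nat \<times> nat \<Rightarrow> rat extended" where
  "slot_val b = val (T (box_of d b))"

lemma slot_val_slot: "k < m \<Longrightarrow> slot_val (slot k) = val (a k)"
  by (simp add: slot_val_def box_of_slot T_pos)

text \<open>On one diagonal a larger reversed row index lies further north-west, where the norm is
  strictly smaller.\<close>

lemma slot_val_mono: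
  assumes "(i, c) \<in> slots d cM cL" "(i', c) \<in> slots d cM cL" "i < i'"
  shows "slot_val (i, c) < slot_val (i', c)"
proof -
  have "i' < d" "i' \<le> c" using assms(2) by (auto simp: mem_slots col_index_def)
  then have e: "d - Suc i = d - Suc i' + (i' - i)" "c - i = c - i' + (i' - i)" using assms(3) by auto
  have mem: "box_of d b \<in> skew lam mu" if "b \<in> slots d cM cL" for b
    using bij_betwE[OF bij_betw_box_of[OF len_lam len_mu]] that by blast
  have "val (T (d - Suc i' + (i' - i), c - i' + (i' - i))) < val (T (d - Suc i', c - i'))"
  proof (rule val_diag)
    show "(d - Suc i', c - i') \<in> skew lam mu" using mem[OF assms(2)] by (simp add: box_of_def)
    show "(d - Suc i' + (i' - i), c - i' + (i' - i)) \<in> skew lam mu"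
      using mem[OF assms(1)] unfolding e[symmetric] by (simp add: box_of_def)
  qed (use assms(3) in simp)
  then show ?thesis unfolding e[symmetric] by (simp add: slot_val_def box_of_def)
qed

definition terms :: "nat list \<Rightarrow> (nat \<Rightarrow> nat) set" where
  "terms nu = {p. p permutes {0..<d} \<and> admissible d cM (col_index d nu) cL p}"

definition term_entries :: "nat list \<Rightarrow> (nat \<Rightarrow> nat) \<Rightarrow> nat set" where
  "term_entries nu p = entries (slots d (col_index d nu \<circ> p) cL)"

lemma finite_terms: "finite (terms nu)"
  using finite_permutations[of "{0..<d}"] by (simp add: terms_def)

lemma term_entries_subset: "term_entries nu p \<subseteq> {..<m}" and finite_term_entries [simp]: "finite (term_entries nu p)"
  by (simp_all add: term_entries_def entries_subset)

lemma term_between: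
  assumes "nu \<in> partitions d n" "p \<in> terms nu"
  shows "between nu"
proof -
  have "cM i \<le> col_index d nu i \<and> col_index d nu i \<le> cL i" if "i < d" for i
    by (rule admissible_between[where p = p])
      (use col_index_strict_mono[OF mu] col_index_strict_mono[OF assms(1)] col_index_strict_mono[OF lam]
        assms(2) that in \<open>auto simp: terms_def\<close>)
  then show ?thesis
    using assms(1) len_lam len_mu partitionsD(1)[OF assms(1)]
    by (simp add: between_def part_le_iff_col_index)
qed

lemma id_in_terms: "between nu \<Longrightarrow> id \<in> terms nu"
  using betweenD(2-4)[of nu] len_lam len_mu by (simp add: terms_def admissible_def part_le_iff_col_index permutes_id)

lemma term_entries_id: "between nu \<Longrightarrow> term_entries nu id = rest nu"
  by (simp add: term_entries_def rest_eq_entries)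

lemma term_slots_subset: "p \<in> terms nu \<Longrightarrow> slots d (col_index d nu \<circ> p) cL \<subseteq> slots d cM cL"
  by (auto simp: terms_def admissible_def mem_slots intro: le_trans)

lemma sum_term_entries:
  assumes "p \<in> terms nu"
  shows "(\<Sum>k\<in>term_entries nu p. val (a k)) = (\<Sum>b\<in>slots d (col_index d nu \<circ> p) cL. slot_val b)"
  unfolding sum.reindex_bij_betw[OF bij_betw_entries[OF term_slots_subset[OF assms]], symmetric] term_entries_def
  by (intro sum.cong) (auto simp: slot_val_slot entries_def)

text \<open>Each box moved by the exchange goes north-west along its diagonal, which raises the
  valuation. Strictness needs at least one move, hence \<open>p \<noteq> id\<close>, and a finite
  starting value, since an infinite one cannot grow.\<close>

lemma term_val:
  assumes nu: "nu \<in> partitions d n" and p: "p \<in> terms nu"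
  shows "val_tab T lam nu \<le> (\<Sum>k\<in>term_entries nu p. val (a k))"
    and "p \<noteq> id \<Longrightarrow> val_tab T lam nu = Fin w \<Longrightarrow> Fin w < (\<Sum>k\<in>term_entries nu p. val (a k))"
proof -
  define A where "A = slots d (col_index d nu) cL"
  define B where "B = slots d (col_index d nu \<circ> p) cL"
  have bet: "between nu" by (rule term_between[OF nu p])
  have pp: "p permutes {0..<d}" using p by (simp add: terms_def)
  have le: "col_index d nu i \<le> cL i" "col_index d nu (p i) \<le> cL i" if "i < d" for i
    using that p betweenD(2,4)[OF bet] len_lam by (auto simp: terms_def admissible_def part_le_iff_col_index)
  have vA: "val_tab T lam nu = (\<Sum>b\<in>A. slot_val b)"
    using sum_term_entries[OF id_in_terms[OF bet]] val_tab_eq[OF bet] term_entries_id[OF bet] by (simp add: A_def)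
  have vB: "(\<Sum>k\<in>term_entries nu p. val (a k)) = (\<Sum>b\<in>B. slot_val b)"
    using sum_term_entries[OF p] by (simp add: B_def)
  have "\<exists>h. bij_betw h (A - B) (B - A) \<and> (\<forall>i c. (i, c) \<in> A - B \<longrightarrow> (\<exists>i'. h (i, c) = (i', c) \<and> i < i'))"
  proof (rule slots_exchange[where d = d and N = "col_index d nu" and L = cL and p = p,
        OF col_index_strict_mono[OF nu] pp le, folded A_def B_def])
    fix h assume "bij_betw h (A - B) (B - A)"
      and "\<And>i c. (i, c) \<in> A - B \<Longrightarrow> \<exists>i'. h (i, c) = (i', c) \<and> i < i'"
    then show ?thesis by (intro exI[of _ h] conjI allI impI)
  qed
  then obtain h where h: "bij_betw h (A - B) (B - A)"
    and hi: "\<And>i c. (i, c) \<in> A - B \<Longrightarrow> \<exists>i'. h (i, c) = (i', c) \<and> i < i'" by blast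
  have less: "slot_val b < slot_val (h b)" if b: "b \<in> A - B" for b
  proof -
    obtain i c where ic: "b = (i, c)" by (cases b)
    obtain i' where i': "h b = (i', c)" "i < i'" using hi[of i c] b ic by auto
    have "h b \<in> slots d cM cL"
      using bij_betwE[OF h] b term_slots_subset[OF p] by (auto simp: B_def)
    moreover have "b \<in> slots d cM cL"
      using b term_slots_subset[OF id_in_terms[OF bet]] by (auto simp: A_def)
    ultimately show ?thesis using slot_val_mono i' ic by simp
  qed
  have fin: "finite A" "finite B" by (simp_all add: A_def B_def)
  show "val_tab T lam nu \<le> (\<Sum>k\<in>term_entries nu p. val (a k))"
  proof -
    have "(\<Sum>b\<in>A. slot_val b) = (\<Sum>b\<in>A - B. slot_val b) + (\<Sum>b\<in>A \<inter> B. slot_val b)"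
      using fin by (subst sum.union_disjoint[symmetric]) (auto intro!: sum.cong)
    also have "\<dots> \<le> (\<Sum>b\<in>A - B. slot_val (h b)) + (\<Sum>b\<in>A \<inter> B. slot_val b)"
      using less by (intro add_right_mono sum_mono) (auto intro: less_imp_le)
    also have "(\<Sum>b\<in>A - B. slot_val (h b)) = (\<Sum>b\<in>B - A. slot_val b)"
      by (rule sum.reindex_bij_betw[OF h])
    also have "\<dots> + (\<Sum>b\<in>A \<inter> B. slot_val b) = (\<Sum>b\<in>B. slot_val b)"
      using fin by (subst sum.union_disjoint[symmetric]) (auto intro!: sum.cong)
    finally show ?thesis by (simp only: vA vB)
  qed
  show "Fin w < (\<Sum>k\<in>term_entries nu p. val (a k))" if "p \<noteq> id" "val_tab T lam nu = Fin w"
    unfolding vB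
  proof (rule sum_exchange_less[where v = slot_val and h = h, OF fin _ h less])
    show "A - B \<noteq> {}"
      unfolding A_def B_def
      by (rule slots_exchange_nonempty[where d = d and N = "col_index d nu" and L = cL and p = p,
        OF col_index_strict_mono[OF nu] pp that(1) le])
    show "(\<Sum>b\<in>A. slot_val b) = Fin w" using that(2) vA by simp
  qed (auto simp: slot_val_def)
qed

section \<open>Scaled variables and their reductions\<close>

definition scale :: "nat \<Rightarrow> puiseux" where
  "scale k = (case val (a k) of Fin v \<Rightarrow> fin_monom 1 v | _ \<Rightarrow> 0)"

lemma val_scale: "val (scale k) = val (a k)"
  by (cases "a k" rule: val_cases) (auto simp: scale_def intro!: val_eqI simp: pcoeff_fin_monom ord_ge_def)

lemma scale_prod: "(\<Sum>k\<in>S. val (a k)) = Fin w \<Longrightarrow> finite S \<Longrightarrow> (\<Prod>k\<in>S. scale k) = fin_monom 1 w"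
proof -
  assume S: "(\<Sum>k\<in>S. val (a k)) = Fin w" "finite S"
  have "\<forall>k\<in>S. val (a k) \<noteq> Pinf"
    using sum_eq_Pinf_iff[where v = "\<lambda>k. val (a k)", OF S(2) val_neq_Minf] S(1) by auto
  have "\<exists>v. val (a k) = Fin v" if "k \<in> S" for k
    using that \<open>\<forall>k\<in>S. val (a k) \<noteq> Pinf\<close> by (cases "a k" rule: val_cases) auto
  then obtain v where v: "\<And>k. k \<in> S \<Longrightarrow> val (a k) = Fin (v k)" by metis
  have "Fin (\<Sum>k\<in>S. v k) = Fin w"
    using S(1) v by (simp flip: sum_Fin)
  moreover have "(\<Prod>k\<in>S. scale k) = (\<Prod>k\<in>S. fin_monom 1 (v k))"
    using v by (intro prod.cong) (auto simp: scale_def)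
  ultimately show ?thesis by (simp add: fin_monom_prod)
qed

definition term_scale :: "nat list \<Rightarrow> (nat \<Rightarrow> nat) \<Rightarrow> puiseux" where
  "term_scale nu p = (\<Prod>k\<in>term_entries nu p. scale k)"

lemma val_term_scale: "val (term_scale nu p) = (\<Sum>k\<in>term_entries nu p. val (a k))"
  by (simp add: term_scale_def val_prod val_scale)

text \<open>After division by \<open>u^w\<close> a term reduces to 1 exactly for the identity
  permutation of a partition of valuation \<open>w\<close>, and to 0 otherwise. This is why only
  \<open>M_set\<close> survives modulo the maximal ideal.\<close>

lemma term_scale_ord:
  assumes "nu \<in> partitions d n" "p \<in> terms nu" "Fin w \<le> val_tab T lam nu"
  shows "ord_ge (term_scale nu p) w"
    and "pcoeff (term_scale nu p) w = (if p = id \<and> val_tab T lam nu = Fin w then 1 else 0)"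
proof -
  have le: "Fin w \<le> val (term_scale nu p)"
    using assms(3) term_val(1)[OF assms(1,2)] by (simp add: val_term_scale)
  then show "ord_ge (term_scale nu p) w" by (rule ord_ge_if_val_ge)
  show "pcoeff (term_scale nu p) w = (if p = id \<and> val_tab T lam nu = Fin w then 1 else 0)"
  proof (cases "p = id \<and> val_tab T lam nu = Fin w")
    case True
    have bet: "between nu" by (rule term_between[OF assms(1,2)])
    have "term_scale nu p = fin_monom 1 w"
      unfolding term_scale_def using True term_entries_id[OF bet] val_tab_eq[OF bet]
      by (intro scale_prod) auto
    then show ?thesis using True by (simp add: pcoeff_fin_monom)
  next
    case False
    have "Fin w < val (term_scale nu p)"
    proof (cases "val_tab T lam nu = Fin w")
      case True
      then show ?thesis using False term_val(2)[OF assms(1,2)] by (simp add: val_term_scale)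
    next
      case False
      then have "Fin w < val_tab T lam nu" using assms(3) by simp
      then show ?thesis using term_val(1)[OF assms(1,2)] by (simp add: val_term_scale)
    qed
    then have "pcoeff (term_scale nu p) w = 0"
      by (cases "term_scale nu p" rule: val_cases) (auto dest!: val_eq_FinD(2) simp: ord_ge_def)
    then show ?thesis using False by simp
  qed
qed

lemma term_scale_0:
  assumes "nu \<in> partitions d n" "p \<in> terms nu" "val_tab T lam nu = Pinf"
  shows "term_scale nu p = 0"
proof -
  have "val (term_scale nu p) = Pinf"
    using term_val(1)[OF assms(1,2)] assms(3) by (simp add: val_term_scale)
  then show ?thesis by simp
qed

section \<open>The parametrized point and its Wronskian\<close>

definition slot_fun :: "(nat \<Rightarrow> puiseux) \<Rightarrow> nat \<times> nat \<Rightarrow> puiseux" where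
  "slot_fun y b = y (the_inv_into {..<m} slot b)"

lemma slot_fun_slot: "k < m \<Longrightarrow> slot_fun y (slot k) = y k"
  using the_inv_into_f_f[OF bij_betw_imp_inj_on[OF bij_betw_slot], of k] by (simp add: slot_fun_def)

definition row_polys :: "(nat \<Rightarrow> puiseux) \<Rightarrow> nat \<Rightarrow> puiseux poly" where
  "row_polys y = row_poly cM cL (slot_fun y)"

lemma minor_rows: "minor d (row_polys y) nu = (\<Sum>p\<in>terms nu. of_int (sign p) * (\<Prod>k\<in>term_entries nu p. y k))"
proof -
  have "(\<Prod>b\<in>slots d (col_index d nu \<circ> p) cL. slot_fun y b) = (\<Prod>k\<in>term_entries nu p. y k)"
    if "p \<in> terms nu" for p
    unfolding prod.reindex_bij_betw[OF bij_betw_entries[OF term_slots_subset[OF that]], symmetric] term_entries_def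
    by (intro prod.cong) (auto simp: slot_fun_slot entries_def)
  then show ?thesis
    unfolding minor_eq_det row_polys_def det_row_poly terms_def by (intro sum.cong) auto
qed

lemma minor_rows_not_between: "nu \<in> partitions d n \<Longrightarrow> \<not> between nu \<Longrightarrow> minor d (row_polys y) nu = 0"
  using term_between by (force simp: minor_rows intro: sum.neutral)

text \<open>A permutation other than the identity would have to move a box of
  \<open>lam/lam\<close>, which has none.\<close>

lemma minor_rows_lam: "minor d (row_polys y) lam = 1"
proof -
  have "p = id" if p: "p \<in> terms lam" for p
  proof (rule ccontr)
    assume "p \<noteq> id"
    have "slots d cL cL - slots d (cL \<circ> p) cL \<noteq> {}"
      by (rule slots_exchange_nonempty[where d = d and N = cL and L = cL and p = p, OF col_index_strict_mono[OF lam] _ \<open>p \<noteq> id\<close>])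
        (use p in \<open>auto simp: terms_def admissible_def\<close>)
    then show False by (auto simp: mem_slots)
  qed
  then have "terms lam = {id}" using id_in_terms[OF between_lam] by auto
  moreover have "rest lam = {}" using card_rest[OF between_lam] sum_lam by simp
  ultimately show ?thesis by (simp add: minor_rows term_entries_id[OF between_lam])
qed

lemma degree_rows: "i < d \<Longrightarrow> degree (row_polys y i) < n"
  using degree_row_poly[of cM cL "slot_fun y" i] col_index_less[OF lam _ d(2), of i] by (simp add: row_polys_def)

lemma span_rows_Gr: "poly_vs.span (row_polys y ` {..<d}) \<in> Gr d n"
proof -
  have "cM i \<le> cL i" if "i < d" for i
    using that mu_lam len_lam len_mu by (simp add: part_le_iff_col_index)
  then have lead: "Polynomial.coeff (row_polys y i) (cL i) = 1" if "i < d" for i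
    using that by (simp add: row_polys_def coeff_row_poly)
  have "poly_vs.dim (poly_vs.span (row_polys y ` {..<d})) = d"
    by (rule dim_span_echelon[where L = cL])
      (use col_index_strict_mono[OF lam] lead in \<open>auto simp: row_polys_def degree_row_poly\<close>)
  moreover have "poly_vs.span (row_polys y ` {..<d}) \<subseteq> {p. degree p \<le> n - 1}"
  proof (rule poly_vs.span_minimal)
    show "row_polys y ` {..<d} \<subseteq> {p. degree p \<le> n - 1}"
      using degree_rows[of _ y] by fastforce
    show "poly_vs.subspace {p :: puiseux poly. degree p \<le> n - 1}"
      unfolding poly_vs.subspace_def
      by (auto intro: degree_add_le order.trans[OF degree_smult_le])
  qed
  ultimately show ?thesis by (simp add: Gr_def poly_vs.subspace_span)
qed

text \<open>The assumed equations settle the ranks below \<open>m\<close>. In rank \<open>m\<close>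
  only \<open>lam\<close> remains, with minor 1, and in all other degrees both sides vanish.\<close>

lemma wronskian_rows:
  assumes "\<And>i. i < m \<Longrightarrow> (\<Sum>nu\<in>rank_set i. fin_monom (q_coef d nu) 0 * minor d (row_polys y) nu) =
    fin_monom (q_coef d lam) 0 * elem_sym m a i"
  shows "wronskian d (row_polys y) = Polynomial.smult (fin_monom (q_coef d lam) 0)
    (\<Prod>\<^sub># (image_mset root_factor (a_plus d n lam mu (image_mset a (mset_set {..<m})))))"
proof (rule poly_eqI)
  fix k
  have c: "Polynomial.coeff (wronskian d (row_polys y)) k =
      (\<Sum>nu | nu \<in> partitions d n \<and> sum_list nu = k. fin_monom (q_coef d nu) 0 * minor d (row_polys y) nu)"
    using coeff_wronskian[OF d(2), of "row_polys y"] degree_rows by (simp add: vandermonde_eq_q_coef)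
  show "Polynomial.coeff (wronskian d (row_polys y)) k = Polynomial.coeff (Polynomial.smult (fin_monom (q_coef d lam) 0)
    (\<Prod>\<^sub># (image_mset root_factor (a_plus d n lam mu (image_mset a (mset_set {..<m})))))) k"
  proof (cases "sum_list mu \<le> k \<and> k \<le> sum_list mu + m")
    case True
    define i where "i = k - sum_list mu"
    have k: "k = sum_list mu + i" "i \<le> m" using True by (auto simp: i_def)
    have "Polynomial.coeff (wronskian d (row_polys y)) k = (\<Sum>nu\<in>rank_set i. fin_monom (q_coef d nu) 0 * minor d (row_polys y) nu)"
      using c by (simp only: rank_set_def k(1)[symmetric])
    also have "\<dots> = fin_monom (q_coef d lam) 0 * elem_sym m a i"
    proof (cases "i = m")
      case True
      have "(\<Sum>nu\<in>rank_set m. fin_monom (q_coef d nu) 0 * minor d (row_polys y) nu) =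
          (\<Sum>nu\<in>{lam}. fin_monom (q_coef d nu) 0 * minor d (row_polys y) nu)"
      proof (rule sum.mono_neutral_right[OF finite_rank_set])
        show "\<forall>nu\<in>rank_set m - {lam}. fin_monom (q_coef d nu) 0 * minor d (row_polys y) nu = 0"
          using minor_rows_not_between between_rank_m by (auto simp: rank_set_def)
      qed (use lam sum_lam in \<open>simp add: rank_set_def\<close>)
      then show ?thesis using True by (simp add: minor_rows_lam elem_sym_m)
    next
      case False
      then show ?thesis using k assms by simp
    qed
    finally show ?thesis using True by (simp add: coeff_root_factors i_def)
  next
    case False
    have "(\<Sum>nu | nu \<in> partitions d n \<and> sum_list nu = k. fin_monom (q_coef d nu) 0 * minor d (row_polys y) nu) = 0"
    proof (rule sum.neutral, intro ballI)
      fix nu assume nu: "nu \<in> {nu \<in> partitions d n. sum_list nu = k}"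
      then have "\<not> between nu"
        using False betweenD(7)[of nu] card_skew[OF _ len_mu, of nu] betweenD(2,3)[of nu] by force
      then show "fin_monom (q_coef d nu) 0 * minor d (row_polys y) nu = 0"
        using nu minor_rows_not_between by simp
    qed
    then show ?thesis
      using False by (simp only: c coeff_smult coeff_root_factors if_False mult_zero_right)
  qed
qed

text \<open>
  A vanishing \<open>\<Omega>\<^sub>\<nu>\<close> with finite exponent would require the minor to vanish identically. The equation
  for \<open>i\<close> the number of zeros among the \<open>a k\<close> excludes this: its right-hand side is the leading
  coefficient of the product of all nonzero \<open>a k\<close>.
\<close>

lemma omega_nonzero:
  fixes \<omega> :: "nat \<Rightarrow> complex"
  assumes eqs: "\<And>i. i < m \<Longrightarrow> ell m a i \<noteq> Pinf \<Longrightarrow> lead_sum d n lam mu m T pos i \<omega> = q_coef d lam * e_coef m a i"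
    and k: "k < m" "a k \<noteq> 0"
  shows "\<omega> k \<noteq> 0"
proof -
  define Z where "Z = {k. k < m \<and> a k = 0}"
  define NZ where "NZ = {k. k < m \<and> a k \<noteq> 0}"
  define z where "z = card Z"
  have fin: "finite Z" "finite NZ" by (auto simp: Z_def NZ_def)
  have "card (Z \<union> NZ) = card Z + card NZ"
    by (rule card_Un_disjoint) (auto simp: Z_def NZ_def)
  moreover have "Z \<union> NZ = {..<m}" by (auto simp: Z_def NZ_def)
  ultimately have card: "card NZ = m - z" "z + card NZ = m" by (auto simp: z_def)
  have "card NZ > 0" using k fin(2) by (auto simp: card_gt_0_iff NZ_def)
  then have "z < m" using card by simp
  \<comment> \<open>There are exactly \<open>m - z\<close> nonzero entries, so a single term of this
    elementary symmetric function survives.\<close>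
  have NZI: "S = NZ" if "S \<subseteq> {..<m}" "card S = m - z" "\<forall>k\<in>S. a k \<noteq> 0" for S
    using that card fin by (intro card_subset_eq) (auto simp: NZ_def)
  have E: "elem_sym m a z = (\<Prod>k\<in>NZ. a k)"
  proof -
    have "elem_sym m a z = (\<Sum>S\<in>{NZ}. \<Prod>k\<in>S. a k)"
      unfolding elem_sym_def
    proof (rule sum.mono_neutral_right[OF ell_set(1)])
      show "{NZ} \<subseteq> {S. S \<subseteq> {..<m} \<and> card S = m - z}" using card by (auto simp: NZ_def)
      show "\<forall>S\<in>{S. S \<subseteq> {..<m} \<and> card S = m - z} - {NZ}. (\<Prod>k\<in>S. a k) = 0"
      proof
        fix S assume "S \<in> {S. S \<subseteq> {..<m} \<and> card S = m - z} - {NZ}"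
        then have "finite S" "\<exists>k\<in>S. a k = 0" using NZI finite_subset by blast+
        then show "(\<Prod>k\<in>S. a k) = 0" by (simp add: prod_zero_iff)
      qed
    qed
    then show ?thesis by simp
  qed
  have "(\<Prod>k\<in>NZ. a k) \<noteq> 0" using fin by (simp add: prod_zero_iff NZ_def)
  then obtain w where w: "val (elem_sym m a z) = Fin w"
    using E by (cases "elem_sym m a z" rule: val_cases) auto
  have "ell m a z = Fin w"
  proof -
    have "ell m a z \<in> (\<lambda>S. val (\<Prod>k\<in>S. a k)) ` {S. S \<subseteq> {..<m} \<and> card S = m - z}"
      unfolding ell_def using ell_set by (intro Min_in) auto
    then obtain S where S: "S \<subseteq> {..<m}" "card S = m - z" "ell m a z = val (\<Prod>k\<in>S. a k)" by auto
    have "ell m a z \<le> Fin w"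
      using ell_le[of NZ z] card w by (auto simp: E val_prod NZ_def)
    then have "(\<Prod>k\<in>S. a k) \<noteq> 0" using S(3) by auto
    moreover have "finite S" using S(1) finite_subset by blast
    ultimately have "S = NZ" using NZI S by (simp add: prod_zero_iff)
    then show ?thesis using S(3) E w by simp
  qed
  then have "e_coef m a z \<noteq> 0" using val_eq_FinD(3)[OF w] by (simp add: e_coef_def coeff_at_def)
  then have "lead_sum d n lam mu m T pos z \<omega> \<noteq> 0"
    using eqs[OF \<open>z < m\<close>] \<open>ell m a z = Fin w\<close> q_coef_nz[OF lam] by simp
  then obtain nu where nu: "nu \<in> M_set d n lam mu T z" "(\<Prod>k\<in>rest nu. \<omega> k) \<noteq> 0"
    using \<open>z < m\<close> by (force simp: lead_sum_eq intro: sum.neutral)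
  have bet: "between nu" "sum_list nu = sum_list mu + z" "val_tab T lam nu = Fin w"
    using nu(1) \<open>z < m\<close> \<open>ell m a z = Fin w\<close> by (auto simp: M_set_eq)
  \<comment> \<open>Finite valuation keeps zero entries out of \<open>rest nu\<close>, so by
    cardinality it is all of \<open>NZ\<close>, and the nonzero monomial contains every
    \<open>\<omega> k\<close> in question.\<close>
  have "\<forall>k\<in>rest nu. a k \<noteq> 0"
    using sum_eq_Pinf_iff[where v = "\<lambda>k. val (a k)", OF finite_rest val_neq_Minf, of nu] bet val_tab_eq[OF bet(1)] by auto
  then have "rest nu = NZ"
    using card_rest[OF bet(1)] bet(2) by (intro NZI rest_subset) auto
  then show ?thesis using nu(2) k fin by (auto simp: prod_zero_iff NZ_def)
qed

section \<open>Lifting the solution of the reduced system\<close>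

lemma ramified_scale:
  assumes "ramified r (a k)"
  shows "ramified r (scale k)"
  using assms val_eq_FinD(3)[of "a k"]
  by (cases "a k" rule: val_cases) (auto simp: scale_def ramified_def pcoeff_fin_monom)

lemma ramified_term_scale: "(\<And>k. k < m \<Longrightarrow> ramified r (a k)) \<Longrightarrow> ramified r (term_scale nu p)"
  unfolding term_scale_def using term_entries_subset[of nu p]
  by (intro ramified_prod ramified_scale) auto

text \<open>\<open>u^w\<close> occurs in a product of scaled variables, so \<open>w\<close> has the
  common denominator and division of an equation by \<open>u^w\<close> needs no further root of
  u.\<close>

lemma ell_ramified:
  assumes "\<And>k. k < m \<Longrightarrow> ramified r (a k)" "i \<le> m" "ell m a i = Fin w"
  shows "w * of_nat (Suc r) \<in> \<int>"
proof -
  obtain nu where nu: "between nu" "sum_list nu = sum_list mu + i" "val_tab T lam nu = ell m a i"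
    using ell_attained[OF assms(2)] by blast
  have "pcoeff (term_scale nu id) w = 1"
    using term_scale_ord(2)[OF betweenD(1)[OF nu(1)] id_in_terms[OF nu(1)], of w] nu(3) assms(3) by simp
  then show ?thesis using ramified_term_scale[OF assms(1), of nu id] by (simp add: ramified_def del: of_nat_Suc)
qed

lemma ord_ge_fin_monom_mult: "ord_ge g w \<Longrightarrow> ord_ge (fin_monom c (- w) * g) 0"
  using ord_ge_mult[of "fin_monom c (- w)" "- w" g w] by (simp add: ord_ge_def pcoeff_fin_monom)

text \<open>The function \<open>g\<close> of the entry set is arbitrary so that one computation
  serves both the values of the reduced equations and their partial derivatives.\<close>

lemma sum_terms_id:
  fixes g :: "nat set \<Rightarrow> complex"
  assumes "i \<le> m"
  shows "(\<Sum>x\<in>Sigma (rank_set i) terms. (if snd x = id \<and> fst x \<in> M_set d n lam mu T i then q_coef d (fst x) else 0)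
      * g (term_entries (fst x) (snd x))) = (\<Sum>nu\<in>M_set d n lam mu T i. q_coef d nu * g (rest nu))"
    (is "(\<Sum>x\<in>?A. ?F x) = _")
proof -
  let ?M = "M_set d n lam mu T i"
  have bet: "between nu" if "nu \<in> ?M" for nu using that assms by (simp add: M_set_eq)
  have "(\<Sum>x\<in>?A. ?F x) = (\<Sum>x\<in>(\<lambda>nu. (nu, id)) ` ?M. ?F x)"
  proof (rule sum.mono_neutral_right)
    show "finite ?A" using finite_rank_set finite_terms by (intro finite_SigmaI)
    show "(\<lambda>nu. (nu, id)) ` ?M \<subseteq> ?A"
      using bet id_in_terms by (auto simp: M_set_def rank_set_def)
  qed auto
  also have "\<dots> = (\<Sum>nu\<in>?M. ?F (nu, id))"
    by (subst sum.reindex) (auto simp: inj_on_def)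
  also have "\<dots> = (\<Sum>nu\<in>?M. q_coef d nu * g (rest nu))"
    using bet by (intro sum.cong) (auto simp: term_entries_id)
  finally show ?thesis .
qed

lemma lifted_solution:
  fixes \<omega> :: "nat \<Rightarrow> complex"
  assumes eqs: "\<And>i. i < m \<Longrightarrow> ell m a i \<noteq> Pinf \<Longrightarrow> lead_sum d n lam mu m T pos i \<omega> = q_coef d lam * e_coef m a i"
    and det: "Determinant.det (jacobian d n lam mu m T pos \<omega>) \<noteq> 0"
  shows "\<exists>r Y. (\<forall>k<m. fps_nth (Y k) 0 = 0) \<and> (\<forall>i<m.
    (\<Sum>nu\<in>rank_set i. fin_monom (q_coef d nu) 0 *
      minor d (row_polys (\<lambda>k. scale k * puiseux_of_fps r (fps_const (\<omega> k) + Y k))) nu) =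
    fin_monom (q_coef d lam) 0 * elem_sym m a i)"
proof -
  obtain r where r: "\<And>k. k < m \<Longrightarrow> ramified r (a k)" using common_ramification[of m a] by blast
  \<comment> \<open>The coefficient of one Leibniz term after division of its equation by
    \<open>u^w\<close>, to be used with \<open>ell m a i = Fin w\<close>.\<close>
  define tc where "tc w nu p = fin_monom (q_coef d nu * of_int (sign p)) (- w) * term_scale nu p" for w nu p
  \<comment> \<open>Where \<open>ell m a i = \<infinity>\<close> there is nothing to solve; a dummy equation with the same gradient keeps
    the Jacobian of the system equal to \<open>jacobian\<close>.\<close>
  define C where "C i x = (case ell m a i of Fin w \<Rightarrow> fps_of_puiseux r (tc w (fst x) (snd x))
     | _ \<Rightarrow> fps_const (if snd x = id \<and> fst x \<in> M_set d n lam mu T i then q_coef d (fst x) else 0))" for i x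
  define c where "c i = (case ell m a i of Fin w \<Rightarrow> fps_of_puiseux r (fin_monom (q_coef d lam) (- w) * elem_sym m a i)
     | _ \<Rightarrow> fps_const (lead_sum d n lam mu m T pos i \<omega>))" for i
  let ?A = "\<lambda>i. Sigma (rank_set i) terms"
  let ?B = "\<lambda>x. term_entries (fst x) (snd x)"
  have Fin_le: "between nu \<and> Fin w \<le> val_tab T lam nu"
    if "ell m a i = Fin w" "nu \<in> rank_set i" "p \<in> terms nu" for i w nu p
  proof -
    have "between nu" using that term_between by (auto simp: rank_set_def)
    then show ?thesis using ell_le_val_tab[of nu i] that by (simp add: rank_set_def)
  qed
  have C0: "fps_nth (C i x) 0 = (if snd x = id \<and> fst x \<in> M_set d n lam mu T i then q_coef d (fst x) else 0)"
    if i: "i < m" and x: "x \<in> ?A i" for i x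
  proof (cases "ell m a i")
    case (Fin w)
    obtain nu p where np: "x = (nu, p)" by (cases x)
    have nu: "nu \<in> rank_set i" "p \<in> terms nu" "nu \<in> partitions d n" "sum_list nu = sum_list mu + i"
      using x np by (auto simp: rank_set_def)
    note bet = Fin_le[OF Fin nu(1,2)]
    have "fps_nth (C i x) 0 = q_coef d nu * of_int (sign p) * pcoeff (term_scale nu p) w"
      by (simp add: C_def Fin np fps_of_puiseux_nth_0 tc_def pcoeff_fin_monom_mult)
    also have "\<dots> = (if p = id \<and> val_tab T lam nu = Fin w then q_coef d nu else 0)"
      using term_scale_ord(2)[OF nu(3,2) conjunct2[OF bet]] by (simp add: sign_id)
    finally show ?thesis using i Fin nu bet by (simp add: np M_set_eq)
  qed (simp_all add: C_def)
  have c0: "fps_nth (c i) 0 = lead_sum d n lam mu m T pos i \<omega>" if i: "i < m" for i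
  proof (cases "ell m a i")
    case (Fin w)
    then show ?thesis using eqs[OF i]
      by (simp add: c_def fps_of_puiseux_nth_0 pcoeff_fin_monom_mult e_coef_def coeff_at_def)
  qed (simp_all add: c_def)
  have sum0: "(\<Sum>x\<in>?A i. fps_nth (C i x) 0 * g (?B x)) = (\<Sum>nu\<in>M_set d n lam mu T i. q_coef d nu * g (rest nu))"
    if i: "i < m" for i and g :: "nat set \<Rightarrow> complex"
    using sum_terms_id[of i g] i C0[OF i] by (simp cong: sum.cong)
  have lead: "(\<Sum>x\<in>?A i. fps_nth (C i x) 0 * (\<Prod>k\<in>?B x. \<omega> k)) = fps_nth (c i) 0" if "i < m" for i
    using sum0[OF that, of "\<lambda>S. \<Prod>k\<in>S. \<omega> k"] that by (simp add: c0 lead_sum_eq)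
  have "Matrix.mat m m (\<lambda>(i, j). \<Sum>x\<in>?A i. fps_nth (C i x) 0 * (if j \<in> ?B x then \<Prod>k\<in>?B x - {j}. \<omega> k else 0))
    = jacobian d n lam mu m T pos \<omega>"
    unfolding jacobian_eq
  proof (rule cong_mat[OF refl refl])
    fix i j assume "i < m" "j < m"
    then show "(case (i, j) of (i, j) \<Rightarrow> \<Sum>x\<in>?A i. fps_nth (C i x) 0 * (if j \<in> ?B x then \<Prod>k\<in>?B x - {j}. \<omega> k else 0)) =
      (case (i, j) of (i, j) \<Rightarrow> \<Sum>nu\<in>M_set d n lam mu T i. q_coef d nu * (if j \<in> rest nu then \<Prod>k\<in>rest nu - {j}. \<omega> k else 0))"
      using sum0[of i "\<lambda>S. if j \<in> S then \<Prod>k\<in>S - {j}. \<omega> k else 0"] by simp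
  qed
  with det have det': "Determinant.det (Matrix.mat m m (\<lambda>(i, j).
      \<Sum>x\<in>?A i. fps_nth (C i x) 0 * (if j \<in> ?B x then \<Prod>k\<in>?B x - {j}. \<omega> k else 0))) \<noteq> 0"
    by simp
  obtain Y where Y0: "\<And>j. j < m \<Longrightarrow> fps_nth (Y j) 0 = 0"
    and Y: "\<And>i. i < m \<Longrightarrow> (\<Sum>x\<in>?A i. C i x * (\<Prod>k\<in>?B x. fps_const (\<omega> k) + Y k)) = c i"
    using hensel_multiaffine[OF term_entries_subset lead det'] by blast
  define V where "V k = fps_const (\<omega> k) + Y k" for k
  define y where "y k = scale k * puiseux_of_fps r (V k)" for k
  have mon: "(\<Prod>k\<in>term_entries nu p. y k) = term_scale nu p * puiseux_of_fps r (\<Prod>k\<in>term_entries nu p. V k)" for nu p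
    by (simp add: y_def prod.distrib term_scale_def puiseux_of_fps_prod)
  have "(\<Sum>nu\<in>rank_set i. fin_monom (q_coef d nu) 0 * minor d (row_polys y) nu) =
      fin_monom (q_coef d lam) 0 * elem_sym m a i" (is "?L = ?R") if i: "i < m" for i
  proof (cases "ell m a i")
    case Minf
    then show ?thesis using ell_neq_Minf by simp
  next
    \<comment> \<open>Every Leibniz term contains the scale of a zero entry, so the left side
      vanishes for any \<open>Y\<close>, as does the elementary symmetric function.\<close>
    case Pinf
    have "minor d (row_polys y) nu = 0" if "nu \<in> rank_set i" for nu
      unfolding minor_rows
    proof (intro sum.neutral ballI)
      fix p assume p: "p \<in> terms nu"
      have nu: "nu \<in> partitions d n" "sum_list nu = sum_list mu + i" using that by (auto simp: rank_set_def)
      have "val_tab T lam nu = Pinf"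
        using ell_le_val_tab[OF term_between[OF nu(1) p] nu(2)] Pinf by simp
      then show "of_int (sign p) * (\<Prod>k\<in>term_entries nu p. y k) = 0"
        unfolding mon using term_scale_0[OF nu(1) p] by simp
    qed
    then show ?thesis by (simp add: elem_sym_0[OF Pinf])
  next
    case (Fin w)
    have wr: "- w * of_nat (Suc r) \<in> \<int>"
      using ell_ramified[OF r less_imp_le[OF i] Fin] by (simp del: of_nat_Suc)
    have C: "puiseux_of_fps r (C i (nu, p)) = tc w nu p" if "nu \<in> rank_set i" "p \<in> terms nu" for nu p
    proof -
      have "nu \<in> partitions d n" using that by (simp add: rank_set_def)
      then have "ord_ge (tc w nu p) 0"
        unfolding tc_def using Fin_le[OF Fin that] term_scale_ord(1)[OF _ that(2)] by (intro ord_ge_fin_monom_mult) simp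
      moreover have "ramified r (tc w nu p)"
        unfolding tc_def using r wr by (intro ramified_mult ramified_fin_monom ramified_term_scale)
      ultimately show ?thesis by (simp add: C_def Fin puiseux_of_fps_inverse integral_puiseux_iff)
    qed
    have c: "puiseux_of_fps r (c i) = fin_monom (q_coef d lam) (- w) * elem_sym m a i"
    proof -
      have "ord_ge (fin_monom (q_coef d lam) (- w) * elem_sym m a i) 0"
        using Fin by (intro ord_ge_fin_monom_mult elem_sym_ord) simp
      moreover have "ramified r (elem_sym m a i)"
        unfolding elem_sym_def using r by (intro ramified_sum ramified_prod) auto
      then have "ramified r (fin_monom (q_coef d lam) (- w) * elem_sym m a i)"
        using wr by (intro ramified_mult ramified_fin_monom)
      ultimately show ?thesis by (simp add: c_def Fin puiseux_of_fps_inverse integral_puiseux_iff)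
    qed
    \<comment> \<open>Divided by \<open>u^w\<close>, the wanted identity is the image of the lifted
      power series equation; the monomial is cancelled at the end.\<close>
    have "fin_monom 1 (- w) * ?L = (\<Sum>nu\<in>rank_set i. \<Sum>p\<in>terms nu.
        tc w nu p * puiseux_of_fps r (\<Prod>k\<in>term_entries nu p. V k))"
      unfolding sum_distrib_left minor_rows
    proof (intro sum.cong refl)
      fix nu and p :: "nat \<Rightarrow> nat"
      have "fin_monom (q_coef d nu * of_int (sign p)) (- w) =
          fin_monom 1 (- w) * (fin_monom (q_coef d nu) 0 * of_int (sign p))"
        by (simp add: of_int_puiseux fin_monom_mult)
      then show "fin_monom 1 (- w) * (fin_monom (q_coef d nu) 0 * (of_int (sign p) * (\<Prod>k\<in>term_entries nu p. y k))) =
          tc w nu p * puiseux_of_fps r (\<Prod>k\<in>term_entries nu p. V k)"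
        unfolding mon tc_def by (simp only: mult.assoc)
    qed
    also have "\<dots> = (\<Sum>x\<in>?A i. puiseux_of_fps r (C i x) * puiseux_of_fps r (\<Prod>k\<in>?B x. V k))"
      using finite_rank_set finite_terms C by (subst sum.Sigma) (auto intro!: sum.cong)
    also have "\<dots> = puiseux_of_fps r (c i)"
      using Y[OF i] by (simp add: puiseux_of_fps_sum[symmetric] puiseux_of_fps_hom(2)[symmetric] V_def)
    also have "\<dots> = fin_monom 1 (- w) * ?R"
      by (simp add: c mult.assoc[symmetric] fin_monom_mult)
    finally show ?thesis by simp
  qed
  then show ?thesis using Y0 unfolding y_def[abs_def] V_def by blast
qed

text \<open>The identity permutation supplies the coefficient of \<open>u^w\<close>, and all other
  terms start later. A finite exponent means that no zero entry lies outside \<open>nu\<close>, so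
  the product of the \<open>\<omega> k\<close> is nonzero, as \<open>LT_eq_monomI\<close>
  requires.\<close>

lemma LT_minor_rows:
  fixes \<omega> :: "nat \<Rightarrow> complex"
  assumes Y0: "\<And>k. k < m \<Longrightarrow> fps_nth (Y k) 0 = 0"
    and nz: "\<And>k. k < m \<Longrightarrow> a k \<noteq> 0 \<Longrightarrow> \<omega> k \<noteq> 0" and nu: "nu \<in> partitions d n"
  shows "LT (minor d (row_polys (\<lambda>k. scale k * puiseux_of_fps r (fps_const (\<omega> k) + Y k))) nu) =
    pmonom (Omega lam mu m pos \<omega> nu) (val_tab T lam nu)"
proof (cases "between nu")
  case False
  then show ?thesis using nu by (simp add: minor_rows_not_between Omega_0)
next
  case bet: True
  define V where "V k = fps_const (\<omega> k) + Y k" for k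
  define t where "t p = of_int (sign p) * (term_scale nu p * puiseux_of_fps r (\<Prod>k\<in>term_entries nu p. V k))" for p
  have minor: "minor d (row_polys (\<lambda>k. scale k * puiseux_of_fps r (fps_const (\<omega> k) + Y k))) nu = (\<Sum>p\<in>terms nu. t p)"
    by (simp add: minor_rows t_def prod.distrib term_scale_def puiseux_of_fps_prod V_def)
  show ?thesis
  proof (cases "val_tab T lam nu")
    case Pinf
    then show ?thesis unfolding minor by (simp add: t_def term_scale_0[OF nu])
  next
    case Minf
    then show ?thesis
      using sum_eq_Pinf_iff[where v = "\<lambda>k. val (a k)", OF finite_rest val_neq_Minf, of nu] val_tab_eq[OF bet] by simp
  next
    case (Fin w)
    have ord: "ord_ge (t p) w" and co: "pcoeff (t p) w = (if p = id then \<Prod>k\<in>rest nu. \<omega> k else 0)"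
      if p: "p \<in> terms nu" for p
    proof -
      let ?H = "puiseux_of_fps r (\<Prod>k\<in>term_entries nu p. V k)"
      have H: "ord_ge ?H 0" by (simp add: ord_ge_def pcoeff_puiseux_of_fps)
      note ts = term_scale_ord[OF nu p, of w, unfolded Fin, OF order.refl]
      have 1: "ord_ge (term_scale nu p * ?H) w"
        using ord_ge_mult[OF ts(1) H] by simp
      have 2: "pcoeff (term_scale nu p * ?H) w = pcoeff (term_scale nu p) w * pcoeff ?H 0"
        using pcoeff_mult_low[OF ts(1) H] by simp
      show "ord_ge (t p) w"
        unfolding t_def of_int_puiseux using 1 by (simp add: ord_ge_def pcoeff_fin_monom_mult)
      have "pcoeff (t p) w = of_int (sign p) * (pcoeff (term_scale nu p) w * pcoeff ?H 0)"
        unfolding t_def of_int_puiseux pcoeff_fin_monom_mult using 2 by simp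
      also have "pcoeff ?H 0 = (\<Prod>k\<in>term_entries nu p. fps_nth (V k) 0)"
        by (simp add: pcoeff_puiseux_of_fps fps_prod_nth_0)
      also have "\<dots> = (\<Prod>k\<in>term_entries nu p. \<omega> k)"
        using term_entries_subset[of nu p] Y0 by (intro prod.cong) (auto simp: V_def)
      finally show "pcoeff (t p) w = (if p = id then \<Prod>k\<in>rest nu. \<omega> k else 0)"
        by (simp add: ts(2) term_entries_id[OF bet] sign_id)
    qed
    have "pcoeff (\<Sum>p\<in>terms nu. t p) w = (\<Prod>k\<in>rest nu. \<omega> k)"
      using co finite_terms[of nu] id_in_terms[OF bet] by (simp add: sum.delta)
    moreover have "ord_ge (\<Sum>p\<in>terms nu. t p) w" by (rule ord_ge_sum) (rule ord)
    moreover have "(\<Prod>k\<in>rest nu. \<omega> k) \<noteq> 0"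
    proof -
      have "\<forall>k\<in>rest nu. a k \<noteq> 0"
        using sum_eq_Pinf_iff[where v = "\<lambda>k. val (a k)", OF finite_rest val_neq_Minf, of nu] Fin val_tab_eq[OF bet] by auto
      then show ?thesis using nz rest_subset[of nu] by (auto simp: prod_zero_iff)
    qed
    ultimately show ?thesis unfolding minor Fin Omega_eq[OF bet] by (intro LT_eq_monomI)
  qed
qed

lemma point_exists:
  fixes \<omega> :: "nat \<Rightarrow> complex"
  assumes eqs: "\<And>i. i < m \<Longrightarrow> ell m a i \<noteq> Pinf \<Longrightarrow> lead_sum d n lam mu m T pos i \<omega> = q_coef d lam * e_coef m a i"
    and det: "Determinant.det (jacobian d n lam mu m T pos \<omega>) \<noteq> 0"
  shows "\<exists>x \<in> wronski_fibre d n (a_plus d n lam mu (image_mset a (mset_set {..<m}))).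
    \<exists>p. plucker_coords d n x p \<and>
      (\<forall>nu\<in>partitions d n. LT (p nu) = pmonom (Omega lam mu m pos \<omega> nu) (val_tab T lam nu))"
proof -
  obtain r Y where Y0: "\<And>k. k < m \<Longrightarrow> fps_nth (Y k) 0 = 0"
    and Y: "\<And>i. i < m \<Longrightarrow>
      (\<Sum>nu\<in>rank_set i. fin_monom (q_coef d nu) 0 *
        minor d (row_polys (\<lambda>k. scale k * puiseux_of_fps r (fps_const (\<omega> k) + Y k))) nu) =
      fin_monom (q_coef d lam) 0 * elem_sym m a i"
    using lifted_solution[OF eqs det] by auto
  define f where "f = row_polys (\<lambda>k. scale k * puiseux_of_fps r (fps_const (\<omega> k) + Y k))"
  define x where "x = poly_vs.span (f ` {..<d})"
  have "x \<in> Gr d n" unfolding x_def f_def by (rule span_rows_Gr)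
  moreover have "spans d f x" by (simp add: spans_def x_def)
  moreover have "fin_monom (q_coef d lam) 0 \<noteq> 0" using q_coef_nz[OF lam] by simp
  moreover have "wronskian d f = Polynomial.smult (fin_monom (q_coef d lam) 0)
    (\<Prod>\<^sub># (image_mset root_factor (a_plus d n lam mu (image_mset a (mset_set {..<m})))))"
    unfolding f_def by (rule wronskian_rows[OF Y])
  ultimately have "x \<in> wronski_fibre d n (a_plus d n lam mu (image_mset a (mset_set {..<m})))"
    unfolding wronski_fibre_def by blast
  moreover have "plucker_coords d n x (minor d f)"
    unfolding plucker_coords_def using \<open>spans d f x\<close> by (intro exI[of _ f] exI[of _ 1]) simp
  moreover have "LT (minor d f nu) = pmonom (Omega lam mu m pos \<omega> nu) (val_tab T lam nu)"
    if "nu \<in> partitions d n" for nu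
    unfolding f_def by (rule LT_minor_rows[OF Y0 omega_nonzero[OF eqs] that])
  ultimately show ?thesis by blast
qed

end

theorem theorem4p2:
  fixes d n m :: nat
    and \<epsilon> :: real
    and lam mu :: "nat list"
    and a :: "nat \<Rightarrow> puiseux"
    and T :: "nat \<times> nat \<Rightarrow> puiseux"
    and pos :: "nat \<Rightarrow> nat \<times> nat"
    and \<omega> :: "nat \<Rightarrow> complex"
  assumes "0 < d" and "d < n"
    and "0 < \<epsilon>" and "\<epsilon> < 1"
    and "lam \<in> partitions d n" and "mu \<in> partitions d n" and "mu \<preceq> lam"
    and "m = card (skew lam mu)"
    and "diagram mu \<noteq> {} \<Longrightarrow> 0 \<notin> a ` {..<m}"
    and "T \<in> DIT \<epsilon> lam mu (image_mset a (mset_set {..<m}))"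
    and "bij_betw pos {..<m} (skew lam mu)" and "\<And>k. k < m \<Longrightarrow> T (pos k) = a k"
    and "Determinant.det (jacobian d n lam mu m T pos \<omega>) \<noteq> 0"
  shows "(\<exists>x \<in> wronski_fibre d n (a_plus d n lam mu (image_mset a (mset_set {..<m}))).
            \<exists>p. plucker_coords d n x p \<and>
              (\<forall>nu\<in>partitions d n.
                 LT (p nu) = pmonom (Omega lam mu m pos \<omega> nu) (val_tab T lam nu)))
         \<longleftrightarrow> (\<forall>i<m. ell m a i \<noteq> Pinf \<longrightarrow>
                lead_sum d n lam mu m T pos i \<omega> = q_coef d lam * e_coef m a i)"
proof -
  interpret tableau_setup d n m \<epsilon> lam mu a T pos
    by unfold_locales (use assms in auto)
  show ?thesis
    using leading_coefficients point_exists[OF _ assms(13)] by blast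
qed

end
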